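(* Let $k\in\mathbb Z$, $m\in\mathbb Z/(q-1)\mathbb Z$, $\mathcal H=\binom{h_1}{h_2}\in\mathbb M_k^m(\rho_t^* )$, and let $\zeta\in\mathbb F_q^{ac}\subset\mathbb C_\infty$ have minimal polynomial $\mathfrak p\in A$. Then for each $l=0,1,\dots,\deg(\mathfrak p)-1$: $$\mathrm{ev}_{\zeta^{q^l}}(h_1)\in M_k^{m+1}(\mathfrak p,\eta_\zeta^{q^l}),\qquad \mathrm{ev}_{\zeta^{q^l}}(h_1)|_k^m[W_{\mathfrak p}]=-\mathrm{ev}_{\zeta^{q^l}}(h_2)|_k^m[\alpha_{\mathfrak p}]\in M_k^m(\mathfrak p,\eta_\zeta^{-q^l}).$$
   Context: Notation: $q$ a prime power, $A=\mathbb F_q[\theta]$, $K_\infty=\mathbb F_q((1/\theta))$, $\mathbb C_\infty$ the completion of an algebraic closure of $K_\infty$, $\mathbb F_q^{ac}$ the algebraic closure of $\mathbb F_q$ in $\mathbb C_\infty$. $\Omega=\mathbb C_\infty\setminus K_\infty$, $|z|_\Im=\inf_{\kappa\in K_\infty}|z-\kappa|$, $\mathrm{GL}_2(K)$ acts by Möbius transformations, $j(\gamma,z)=cz+d$. $\mathbb T$ is the Tate algebra of series $\sum f_it^i$ with $f_i\in\mathbb C_\infty$, $f_i\to0$; for $\xi\in\mathbb F_q^{ac}$, $\mathrm{ev}_\xi(\sum f_it^i)=\sum f_i\xi^i$, applied pointwise to functions $\Omega\to\mathbb T$. $a(t)$ is the image of $a\in A$ under $\theta\mapsto t$. $u(z)=\widetilde\pi^{-1}\sum_{a\in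 A}(z-a)^{-1}$ with $\widetilde\pi$ the Carlitz period. Rigid analytic: uniform limit on each $\Omega_n=\{|z|\le q^n,|z|_\Im\ge q^{-n}\}$ of rational functions in $\mathbb T(z)$ without poles there; tempered: $u^Nf\to0$ as $|z|_\Im\to\infty$ for some $N$. $\rho_t^*(\gamma)=(ad-bc)^{-1}\begin{pmatrix}d(t)&-c(t)\\-b(t)&a(t)\end{pmatrix}$; $\mathbb M_k^m(\rho_t^* )$ is the $\mathbb T$-module of $\mathcal H=\binom{h_1}{h_2}:\Omega\to\mathbb T^2$ with tempered rigid analytic coordinates, $\mathcal H(\gamma z)=j(\gamma,z)^k\det(\gamma)^{-m}\rho_t^*(\gamma)\mathcal H(z)$ for all $\gamma\in\mathrm{GL}_2(A)$, and $h_1(z)\to0$, $u(z)h_2(z)\to0$ as $|z|_\Im\to\infty$. Slash operator: $(f|_k^m[\gamma])(z)=\det(\gamma)^mj(\gamma,z)^{-k}f(\gamma z)$. $\alpha_{\mathfrak p}=\begin{pmatrix}\mathfrak p&0\\0&1\end{pmatrix}$, $W_{\mathfrak p}=\begin{pmatrix}0&-1\\\mathfrak p&0\end{pmatrix}$. $\Gamma_0(\mathfrak p)=\{\gamma\in\mathrm{GL}_2(A):c\equiv0\bmod\mathfrak p\}$; $\eta_\zeta:\Gamma_0(\mathfrak p)\to\mathbb F_q(\zeta)^\times$, $\gamma\mapsto d(\zeta)$; $\Gamma_1(\mathfrak p)=\ker\eta_\zeta$. For a congruence subgroup $\Gamma$, $M_k^m(\Gamma)$ is the space of rigid analytic $f:\Omega\to\mathbb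 C_\infty$ with $f|_k^m[\gamma]=f$ for $\gamma\in\Gamma$ and $f|_k^m[\gamma]$ bounded on $\{|z|_\Im\ge1\}$ for all $\gamma\in\mathrm{GL}_2(A)$. $M_k^m(\mathfrak p,\eta_\zeta^l)=\{f\in M_k^m(\Gamma_1(\mathfrak p)):f|_k^m[\gamma]=\eta_\zeta(\gamma)^lf\ \forall\gamma\in\Gamma_0(\mathfrak p)\}$. *)

theory Defs
  imports "HOL-Analysis.Analysis" "HOL-Computational_Algebra.Polynomial" "HOL-Computational_Algebra.Primes"
begin

text \<open>The ambient type 'c plays the role of C_infinity. Its absolute value is the
distance to 0. q is the prime power, th is the element theta.\<close>

definition cabs :: "'c::{zero,metric_space} \<Rightarrow> real" where
  "cabs x = dist x 0"

definition Fqset :: "nat \<Rightarrow> 'c::field set" where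
  "Fqset q = {x. x ^ q = x}"

definition Fqpoly :: "nat \<Rightarrow> 'c::field poly \<Rightarrow> bool" where
  "Fqpoly q p \<longleftrightarrow> (\<forall>i. coeff p i \<in> Fqset q)"

definition Kinf :: "nat \<Rightarrow> 'c::{field,metric_space} \<Rightarrow> 'c set" where
  "Kinf q th = {x. \<forall>e>0. \<exists>a b. Fqpoly q a \<and> Fqpoly q b \<and> poly b th \<noteq> 0 \<and>
                    cabs (x - poly a th / poly b th) < e}"

definition algebraic_over :: "'c::field set \<Rightarrow> 'c \<Rightarrow> bool" where
  "algebraic_over K y \<longleftrightarrow> (\<exists>p. p \<noteq> 0 \<and> (\<forall>i. coeff p i \<in> K) \<and> poly p y = 0)"

text \<open>C_infinity: complete, algebraically closed, non-archimedean valued field of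
characteristic p containing F_q(theta) with theta transcendental over F_q, |theta| = q,
in which the algebraic closure of K_infinity is dense. These properties characterise
C_infinity up to isometric isomorphism.\<close>
definition is_Cinf :: "nat \<Rightarrow> 'c::{field,complete_space} \<Rightarrow> bool" where
  "is_Cinf q th \<longleftrightarrow>
     (\<exists>p r. prime (p::nat) \<and> r > 0 \<and> q = p ^ r \<and> of_nat p = (0::'c)) \<and>
     (\<forall>x y::'c. dist x y = cabs (x - y)) \<and>
     (\<forall>x y::'c. cabs (x * y) = cabs x * cabs y) \<and>
     (\<forall>x y::'c. cabs (x + y) \<le> max (cabs x) (cabs y)) \<and>
     (\<forall>p::'c poly. degree p \<ge> 1 \<longrightarrow> (\<exists>x. poly p x = 0)) \<and>
     (\<forall>p. Fqpoly q p \<and> poly p th = 0 \<longrightarrow> p = 0) \<and>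
     cabs th = real q \<and>
     (\<forall>x::'c. \<forall>e>0. \<exists>y. algebraic_over (Kinf q th) y \<and> cabs (x - y) < e)"

definition Fq_ac :: "nat \<Rightarrow> 'c::field set" where
  "Fq_ac q = {x. \<exists>n\<ge>1. x ^ (q ^ n) = x}"

text \<open>Minimal polynomial over F_q (variable read as theta, giving an element of A).\<close>
definition minpoly_Fq :: "nat \<Rightarrow> 'c::field \<Rightarrow> 'c poly \<Rightarrow> bool" where
  "minpoly_Fq q z p \<longleftrightarrow> Fqpoly q p \<and> lead_coeff p = 1 \<and> poly p z = 0 \<and>
     (\<forall>g. Fqpoly q g \<and> g \<noteq> 0 \<and> poly g z = 0 \<longrightarrow> degree p \<le> degree g)"

definition Omega :: "nat \<Rightarrow> 'c::{field,metric_space} \<Rightarrow> 'c set" where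
  "Omega q th = UNIV - Kinf q th"

definition imnorm :: "nat \<Rightarrow> 'c::{field,metric_space} \<Rightarrow> 'c \<Rightarrow> real" where
  "imnorm q th z = (INF k\<in>Kinf q th. cabs (z - k))"

definition Omega_n :: "nat \<Rightarrow> 'c::{field,metric_space} \<Rightarrow> nat \<Rightarrow> 'c set" where
  "Omega_n q th n = {z. cabs z \<le> real q ^ n \<and> imnorm q th z \<ge> inverse (real q ^ n)}"

definition Aset :: "nat \<Rightarrow> 'c::field \<Rightarrow> 'c set" where
  "Aset q th = {poly a th | a. Fqpoly q a}"

text \<open>The polynomial a with a(theta) = x (unique since theta is transcendental).\<close>
definition Apoly :: "nat \<Rightarrow> 'c::field \<Rightarrow> 'c \<Rightarrow> 'c poly" where
  "Apoly q th x = (THE a. Fqpoly q a \<and> poly a th = x)"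

type_synonym 'c mat2 = "'c \<times> 'c \<times> 'c \<times> 'c"

definition GL2A :: "nat \<Rightarrow> 'c::field \<Rightarrow> 'c mat2 set" where
  "GL2A q th = {(a,b,c,d). a \<in> Aset q th \<and> b \<in> Aset q th \<and> c \<in> Aset q th \<and> d \<in> Aset q th \<and>
                 a * d - b * c \<in> Fqset q - {0}}"

definition mob :: "'c::field mat2 \<Rightarrow> 'c \<Rightarrow> 'c" where
  "mob g z = (case g of (a,b,c,d) \<Rightarrow> (a * z + b) / (c * z + d))"

definition jfac :: "'c::field mat2 \<Rightarrow> 'c \<Rightarrow> 'c" where
  "jfac g z = (case g of (a,b,c,d) \<Rightarrow> c * z + d)"

definition mdet :: "'c::field mat2 \<Rightarrow> 'c" where
  "mdet g = (case g of (a,b,c,d) \<Rightarrow> a * d - b * c)"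

definition slash :: "int \<Rightarrow> int \<Rightarrow> 'c::field mat2 \<Rightarrow> ('c \<Rightarrow> 'c) \<Rightarrow> 'c \<Rightarrow> 'c" where
  "slash k m g f z = mdet g powi m * jfac g z powi (- k) * f (mob g z)"

type_synonym 'c tate = "nat \<Rightarrow> 'c"

definition tate :: "'c::{zero,metric_space} tate \<Rightarrow> bool" where
  "tate f \<longleftrightarrow> (\<lambda>i. cabs (f i)) \<longlonglongrightarrow> 0"

definition tmult :: "'c::comm_ring_1 tate \<Rightarrow> 'c tate \<Rightarrow> 'c tate" where
  "tmult f g = (\<lambda>i. \<Sum>j\<le>i. f j * g (i - j))"

definition tone :: "'c::comm_ring_1 tate" where
  "tone = (\<lambda>i. if i = 0 then 1 else 0)"

definition tunit :: "'c::{comm_ring_1,metric_space} tate \<Rightarrow> bool" where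
  "tunit g \<longleftrightarrow> (\<exists>h. tate h \<and> tmult g h = tone)"

definition tinv :: "'c::{comm_ring_1,metric_space} tate \<Rightarrow> 'c tate" where
  "tinv g = (SOME h. tate h \<and> tmult g h = tone)"

definition gnorm :: "'c::{zero,metric_space} tate \<Rightarrow> real" where
  "gnorm f = (SUP i. cabs (f i))"

definition tscal :: "'c::times \<Rightarrow> 'c tate \<Rightarrow> 'c tate" where
  "tscal s f = (\<lambda>i. s * f i)"

definition tpolyeval :: "'c::comm_ring_1 tate list \<Rightarrow> 'c \<Rightarrow> 'c tate" where
  "tpolyeval Ps z = (\<lambda>i. \<Sum>j<length Ps. (Ps ! j) i * z ^ j)"

text \<open>a(t): image of a in A under theta to t, as an element of T.\<close>
definition tA :: "nat \<Rightarrow> 'c::field \<Rightarrow> 'c \<Rightarrow> 'c tate" where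
  "tA q th x = (\<lambda>i. coeff (Apoly q th x) i)"

definition ev :: "'c::{field,metric_space} tate \<Rightarrow> 'c \<Rightarrow> 'c" where
  "ev f xi = (\<Sum>i. f i * xi ^ i)"

definition rigidT :: "nat \<Rightarrow> 'c::{field,metric_space} \<Rightarrow> ('c \<Rightarrow> 'c tate) \<Rightarrow> bool" where
  "rigidT q th h \<longleftrightarrow> (\<forall>z\<in>Omega q th. tate (h z)) \<and>
     (\<forall>n::nat. \<forall>e>0. \<exists>Ps Qs. (\<forall>P\<in>set Ps. tate P) \<and> (\<forall>Q\<in>set Qs. tate Q) \<and>
        (\<forall>z\<in>Omega_n q th n. tunit (tpolyeval Qs z) \<and>
           gnorm (\<lambda>i. h z i - tmult (tpolyeval Ps z) (tinv (tpolyeval Qs z)) i) < e))"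

definition rigidC :: "nat \<Rightarrow> 'c::{field,metric_space} \<Rightarrow> ('c \<Rightarrow> 'c) \<Rightarrow> bool" where
  "rigidC q th f \<longleftrightarrow>
     (\<forall>n::nat. \<forall>e>0. \<exists>P Q. \<forall>z\<in>Omega_n q th n. poly Q z \<noteq> 0 \<and>
        cabs (f z - poly P z / poly Q z) < e)"

definition tends0Im :: "nat \<Rightarrow> 'c::{field,metric_space} \<Rightarrow> ('c \<Rightarrow> real) \<Rightarrow> bool" where
  "tends0Im q th g \<longleftrightarrow> (\<forall>e>0. \<exists>R. \<forall>z\<in>Omega q th. imnorm q th z \<ge> R \<longrightarrow> \<bar>g z\<bar> < e)"

text \<open>Carlitz period: pi^(q-1) = -theta^q / P^(q-1), P = prod_(i>=1) (1 - theta^(1-q^i)).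
 Determined up to a factor in F_q^x, which does not affect anything below.\<close>
definition carlitz_period :: "nat \<Rightarrow> 'c::{field,metric_space} \<Rightarrow> 'c" where
  "carlitz_period q th = (SOME x. \<exists>P. P \<noteq> 0 \<and>
      (\<lambda>n. \<Prod>i\<in>{1..n}. (1 - inverse (th ^ (q ^ i - 1)))) \<longlonglongrightarrow> P \<and>
      x ^ (q - 1) = - (th ^ q) / P ^ (q - 1))"

definition uC :: "nat \<Rightarrow> 'c::{field,metric_space} \<Rightarrow> 'c \<Rightarrow> 'c" where
  "uC q th z = inverse (carlitz_period q th) * infsum (\<lambda>a. inverse (z - a)) (Aset q th)"

definition temperedT :: "nat \<Rightarrow> 'c::{field,metric_space} \<Rightarrow> ('c \<Rightarrow> 'c tate) \<Rightarrow> bool" where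
  "temperedT q th h \<longleftrightarrow> (\<exists>N::nat. tends0Im q th (\<lambda>z. gnorm (tscal (uC q th z ^ N) (h z))))"

definition vmf :: "nat \<Rightarrow> 'c::{field,metric_space} \<Rightarrow> int \<Rightarrow> int \<Rightarrow>
                   ('c \<Rightarrow> 'c tate) \<Rightarrow> ('c \<Rightarrow> 'c tate) \<Rightarrow> bool" where
  "vmf q th k m h1 h2 \<longleftrightarrow>
     rigidT q th h1 \<and> rigidT q th h2 \<and> temperedT q th h1 \<and> temperedT q th h2 \<and>
     (\<forall>g\<in>GL2A q th. \<forall>z\<in>Omega q th. (case g of (a,b,c,d) \<Rightarrow>
        h1 (mob g z) = tscal (jfac g z powi k * mdet g powi (- m) * inverse (mdet g))
                         (\<lambda>i. tmult (tA q th d) (h1 z) i - tmult (tA q th c) (h2 z) i) \<and>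
        h2 (mob g z) = tscal (jfac g z powi k * mdet g powi (- m) * inverse (mdet g))
                         (\<lambda>i. tmult (tA q th a) (h2 z) i - tmult (tA q th b) (h1 z) i))) \<and>
     tends0Im q th (\<lambda>z. gnorm (h1 z)) \<and>
     tends0Im q th (\<lambda>z. gnorm (tscal (uC q th z) (h2 z)))"

definition Gamma0 :: "nat \<Rightarrow> 'c::field \<Rightarrow> 'c poly \<Rightarrow> 'c mat2 set" where
  "Gamma0 q th p = {g \<in> GL2A q th. case g of (a,b,c,d) \<Rightarrow> (\<exists>e\<in>Aset q th. c = poly p th * e)}"

definition eta :: "nat \<Rightarrow> 'c::field \<Rightarrow> 'c \<Rightarrow> 'c mat2 \<Rightarrow> 'c" where
  "eta q th zeta g = (case g of (a,b,c,d) \<Rightarrow> poly (Apoly q th d) zeta)"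

definition Gamma1 :: "nat \<Rightarrow> 'c::field \<Rightarrow> 'c poly \<Rightarrow> 'c \<Rightarrow> 'c mat2 set" where
  "Gamma1 q th p zeta = {g \<in> Gamma0 q th p. eta q th zeta g = 1}"

definition mfG :: "nat \<Rightarrow> 'c::{field,metric_space} \<Rightarrow> 'c mat2 set \<Rightarrow> int \<Rightarrow> int \<Rightarrow> ('c \<Rightarrow> 'c) \<Rightarrow> bool" where
  "mfG q th G k m f \<longleftrightarrow> rigidC q th f \<and>
     (\<forall>g\<in>G. \<forall>z\<in>Omega q th. slash k m g f z = f z) \<and>
     (\<forall>g\<in>GL2A q th. \<exists>B. \<forall>z\<in>Omega q th. imnorm q th z \<ge> 1 \<longrightarrow> cabs (slash k m g f z) \<le> B)"

definition mfchar :: "nat \<Rightarrow> 'c::{field,metric_space} \<Rightarrow> 'c poly \<Rightarrow> 'c \<Rightarrow> int \<Rightarrow> int \<Rightarrow> int \<Rightarrow> ('c \<Rightarrow> 'c) \<Rightarrow> bool" where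
  "mfchar q th p zeta k m l f \<longleftrightarrow> mfG q th (Gamma1 q th p zeta) k m f \<and>
     (\<forall>g\<in>Gamma0 q th p. \<forall>z\<in>Omega q th. slash k m g f z = eta q th zeta g powi l * f z)"

definition alpha_p :: "'c::field \<Rightarrow> 'c poly \<Rightarrow> 'c mat2" where
  "alpha_p th p = (poly p th, 0, 0, 1)"

definition W_p :: "'c::field \<Rightarrow> 'c poly \<Rightarrow> 'c mat2" where
  "W_p th p = (0, -1, poly p th, 0)"

end

theory Submission
  imports Defs
begin

text \<open>
  Evaluation at a root of unity \<open>\<xi>\<close> is a ring homomorphism on the Tate algebra, so \<open>f\<^sub>1 = ev\<^sub>\<xi> h\<^sub>1\<close> and
  \<open>f\<^sub>2 = ev\<^sub>\<xi> h\<^sub>2\<close> inherit the transformation law of the vectorial form, and everything but the behaviour at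
  the cusps is algebra. For the cusps one needs that \<open>f\<^sub>2\<close> is bounded on \<open>\<bar>z\<bar>\<^sub>\<Im> \<ge> 1\<close>, given only that
  \<open>u f\<^sub>2 \<rightarrow> 0\<close>, \<open>f\<^sub>1 \<rightarrow> 0\<close> and \<open>f\<^sub>2(z + a) = f\<^sub>2(z) - a(\<xi>) f\<^sub>1(z)\<close> for \<open>a \<in> A\<close>.

  Instead of expanding in \<open>u\<close>, we use Cauchy's formula on the region bounded by a circle of radius
  \<open>q\<^sup>N\<^sup>+\<^sup>1\<^sup>/\<^sup>2\<close> and by the circles of radius \<open>q\<^sup>-\<^sup>1\<^sup>/\<^sup>2\<close> around the elements of \<open>A\<close> of degree at most \<open>N\<close>, with
  residues computed as limits of averages over roots of unity. By the translation law and the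
  ultrametric inequality the small circles contribute a bounded amount. The contribution of the large circle,
  as a function of \<open>z\<close>, is interpolated at the lattice points of degree at most \<open>N\<close>: its values there differ by
  at most the supremum of \<open>\<bar>f\<^sub>1\<bar>\<close> on the circle, and the interpolation error is controlled by \<open>u f\<^sub>2 \<rightarrow> 0\<close>. Letting
  \<open>N \<rightarrow> \<infinity>\<close>, the values of \<open>f\<^sub>2\<close> at any two points of \<open>\<bar>z\<bar>\<^sub>\<Im> \<ge> 1\<close> differ by a bounded amount.
\<close>

text \<open>An expansion of \<open>f2\<close> in u is not directly available because
  \<open>f2\<close> is not A-periodic: translation by a adds -a(\<xi>) \<open>f1\<close>. This
  correction is small far out, since |a(\<xi>)| \<le> 1 and \<open>f1\<close> tends to 0. The
  condition on u \<open>f2\<close> enters only through the size of u on the large circles, where |u|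
  is the inverse of the absolute value of the period times |D / e(z)|, for the lattice polynomial e
  and its constant derivative D. Only the cusp at infinity needs analysis. The vectorial law holds
  on all of GL_2(A), so slashing \<open>f1\<close> by any \<gamma> gives d(\<xi>) \<open>f1\<close>
  - c(\<xi>) \<open>f2\<close>. For \<open>f2\<close> slashed by \<alpha>, the product
  \<alpha>\<gamma> is written as an element of GL_2(A) times diag(p, 1) if p divides c, and times
  (1, x; 0, p) otherwise. In the second case \<open>f2\<close> gets the factor (pa)(\<xi>) = 0 and
  only \<open>f1\<close> survives, at a point with |z|_Im \<ge> 1/|p|; hence bounds below height 1
  are needed too. The characters come from two facts: evaluation at \<xi> kills the multiples of p,
  and Frobenius gives d(\<xi>) = d(\<zeta>)^(q^l).\<close>

locale Cinf_field =
  fixes q :: nat and th :: "'c::{field,complete_space}"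
  assumes Cinf: "is_Cinf q th"
begin

subsection \<open>The absolute value\<close>

lemma dist_cabs: "dist x y = cabs (x - y)" for x y :: 'c
  using Cinf[unfolded is_Cinf_def, THEN conjunct2, THEN conjunct1] by blast

lemma cabs_mult: "cabs (x * y) = cabs x * cabs y" for x y :: 'c
  using Cinf[unfolded is_Cinf_def, THEN conjunct2, THEN conjunct2, THEN conjunct1] by blast

lemma cabs_add_le_max: "cabs (x + y) \<le> max (cabs x) (cabs y)" for x y :: 'c
  using Cinf[unfolded is_Cinf_def, THEN conjunct2, THEN conjunct2, THEN conjunct2, THEN conjunct1] by blast

lemma exists_root: "degree f \<ge> 1 \<Longrightarrow> \<exists>x. poly f x = 0" for f :: "'c poly"
  using Cinf[unfolded is_Cinf_def, THEN conjunct2, THEN conjunct2, THEN conjunct2, THEN conjunct2, THEN conjunct1] by blast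

lemma th_transcendental: "Fqpoly q f \<Longrightarrow> poly f th = 0 \<Longrightarrow> f = 0"
  using Cinf[unfolded is_Cinf_def, THEN conjunct2, THEN conjunct2, THEN conjunct2, THEN conjunct2, THEN conjunct2, THEN conjunct1] by blast

lemma cabs_th: "cabs th = real q"
  using Cinf[unfolded is_Cinf_def, THEN conjunct2, THEN conjunct2, THEN conjunct2, THEN conjunct2, THEN conjunct2, THEN conjunct2, THEN conjunct1] by blast

text \<open>Identifying p with the characteristic makes the Frobenius identity applicable to powers
  of q.\<close>

lemma q_prime_power_char: "\<exists>p r. prime p \<and> r > 0 \<and> q = p ^ r \<and> CHAR('c) = p"
proof -
  obtain p r where p: "prime (p::nat)" "r > 0" "q = p ^ r" "of_nat p = (0::'c)"
    using Cinf[unfolded is_Cinf_def, THEN conjunct1] by blast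
  have "CHAR('c) dvd p"
    using p(4) by (simp add: of_nat_eq_0_iff_char_dvd)
  moreover have "CHAR('c) \<noteq> 1"
    by (metis of_nat_1 of_nat_CHAR zero_neq_one)
  ultimately have "CHAR('c) = p"
    using p(1) by (metis prime_nat_iff)
  with p show ?thesis by blast
qed

lemma prime_char: "prime CHAR('c)"
  using q_prime_power_char by blast

lemma q_power_char: "\<exists>r. q ^ n = CHAR('c) ^ r"
proof -
  obtain p s where "q = p ^ s" "CHAR('c) = p"
    using q_prime_power_char by blast
  then show ?thesis
    by (intro exI[of _ "s * n"]) (simp add: power_mult)
qed

lemma q_ge_2: "q \<ge> 2"
proof -
  obtain p r where "prime p" "r > 0" "q = p ^ r"
    using q_prime_power_char by blast
  then show ?thesis
    using prime_ge_2_nat[of p] self_le_power[of p r] by auto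
qed

lemma real_q_gt_1: "real q > 1"
  using q_ge_2 by simp

lemma frobenius_add: "(x + y) ^ (q ^ n) = x ^ (q ^ n) + y ^ (q ^ n)" for x y :: 'c
proof -
  obtain r where "q ^ n = CHAR('c) ^ r"
    using q_power_char by blast
  then show ?thesis
    by (rule freshmans_dream'[OF prime_char])
qed

lemma cabs_0 [simp]: "cabs (0::'c) = 0"
  by (simp add: cabs_def)

lemma cabs_nonneg [simp]: "cabs (x::'c) \<ge> 0"
  by (simp add: cabs_def)

lemma cabs_eq_0_iff [simp]: "cabs x = 0 \<longleftrightarrow> x = 0" for x :: 'c
  by (simp add: cabs_def)

lemma cabs_pos_iff [simp]: "cabs x > 0 \<longleftrightarrow> x \<noteq> 0" for x :: 'c
  by (simp add: cabs_def)

lemma cabs_1 [simp]: "cabs (1::'c) = 1"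
  using cabs_mult[of 1 1] by (simp add: cabs_def)

lemma cabs_power: "cabs (x ^ n) = cabs x ^ n" for x :: 'c
  by (induction n) (auto simp: cabs_mult)

lemma cabs_minus [simp]: "cabs (- x) = cabs x" for x :: 'c
  using dist_cabs[of 0 x] by (simp add: cabs_def dist_commute)

lemma cabs_minus_commute: "cabs (x - y) = cabs (y - x)" for x y :: 'c
  using cabs_minus[of "x - y"] by simp

lemma cabs_diff_le_max: "cabs (x - y) \<le> max (cabs x) (cabs y)" for x y :: 'c
  using cabs_add_le_max[of x "- y"] by simp

lemma cabs_add_le: "cabs (x + y) \<le> cabs x + cabs y" for x y :: 'c
  using cabs_add_le_max[of x y] cabs_nonneg[of x] cabs_nonneg[of y] by linarith

lemma cabs_add_less: "cabs x < e \<Longrightarrow> cabs y < e \<Longrightarrow> cabs (x + y) < e" for x y :: 'c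
  using cabs_add_le_max[of x y] by simp

lemma cabs_diff_less: "cabs x < e \<Longrightarrow> cabs y < e \<Longrightarrow> cabs (x - y) < e" for x y :: 'c
  using cabs_diff_le_max[of x y] by simp

lemma cabs_add_leI: "cabs x \<le> e \<Longrightarrow> cabs y \<le> e \<Longrightarrow> cabs (x + y) \<le> e" for x y :: 'c
  using cabs_add_le_max[of x y] by simp

lemma cabs_diff_leI: "cabs x \<le> e \<Longrightarrow> cabs y \<le> e \<Longrightarrow> cabs (x - y) \<le> e" for x y :: 'c
  using cabs_diff_le_max[of x y] by simp

lemma cabs_inverse: "cabs (inverse x) = inverse (cabs x)" for x :: 'c
proof (cases "x = 0")
  case False
  then show ?thesis
    using cabs_mult[of x "inverse x"] by (simp add: field_simps)
qed simp

lemma cabs_divide: "cabs (x / y) = cabs x / cabs y" for x y :: 'c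
  by (simp add: divide_inverse cabs_mult cabs_inverse)

lemma cabs_prod: "cabs (prod f A) = (\<Prod>a\<in>A. cabs (f a))" for f :: "'a \<Rightarrow> 'c"
  by (induction A rule: infinite_finite_induct) (auto simp: cabs_mult)

lemma cabs_add_eq: "cabs x < cabs y \<Longrightarrow> cabs (x + y) = cabs y" for x y :: 'c
  using cabs_add_le_max[of x y] cabs_diff_le_max[of "x + y" x] by (auto simp: max_def split: if_splits)

lemma cabs_diff_eq: "cabs x < cabs y \<Longrightarrow> cabs (x - y) = cabs y" for x y :: 'c
  using cabs_add_eq[of x "- y"] by simp

lemma cabs_diff_eq': "cabs y < cabs x \<Longrightarrow> cabs (x - y) = cabs x" for x y :: 'c
  using cabs_diff_eq[of y x] cabs_minus_commute by simp

text \<open>By the ultrametric inequality the number of terms does not enter.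
  \<open>B \<ge> 0\<close> covers empty and infinite index sets, where \<open>sum\<close> is
  0.\<close>

lemma cabs_sum_le:
  fixes f :: "'a \<Rightarrow> 'c"
  assumes "B \<ge> 0" "\<And>a. a \<in> A \<Longrightarrow> cabs (f a) \<le> B"
  shows "cabs (sum f A) \<le> B"
  using assms
proof (induction A rule: infinite_finite_induct)
  case (insert x F)
  then show ?case
    using cabs_add_le_max[of "f x" "sum f F"] by fastforce
qed auto

lemma cabs_eq_if_close: "cabs (x - y) < cabs x \<Longrightarrow> cabs y = cabs x" for x y :: 'c
  using cabs_add_eq[of "y - x" x] by (simp add: cabs_minus_commute)

lemma cabs_ultra: "cabs (x - y) < B \<Longrightarrow> cabs (y - z) < B \<Longrightarrow> cabs (x - z) < B" for x y z :: 'c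
  using cabs_add_le_max[of "x - y" "y - z"] by auto

lemma cabs_eq_1I: "x ^ n = 1 \<Longrightarrow> n > 0 \<Longrightarrow> cabs x = 1" for x :: 'c
  using cabs_power[of x n] power_eq_imp_eq_base[of "cabs x" n 1] by auto

lemma cabs_le_1_of_power_eq_self: "x ^ n = x \<Longrightarrow> n > 1 \<Longrightarrow> cabs x \<le> 1" for x :: 'c
proof (cases "x = 0")
  case False
  assume "x ^ n = x" "n > 1"
  then have "x * x ^ (n - 1) = x * 1"
    by (metis mult.right_neutral gr_implies_not0 power_eq_if)
  with False \<open>n > 1\<close> have "cabs x = 1"
    by (intro cabs_eq_1I[of _ "n - 1"]) auto
  then show ?thesis by simp
qed auto

lemma cabs_le_1_Fq_ac: "x \<in> Fq_ac q \<Longrightarrow> cabs (x :: 'c) \<le> 1"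
proof -
  assume "x \<in> Fq_ac q"
  then obtain n where "n \<ge> 1" "x ^ (q ^ n) = x" by (auto simp: Fq_ac_def)
  then show ?thesis
    using q_ge_2 one_less_power[of q n] by (intro cabs_le_1_of_power_eq_self[of _ "q ^ n"]) auto
qed

subsection \<open>Null sequences\<close>

text \<open>The predicate \<open>tate\<close> says that a sequence tends to 0. It serves here for all limits, since the type of
  scalars is not in any type class of topological rings.\<close>

lemma tate_iff: "tate f \<longleftrightarrow> (\<forall>e>0. \<exists>n. \<forall>i\<ge>n. cabs (f i) < e)" for f :: "nat \<Rightarrow> 'c"
  unfolding tate_def LIMSEQ_iff by simp

lemma tate_add:
  fixes f g :: "nat \<Rightarrow> 'c"
  assumes "tate f" "tate g"
  shows "tate (\<lambda>i. f i + g i)"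
  unfolding tate_iff
proof (intro allI impI)
  fix e :: real assume "e > 0"
  then obtain m n where "\<forall>i\<ge>m. cabs (f i) < e" "\<forall>i\<ge>n. cabs (g i) < e"
    using assms unfolding tate_iff by meson
  then show "\<exists>n. \<forall>i\<ge>n. cabs (f i + g i) < e"
    by (intro exI[of _ "max m n"] allI impI cabs_add_less) auto
qed

lemma tate_cmult: "tate f \<Longrightarrow> tate (\<lambda>i. s * f i)" for f :: "nat \<Rightarrow> 'c"
  unfolding tate_def by (simp add: cabs_mult tendsto_mult_right_zero)

lemma tate_minus: "tate f \<Longrightarrow> tate (\<lambda>i. - f i)" for f :: "nat \<Rightarrow> 'c"
  unfolding tate_def by simp

lemma tate_diff: "tate f \<Longrightarrow> tate g \<Longrightarrow> tate (\<lambda>i. f i - g i)" for f g :: "nat \<Rightarrow> 'c"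
  using tate_add[of f "\<lambda>i. - g i"] tate_minus[of g] by simp

lemma tate_0: "tate (\<lambda>_. 0 :: 'c)"
  unfolding tate_def by simp

lemma tate_sum:
  fixes f :: "'a \<Rightarrow> nat \<Rightarrow> 'c"
  shows "(\<And>a. a \<in> A \<Longrightarrow> tate (f a)) \<Longrightarrow> tate (\<lambda>i. \<Sum>a\<in>A. f a i)"
  by (induction A rule: infinite_finite_induct) (auto intro!: tate_add tate_0)

lemma tate_le:
  fixes f g :: "nat \<Rightarrow> 'c"
  assumes "tate f" "\<And>i. cabs (g i) \<le> cabs (f i)"
  shows "tate g"
  unfolding tate_iff
proof (intro allI impI)
  fix e :: real assume "e > 0"
  then obtain n where "\<forall>i\<ge>n. cabs (f i) < e"
    using assms(1) unfolding tate_iff by metis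
  then show "\<exists>n. \<forall>i\<ge>n. cabs (g i) < e"
    by (intro exI[of _ n] allI impI le_less_trans[OF assms(2)]) simp
qed

lemma tate_bounded: "tate f \<Longrightarrow> \<exists>B>0. \<forall>i. cabs (f i) \<le> B" for f :: "nat \<Rightarrow> 'c"
proof -
  assume "tate f"
  then have "Bseq (\<lambda>i. cabs (f i))"
    unfolding tate_def by (intro convergent_imp_Bseq) (auto simp: convergent_def)
  then show ?thesis by (auto simp: Bseq_def)
qed

lemma tate_bdd_above: "tate f \<Longrightarrow> bdd_above (range (\<lambda>i. cabs (f i)))" for f :: "nat \<Rightarrow> 'c"
  using tate_bounded[of f] by (meson bdd_aboveI2)

lemma cabs_le_gnorm: "tate f \<Longrightarrow> cabs (f i) \<le> gnorm f" for f :: "nat \<Rightarrow> 'c"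
  unfolding gnorm_def by (rule cSUP_upper[OF UNIV_I tate_bdd_above])

lemma tendsto_iff_tate: "X \<longlonglongrightarrow> L \<longleftrightarrow> tate (\<lambda>i. X i - L)" for L :: 'c
  unfolding tate_iff lim_sequentially dist_cabs by simp

text \<open>Any difference of later terms is bounded by the largest consecutive step between them,
  so small steps alone force convergence.\<close>

lemma Cauchy_ultrametric:
  fixes X :: "nat \<Rightarrow> 'c"
  assumes "tate (\<lambda>n. X (Suc n) - X n)"
  shows "\<exists>L. X \<longlonglongrightarrow> L"
proof -
  have "Cauchy X"
    unfolding Cauchy_altdef dist_cabs
  proof (intro allI impI)
    fix e :: real assume e: "e > 0"
    then obtain M where M: "\<And>n. n \<ge> M \<Longrightarrow> cabs (X (Suc n) - X n) < e"
      using assms unfolding tate_iff by blast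
    have *: "cabs (X (m + d) - X m) < e" if "m \<ge> M" for m d
    proof (induction d)
      case (Suc d)
      show ?case
        using cabs_ultra[OF M[of "m + d"] Suc] that by simp
    qed (use e in simp)
    show "\<exists>M. \<forall>m\<ge>M. \<forall>n>m. cabs (X m - X n) < e"
    proof (intro exI[of _ M] allI impI)
      fix m n assume "m \<ge> M" "n > m"
      then show "cabs (X m - X n) < e"
        using *[of m "n - m"] by (simp add: cabs_minus_commute)
    qed
  qed
  then show ?thesis
    by (simp add: Cauchy_convergent_iff convergent_def)
qed


subsection \<open>Polynomials over the constant field\<close>

lemma Fqset_add: "x \<in> Fqset q \<Longrightarrow> y \<in> Fqset q \<Longrightarrow> x + y \<in> Fqset q" for x y :: 'c
  using frobenius_add[of x y 1] by (simp add: Fqset_def)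

lemma Fqset_minus: "x \<in> Fqset q \<Longrightarrow> - x \<in> Fqset q" for x :: 'c
proof -
  assume x: "x \<in> Fqset q"
  have "x ^ q + (- x) ^ q = 0"
    using frobenius_add[of x "- x" 1] q_ge_2 by (simp add: power_0_left)
  with x show ?thesis
    by (simp add: Fqset_def eq_neg_iff_add_eq_0 add.commute)
qed

lemma Fqset_diff: "x \<in> Fqset q \<Longrightarrow> y \<in> Fqset q \<Longrightarrow> x - y \<in> Fqset q" for x y :: 'c
  using Fqset_add[of x "- y"] Fqset_minus[of y] by simp

lemma Fqset_mult: "x \<in> Fqset q \<Longrightarrow> y \<in> Fqset q \<Longrightarrow> x * y \<in> Fqset q" for x y :: 'c
  by (simp add: Fqset_def power_mult_distrib)

lemma Fqset_divide: "x \<in> Fqset q \<Longrightarrow> y \<in> Fqset q \<Longrightarrow> x / y \<in> Fqset q" for x y :: 'c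
  by (simp add: Fqset_def power_divide)

lemma Fqset_0 [simp]: "(0::'c) \<in> Fqset q"
  using q_ge_2 by (simp add: Fqset_def power_0_left)

lemma Fqset_1 [simp]: "(1::'c) \<in> Fqset q"
  by (simp add: Fqset_def)

lemma Fqset_sum: "(\<And>a. a \<in> A \<Longrightarrow> f a \<in> Fqset q) \<Longrightarrow> sum f A \<in> Fqset q" for f :: "'a \<Rightarrow> 'c"
  by (induction A rule: infinite_finite_induct) (auto intro: Fqset_add)

lemma Fqset_power_iter: "x \<in> Fqset q \<Longrightarrow> x ^ (q ^ n) = x" for x :: 'c
  by (induction n) (auto simp: Fqset_def power_mult)

lemma cabs_Fqset_le_1: "x \<in> Fqset q \<Longrightarrow> cabs x \<le> 1" for x :: 'c
  using q_ge_2 by (intro cabs_le_1_of_power_eq_self[of _ q]) (auto simp: Fqset_def)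

lemma cabs_Fqset: "x \<in> Fqset q \<Longrightarrow> x \<noteq> 0 \<Longrightarrow> cabs x = 1" for x :: 'c
  using cabs_Fqset_le_1[of x] cabs_Fqset_le_1[of "1 / x"] Fqset_divide[of 1 x]
  by (auto simp: cabs_divide field_simps)

lemma finite_Fqset: "finite (Fqset q :: 'c set)"
proof -
  let ?f = "monom 1 q - monom 1 1 :: 'c poly"
  have "coeff ?f q = 1" using q_ge_2 by simp
  then have "?f \<noteq> 0" by (metis coeff_0 zero_neq_one)
  then have "finite {x. poly ?f x = 0}" by (rule poly_roots_finite)
  moreover have "Fqset q = {x. poly ?f x = 0}"
    by (auto simp: Fqset_def poly_monom)
  ultimately show ?thesis by simp
qed

lemma Fqpoly_0 [simp]: "Fqpoly q (0 :: 'c poly)"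
  by (simp add: Fqpoly_def)

lemma Fqpoly_pCons [simp]: "Fqpoly q (pCons c a) \<longleftrightarrow> c \<in> Fqset q \<and> Fqpoly q a" for a :: "'c poly"
  unfolding Fqpoly_def by (auto simp: coeff_pCons split: nat.splits)

lemma Fqpoly_1 [simp]: "Fqpoly q (1 :: 'c poly)"
  by (simp add: one_pCons)

lemma Fqpoly_add: "Fqpoly q a \<Longrightarrow> Fqpoly q b \<Longrightarrow> Fqpoly q (a + b)" for a b :: "'c poly"
  by (simp add: Fqpoly_def Fqset_add)

lemma Fqpoly_diff: "Fqpoly q a \<Longrightarrow> Fqpoly q b \<Longrightarrow> Fqpoly q (a - b)" for a b :: "'c poly"
  by (simp add: Fqpoly_def Fqset_diff)

lemma Fqpoly_mult: "Fqpoly q a \<Longrightarrow> Fqpoly q b \<Longrightarrow> Fqpoly q (a * b)" for a b :: "'c poly"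
  by (auto simp: Fqpoly_def coeff_mult intro!: Fqset_sum Fqset_mult)

lemma Fqpoly_power: "Fqpoly q a \<Longrightarrow> Fqpoly q (a ^ n)" for a :: "'c poly"
  by (induction n) (auto intro: Fqpoly_mult)

lemma Fqpoly_smult: "c \<in> Fqset q \<Longrightarrow> Fqpoly q a \<Longrightarrow> Fqpoly q (smult c a)" for a :: "'c poly"
  by (simp add: Fqpoly_def Fqset_mult)

text \<open>Frobenius is additive and fixes the coefficients, so it passes through Horner's scheme.
  At \<zeta> this is the origin of the exponent q^l of the character.\<close>

lemma poly_frobenius: "Fqpoly q a \<Longrightarrow> poly a (x ^ (q ^ n)) = poly a x ^ (q ^ n)" for a :: "'c poly"
proof (induction a)
  case 0
  then show ?case using q_ge_2 by (simp add: power_0_left)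
next
  case (pCons c a)
  then show ?case
    by (simp add: frobenius_add power_mult_distrib Fqset_power_iter)
qed

lemma cabs_poly_le_1:
  fixes a :: "'c poly"
  assumes "cabs x \<le> 1"
  shows "Fqpoly q a \<Longrightarrow> cabs (poly a x) \<le> 1"
proof (induction a)
  case (pCons c a)
  have "cabs (x * poly a x) \<le> 1"
    using assms pCons mult_le_one[of "cabs x" "cabs (poly a x)"] by (simp add: cabs_mult)
  with pCons show ?case
    using cabs_Fqset_le_1[of c] cabs_add_le_max[of c "x * poly a x"] by simp
qed simp

text \<open>In Horner's scheme the new constant has absolute value at most 1 and is dominated by the
  multiple of \<open>th\<close>, of absolute value at least q. This makes A discrete.\<close>

lemma cabs_poly_th: "Fqpoly q a \<Longrightarrow> a \<noteq> 0 \<Longrightarrow> cabs (poly a th) = real q ^ degree a"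
proof (induction a)
  case (pCons c a)
  show ?case
  proof (cases "a = 0")
    case True
    then show ?thesis using pCons cabs_Fqset[of c] by auto
  next
    case False
    then have IH: "cabs (th * poly a th) = real q ^ Suc (degree a)"
      using pCons by (simp add: cabs_mult cabs_th)
    have "cabs c < cabs (th * poly a th)"
      using pCons.prems cabs_Fqset_le_1[of c] IH real_q_gt_1 one_less_power[of "real q" "Suc (degree a)"]
      by auto
    then show ?thesis
      using False IH cabs_add_eq by simp
  qed
qed simp

text \<open>The division is built by Horner induction so that quotient and remainder visibly keep
  their coefficients in the finite field.\<close>

lemma Fqpoly_division:
  fixes b :: "'c poly"
  assumes b: "Fqpoly q b" "b \<noteq> 0"
  shows "Fqpoly q a \<Longrightarrow>
    \<exists>s r. Fqpoly q s \<and> Fqpoly q r \<and> a = b * s + r \<and> (r = 0 \<or> degree r < degree b)"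
proof (induction a)
  case 0
  then show ?case by (intro exI[of _ 0]) simp
next
  case (pCons c a)
  then obtain s r where sr: "Fqpoly q s" "Fqpoly q r" "a = b * s + r" "r = 0 \<or> degree r < degree b"
    by auto
  define t where "t = pCons c r"
  \<comment> \<open>Subtracting y times b cancels the only coefficient of t that can reach the
    degree of b.\<close>
  define y where "y = coeff t (degree b) / lead_coeff b"
  define r' where "r' = t - smult y b"
  have t: "Fqpoly q t" using pCons.prems sr by (simp add: t_def)
  have y: "y \<in> Fqset q"
    using t b by (auto simp: y_def Fqpoly_def intro!: Fqset_divide)
  have "degree t \<le> degree b" using sr(4) by (auto simp: t_def degree_pCons_le)
  then have "degree r' \<le> degree b"
    unfolding r'_def by (intro degree_diff_le) auto
  moreover have "coeff r' (degree b) = 0"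
    using b by (simp add: r'_def y_def)
  ultimately have "r' = 0 \<or> degree r' < degree b"
    by (metis le_neq_implies_less leading_coeff_0_iff)
  moreover have "pCons c a = b * (pCons 0 s + [:y:]) + r'"
    by (simp add: sr(3) r'_def t_def algebra_simps)
  moreover have "Fqpoly q (pCons 0 s + [:y:])" "Fqpoly q r'"
    using sr t y b unfolding r'_def by (auto intro!: Fqpoly_diff Fqpoly_smult Fqpoly_add)
  ultimately show ?case by blast
qed

subsection \<open>The ring \<open>A\<close> and the field \<open>K\<^sub>\<infinity>\<close>\<close>

lemma Apoly_poly: "Fqpoly q a \<Longrightarrow> Apoly q th (poly a th) = a"
  unfolding Apoly_def
proof (rule the_equality)
  fix b assume "Fqpoly q a" "Fqpoly q b \<and> poly b th = poly a th"
  then have "Fqpoly q (b - a)" "poly (b - a) th = 0"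
    using Fqpoly_diff by auto
  then show "b = a" using th_transcendental by fastforce
qed simp

lemma Apoly: "x \<in> Aset q th \<Longrightarrow> Fqpoly q (Apoly q th x) \<and> poly (Apoly q th x) th = x"
  unfolding Aset_def using Apoly_poly by auto

lemma Aset_poly [simp]: "Fqpoly q a \<Longrightarrow> poly a th \<in> Aset q th"
  by (auto simp: Aset_def)

lemma AsetE: "x \<in> Aset q th \<Longrightarrow> (\<And>a. Fqpoly q a \<Longrightarrow> x = poly a th \<Longrightarrow> P) \<Longrightarrow> P"
  unfolding Aset_def by blast

lemma Aset_0 [simp]: "0 \<in> Aset q th"
  using Aset_poly[of 0] by simp

lemma Aset_1 [simp]: "1 \<in> Aset q th"
  using Aset_poly[of 1] by simp

lemma Aset_diff: "x \<in> Aset q th \<Longrightarrow> y \<in> Aset q th \<Longrightarrow> x - y \<in> Aset q th"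
  by (elim AsetE) (metis Aset_poly Fqpoly_diff poly_diff)

lemma Aset_minus: "x \<in> Aset q th \<Longrightarrow> - x \<in> Aset q th"
  using Aset_diff[of 0 x] by simp

lemma Aset_mult: "x \<in> Aset q th \<Longrightarrow> y \<in> Aset q th \<Longrightarrow> x * y \<in> Aset q th"
  by (elim AsetE) (metis Aset_poly Fqpoly_mult poly_mult)

lemma Aset_power: "x \<in> Aset q th \<Longrightarrow> x ^ n \<in> Aset q th"
  by (induction n) (auto intro: Aset_mult)

lemma cabs_Aset: "x \<in> Aset q th \<Longrightarrow> x \<noteq> 0 \<Longrightarrow> \<exists>n. cabs x = real q ^ n"
  by (elim AsetE) (metis cabs_poly_th poly_0)

lemma cabs_Aset_ge_1: "x \<in> Aset q th \<Longrightarrow> x \<noteq> 0 \<Longrightarrow> cabs x \<ge> 1"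
  using cabs_Aset[of x] real_q_gt_1 by (auto intro: one_le_power)

text \<open>The field F_q(th). \<open>Kinf\<close> is its closure by \<open>Kinf_iff\<close>, so
  closure under the field operations is shown here first and then passed to limits.\<close>

definition Kset :: "'c set" where
  "Kset = {x / y | x y. x \<in> Aset q th \<and> y \<in> Aset q th \<and> y \<noteq> 0}"

lemma Kinf_iff: "x \<in> Kinf q th \<longleftrightarrow> (\<forall>e>0. \<exists>y\<in>Kset. cabs (x - y) < e)"
proof -
  have "(\<exists>y\<in>Kset. cabs (x - y) < e) \<longleftrightarrow> (\<exists>a b. Fqpoly q a \<and> Fqpoly q b \<and> poly b th \<noteq> 0 \<and>
          cabs (x - poly a th / poly b th) < e)" for e
    unfolding Kset_def Aset_def by blast
  then show ?thesis by (simp add: Kinf_def)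
qed

lemma KsetE:
  assumes "x \<in> Kset"
  obtains a b where "a \<in> Aset q th" "b \<in> Aset q th" "b \<noteq> 0" "x = a / b"
  using assms unfolding Kset_def by blast

lemma KsetI: "a \<in> Aset q th \<Longrightarrow> b \<in> Aset q th \<Longrightarrow> b \<noteq> 0 \<Longrightarrow> a / b \<in> Kset"
  unfolding Kset_def by blast

lemma Kset_diff:
  assumes "x \<in> Kset" "y \<in> Kset"
  shows "x - y \<in> Kset"
proof -
  obtain a b where 1: "a \<in> Aset q th" "b \<in> Aset q th" "b \<noteq> 0" "x = a / b"
    using assms(1) by (rule KsetE)
  obtain c d where 2: "c \<in> Aset q th" "d \<in> Aset q th" "d \<noteq> 0" "y = c / d"
    using assms(2) by (rule KsetE)
  have "x - y = (a * d - c * b) / (b * d)"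
    using 1 2 by (simp add: field_simps)
  then show ?thesis
    using 1 2 by (auto intro!: KsetI Aset_diff Aset_mult)
qed

lemma Kset_mult:
  assumes "x \<in> Kset" "y \<in> Kset"
  shows "x * y \<in> Kset"
proof -
  obtain a b where 1: "a \<in> Aset q th" "b \<in> Aset q th" "b \<noteq> 0" "x = a / b"
    using assms(1) by (rule KsetE)
  obtain c d where 2: "c \<in> Aset q th" "d \<in> Aset q th" "d \<noteq> 0" "y = c / d"
    using assms(2) by (rule KsetE)
  have "x * y = (a * c) / (b * d)"
    using 1 2 by (simp add: field_simps)
  then show ?thesis
    using 1 2 by (auto intro!: KsetI Aset_mult)
qed

lemma Kset_inverse:
  assumes "x \<in> Kset"
  shows "inverse x \<in> Kset"
proof -
  obtain a b where 1: "a \<in> Aset q th" "b \<in> Aset q th" "b \<noteq> 0" "x = a / b"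
    using assms(1) by (rule KsetE)
  show ?thesis
  proof (cases "a = 0")
    case True
    then show ?thesis using 1 KsetI[of 0 1] by simp
  next
    case False
    then show ?thesis using 1 KsetI[of b a] by simp
  qed
qed

lemma Aset_Kset: "x \<in> Aset q th \<Longrightarrow> x \<in> Kset"
  using KsetI[of x 1] by simp

lemma Kset_Kinf: "x \<in> Kset \<Longrightarrow> x \<in> Kinf q th"
  unfolding Kinf_iff by (auto intro!: bexI[of _ x])

lemma Aset_Kinf: "x \<in> Aset q th \<Longrightarrow> x \<in> Kinf q th"
  by (intro Kset_Kinf Aset_Kset)

lemma Kinf_diff:
  assumes "x \<in> Kinf q th" "y \<in> Kinf q th"
  shows "x - y \<in> Kinf q th"
  unfolding Kinf_iff
proof (intro allI impI)
  fix e :: real assume "e > 0"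
  then obtain x' y' where "x' \<in> Kset" "cabs (x - x') < e" "y' \<in> Kset" "cabs (y - y') < e"
    using assms unfolding Kinf_iff by meson
  then have "x' - y' \<in> Kset" "cabs ((x - x') - (y - y')) < e"
    by (auto intro: Kset_diff cabs_diff_less)
  then show "\<exists>y'\<in>Kset. cabs (x - y - y') < e"
    by (intro bexI[of _ "x' - y'"]) (auto simp: algebra_simps)
qed

lemma Kinf_minus: "x \<in> Kinf q th \<Longrightarrow> - x \<in> Kinf q th"
  using Kinf_diff[of 0 x] Aset_Kinf[of 0] by simp

lemma Kinf_mult:
  assumes "x \<in> Kinf q th" "y \<in> Kinf q th"
  shows "x * y \<in> Kinf q th"
  unfolding Kinf_iff
proof (intro allI impI)
  fix e :: real assume e: "e > 0"
  \<comment> \<open>The entry 1 keeps |y'| at most M + 1; then both parts of xy - x'y' = x(y - y') +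
    (x - x')y' are smaller than d(M + 1) \<le> e.\<close>
  define d where "d = min 1 (e / (max (cabs x) (cabs y) + 1))"
  define M where "M = max (cabs x) (cabs y)"
  have M: "M \<ge> 0" unfolding M_def using cabs_nonneg[of x] by linarith
  have d: "d > 0" "d \<le> 1" "d \<le> e / (M + 1)"
    using e M unfolding d_def M_def[symmetric] by auto
  then have d: "d > 0" "d \<le> 1" "d * (M + 1) \<le> e"
    using M by (simp_all add: pos_le_divide_eq)
  obtain x' y' where xy: "x' \<in> Kset" "cabs (x - x') < d" "y' \<in> Kset" "cabs (y - y') < d"
    using assms d(1) unfolding Kinf_iff by meson
  have y': "cabs y' \<le> M + 1"
    using cabs_diff_le_max[of y "y - y'"] xy(4) d(2) M unfolding M_def by auto
  have "cabs (x * (y - y')) \<le> M * cabs (y - y')"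
    unfolding cabs_mult by (intro mult_right_mono) (auto simp: M_def)
  also have "\<dots> \<le> M * d" using xy(4) M by (intro mult_left_mono) auto
  also have "\<dots> < (M + 1) * d" using d(1) by simp
  finally have 1: "cabs (x * (y - y')) < e" using d(3) by (simp add: mult.commute)
  have "cabs ((x - x') * y') \<le> cabs (x - x') * (M + 1)"
    unfolding cabs_mult using y' by (intro mult_left_mono) auto
  also have "\<dots> < d * (M + 1)" using xy(2) M by (intro mult_strict_right_mono) auto
  finally have 2: "cabs ((x - x') * y') < e" using d(3) by simp
  have "cabs (x * y - x' * y') < e"
    using cabs_add_less[OF 1 2] by (simp add: algebra_simps)
  then show "\<exists>z\<in>Kset. cabs (x * y - z) < e"
    using Kset_mult xy by blast
qed

lemma Kinf_inverse:
  assumes "x \<in> Kinf q th"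
  shows "inverse x \<in> Kinf q th"
proof (cases "x = 0")
  case False
  show ?thesis
    unfolding Kinf_iff
  proof (intro allI impI)
    fix e :: real assume e: "e > 0"
    \<comment> \<open>The first entry forces |y| = |x| exactly, the second makes |y - x| / |x|^2
      smaller than e.\<close>
    define d where "d = min (cabs x) (e * cabs x * cabs x)"
    have d: "d > 0" using e False by (auto simp: d_def)
    then obtain y where y: "y \<in> Kset" "cabs (x - y) < d"
      using assms unfolding Kinf_iff by meson
    then have "cabs y = cabs x"
      by (intro cabs_eq_if_close) (auto simp: d_def)
    moreover from this False have "y \<noteq> 0" by auto
    moreover have "cabs (y - x) < e * (cabs x * cabs x)"
      using y by (auto simp: d_def cabs_minus_commute mult.assoc)
    moreover have "inverse x - inverse y = (y - x) / (x * y)"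
      using False \<open>y \<noteq> 0\<close> by (simp add: field_simps)
    ultimately have "cabs (inverse x - inverse y) < e"
      using False by (simp add: cabs_divide cabs_mult divide_less_eq)
    then show "\<exists>z\<in>Kset. cabs (inverse x - z) < e"
      using Kset_inverse[OF y(1)] by blast
  qed
qed (use assms in simp)

lemma Kinf_divide: "x \<in> Kinf q th \<Longrightarrow> y \<in> Kinf q th \<Longrightarrow> x / y \<in> Kinf q th"
  by (simp add: divide_inverse Kinf_mult Kinf_inverse)

text \<open>Division with remainder: the numerator left over has smaller degree than the
  denominator. Hence K, and by density K_inf, is A plus a small disc, which allows points to be
  moved by A into bounded sets.\<close>

lemma Kset_approx:
  assumes "x \<in> Kset"
  shows "\<exists>a\<in>Aset q th. cabs (x - a) \<le> inverse (real q)"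
proof -
  obtain a b where ab: "Fqpoly q a" "Fqpoly q b" "poly b th \<noteq> 0" "x = poly a th / poly b th"
    using assms by (auto elim!: KsetE AsetE)
  then obtain s r where sr: "Fqpoly q s" "Fqpoly q r" "a = b * s + r" "r = 0 \<or> degree r < degree b"
    using Fqpoly_division[of b a] by fastforce
  have x: "x - poly s th = poly r th / poly b th"
    using ab sr by (simp add: field_simps)
  have "cabs (x - poly s th) \<le> inverse (real q)"
  proof (cases "r = 0")
    case True
    then show ?thesis by (simp add: x)
  next
    case False
    have "b \<noteq> 0" using ab by auto
    then have "cabs (x - poly s th) = real q ^ degree r / real q ^ degree b"
      unfolding x cabs_divide using ab(2) sr(2) False by (simp add: cabs_poly_th)
    also have "real q ^ Suc (degree r) \<le> real q ^ degree b"
      using sr(4) False real_q_gt_1 by (intro power_increasing) auto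
    then have "real q ^ degree r / real q ^ degree b \<le> inverse (real q)"
      using real_q_gt_1 by (simp add: field_simps)
    finally show ?thesis .
  qed
  then show ?thesis using sr by (intro bexI[of _ "poly s th"]) auto
qed

lemma Kinf_approx:
  assumes "x \<in> Kinf q th"
  shows "\<exists>a\<in>Aset q th. cabs (x - a) \<le> inverse (real q)"
proof -
  have "inverse (real q) > 0" using real_q_gt_1 by simp
  then obtain y where y: "y \<in> Kset" "cabs (x - y) < inverse (real q)"
    using assms unfolding Kinf_iff by meson
  obtain a where a: "a \<in> Aset q th" "cabs (y - a) \<le> inverse (real q)"
    using Kset_approx[OF y(1)] by blast
  then show ?thesis
    using y cabs_add_leI[of "x - y" "inverse (real q)" "y - a"] by (intro bexI[of _ a]) auto
qed

subsection \<open>The upper half plane\<close>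

lemma bdd_below_imnorm: "bdd_below ((\<lambda>k. cabs (z - k)) ` Kinf q th)"
  by (rule bdd_belowI[of _ 0]) auto

lemma imnorm_le: "k \<in> Kinf q th \<Longrightarrow> imnorm q th z \<le> cabs (z - k)"
  unfolding imnorm_def by (rule cINF_lower[OF bdd_below_imnorm])

lemma imnorm_geI: "(\<And>k. k \<in> Kinf q th \<Longrightarrow> B \<le> cabs (z - k)) \<Longrightarrow> B \<le> imnorm q th z"
  unfolding imnorm_def using Aset_Kinf[of 0] by (intro cINF_greatest) auto

lemma imnorm_lessD: "imnorm q th z < B \<Longrightarrow> \<exists>k\<in>Kinf q th. cabs (z - k) < B"
  using imnorm_geI[of B z] by force

lemma imnorm_le_cabs: "imnorm q th z \<le> cabs z"
  using imnorm_le[OF Aset_Kinf[OF Aset_0]] by simp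

lemma imnorm_nonneg: "imnorm q th z \<ge> 0"
  by (rule imnorm_geI) simp

text \<open>K_inf is closed: a point outside keeps a fixed distance e from K, and the ultrametric
  inequality carries e over to the closure.\<close>

lemma imnorm_pos_iff: "imnorm q th z > 0 \<longleftrightarrow> z \<in> Omega q th"
proof
  assume "imnorm q th z > 0"
  then show "z \<in> Omega q th"
    using imnorm_le[of z z] by (auto simp: Omega_def)
next
  assume z: "z \<in> Omega q th"
  then obtain e where e: "e > 0" "\<And>y. y \<in> Kset \<Longrightarrow> cabs (z - y) \<ge> e"
    by (auto simp: Omega_def Kinf_iff not_less)
  have "e \<le> imnorm q th z"
  proof (rule imnorm_geI, rule ccontr)
    fix k assume k: "k \<in> Kinf q th" "\<not> e \<le> cabs (z - k)"
    then obtain y where "y \<in> Kset" "cabs (k - y) < e"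
      using e(1) unfolding Kinf_iff by meson
    then show False
      using cabs_ultra[of z k e y] k(2) e(2)[of y] by auto
  qed
  with e show "imnorm q th z > 0" by linarith
qed

lemma imnorm_ge_Omega: "B > 0 \<Longrightarrow> imnorm q th z \<ge> B \<Longrightarrow> z \<in> Omega q th"
  using imnorm_pos_iff[of z] by linarith

text \<open>The map permutes K_inf and scales distances by |a|. One inequality is proved directly;
  the other is the same inequality for the inverse map.\<close>

lemma imnorm_affine:
  assumes "a \<in> Kinf q th" "b \<in> Kinf q th" "a \<noteq> 0"
  shows "imnorm q th (a * z + b) = cabs a * imnorm q th z"
proof -
  have le: "cabs a * imnorm q th z \<le> imnorm q th (a * z + b)"
    if "a \<in> Kinf q th" "b \<in> Kinf q th" "a \<noteq> 0" for a b z
  proof (rule imnorm_geI)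
    fix k assume "k \<in> Kinf q th"
    then have "(k - b) / a \<in> Kinf q th" using that by (intro Kinf_divide Kinf_diff)
    then have "cabs a * imnorm q th z \<le> cabs a * cabs (z - (k - b) / a)"
      by (intro mult_left_mono imnorm_le) auto
    also have "\<dots> = cabs (a * z + b - k)"
    proof -
      have "a * (z - (k - b) / a) = a * z + b - k"
        using that by (simp add: field_simps)
      then show ?thesis by (simp flip: cabs_mult)
    qed
    finally show "cabs a * imnorm q th z \<le> cabs (a * z + b - k)" .
  qed
  have "cabs (inverse a) * imnorm q th (a * z + b) \<le> imnorm q th (inverse a * (a * z + b) + (- b / a))"
    using assms by (intro le Kinf_inverse Kinf_divide Kinf_minus) auto
  also have "inverse a * (a * z + b) + (- b / a) = z"
    using assms by (simp add: field_simps)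
  finally have "imnorm q th (a * z + b) \<le> cabs a * imnorm q th z"
    using assms unfolding cabs_inverse by (simp add: field_simps)
  then show ?thesis using le[OF assms] by (intro antisym)
qed

lemma imnorm_diff_Aset: "a \<in> Aset q th \<Longrightarrow> imnorm q th (z - a) = imnorm q th z"
  using imnorm_affine[of 1 "- a" z] Aset_Kinf Aset_minus by simp

lemma Omega_affine:
  "a \<in> Kinf q th \<Longrightarrow> b \<in> Kinf q th \<Longrightarrow> a \<noteq> 0 \<Longrightarrow> z \<in> Omega q th \<Longrightarrow> a * z + b \<in> Omega q th"
  using imnorm_affine[of a b z] imnorm_pos_iff[of z] imnorm_pos_iff[of "a * z + b"] by simp

lemma Omega_not_Kinf: "z \<in> Omega q th \<Longrightarrow> z \<notin> Kinf q th"
  by (simp add: Omega_def)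

lemma Omega_n_Omega: "z \<in> Omega_n q th n \<Longrightarrow> z \<in> Omega q th"
  using real_q_gt_1 by (intro imnorm_ge_Omega[of "inverse (real q ^ n)"]) (auto simp: Omega_n_def)

text \<open>For c nonzero the zero -d/c lies in K_inf; for c = 0 the determinant forces d to be
  nonzero.\<close>

lemma jfac_nonzero:
  assumes "c \<in> Kinf q th" "d \<in> Kinf q th" "a * d - b * c \<noteq> 0" "z \<in> Omega q th"
  shows "c * z + d \<noteq> 0"
proof
  assume 0: "c * z + d = 0"
  show False
  proof (cases "c = 0")
    case False
    then have "z = - d / c" using 0 by (simp add: field_simps eq_neg_iff_add_eq_0)
    then show False using assms Omega_not_Kinf Kinf_divide Kinf_minus by blast
  qed (use 0 assms in auto)
qed


subsection \<open>Evaluation on the Tate algebra\<close>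

lemma cabs_limit_le:
  fixes X :: "nat \<Rightarrow> 'c"
  assumes "X \<longlonglongrightarrow> L" "\<And>n. cabs (X n) \<le> B"
  shows "cabs L \<le> B"
proof (rule ccontr)
  assume L: "\<not> cabs L \<le> B"
  have "0 \<le> B" using assms(2)[of 0] cabs_nonneg[of "X 0"] by linarith
  with L have "cabs L > 0" by linarith
  then obtain n where "\<forall>i\<ge>n. cabs (X i - L) < cabs L"
    using assms(1) unfolding tendsto_iff_tate tate_iff by blast
  then have "cabs (L - X n) < cabs L" by (simp add: cabs_minus_commute)
  then have "cabs (X n) = cabs L" by (rule cabs_eq_if_close)
  with assms(2)[of n] L show False by simp
qed

lemma ev_eqI: "(\<lambda>n. \<Sum>i<n. f i * \<xi> ^ i) \<longlonglongrightarrow> L \<Longrightarrow> ev f \<xi> = L" for L :: 'c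
  unfolding ev_def by (metis sums_def sums_unique)

lemma cabs_term_le:
  fixes f :: "nat \<Rightarrow> 'c"
  assumes "cabs \<xi> \<le> 1"
  shows "cabs (f i * \<xi> ^ i) \<le> cabs (f i)"
  using assms by (simp add: cabs_mult cabs_power mult_left_le power_le_one)

lemma ev_tendsto:
  fixes f :: "nat \<Rightarrow> 'c"
  assumes "tate f" "cabs \<xi> \<le> 1"
  shows "(\<lambda>n. \<Sum>i<n. f i * \<xi> ^ i) \<longlonglongrightarrow> ev f \<xi>"
proof -
  have "tate (\<lambda>i. f i * \<xi> ^ i)"
    by (rule tate_le[OF assms(1)]) (rule cabs_term_le[OF assms(2)])
  then have "\<exists>L. (\<lambda>n. \<Sum>i<n. f i * \<xi> ^ i) \<longlonglongrightarrow> L"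
    by (intro Cauchy_ultrametric) simp
  then show ?thesis using ev_eqI by blast
qed

lemma ev_diff:
  fixes f g :: "nat \<Rightarrow> 'c"
  assumes "tate f" "tate g" "cabs \<xi> \<le> 1"
  shows "ev (\<lambda>i. f i - g i) \<xi> = ev f \<xi> - ev g \<xi>"
proof (rule ev_eqI)
  show "(\<lambda>n. \<Sum>i<n. (f i - g i) * \<xi> ^ i) \<longlonglongrightarrow> ev f \<xi> - ev g \<xi>"
    using tate_diff[OF ev_tendsto[OF assms(1,3), unfolded tendsto_iff_tate]
                       ev_tendsto[OF assms(2,3), unfolded tendsto_iff_tate]]
    unfolding tendsto_iff_tate by (simp add: algebra_simps sum_subtractf)
qed

lemma ev_tscal:
  fixes f :: "nat \<Rightarrow> 'c"
  assumes "tate f" "cabs \<xi> \<le> 1"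
  shows "ev (tscal s f) \<xi> = s * ev f \<xi>"
proof (rule ev_eqI)
  show "(\<lambda>n. \<Sum>i<n. tscal s f i * \<xi> ^ i) \<longlonglongrightarrow> s * ev f \<xi>"
    using tate_cmult[OF ev_tendsto[OF assms, unfolded tendsto_iff_tate], of s]
    unfolding tendsto_iff_tate by (simp add: tscal_def algebra_simps sum_distrib_left)
qed

lemma cabs_ev_le:
  fixes f :: "nat \<Rightarrow> 'c"
  assumes "tate f" "cabs \<xi> \<le> 1" "\<And>i. cabs (f i) \<le> B"
  shows "cabs (ev f \<xi>) \<le> B"
proof (rule cabs_limit_le[OF ev_tendsto[OF assms(1,2)]])
  have "0 \<le> B" using assms(3)[of 0] cabs_nonneg[of "f 0"] by linarith
  then show "cabs (\<Sum>i<n. f i * \<xi> ^ i) \<le> B" for n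
    by (rule cabs_sum_le) (rule order_trans[OF cabs_term_le[OF assms(2)] assms(3)])
qed

lemma cabs_ev_le_gnorm: "tate f \<Longrightarrow> cabs \<xi> \<le> 1 \<Longrightarrow> cabs (ev f \<xi>) \<le> gnorm f" for f :: "nat \<Rightarrow> 'c"
  by (rule cabs_ev_le) (auto intro: cabs_le_gnorm)

text \<open>If i + j is large, one of the indices is large, and the factor belonging to the other
  one is bounded.\<close>

lemma tate_product_small:
  fixes f g :: "nat \<Rightarrow> 'c"
  assumes "tate f" "tate g" "e > 0"
  shows "\<exists>n. \<forall>i j. i + j \<ge> n \<longrightarrow> cabs (f i * g j) < e"
proof -
  obtain B where B: "B > 0" "\<And>i. cabs (f i) \<le> B"
    using tate_bounded[OF assms(1)] by blast
  obtain C where C: "C > 0" "\<And>i. cabs (g i) \<le> C"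
    using tate_bounded[OF assms(2)] by blast
  obtain m where m: "\<And>i. i \<ge> m \<Longrightarrow> cabs (f i) < e / C"
    using assms(1) divide_pos_pos[OF assms(3) C(1)] unfolding tate_iff by metis
  obtain n where n: "\<And>i. i \<ge> n \<Longrightarrow> cabs (g i) < e / B"
    using assms(2) divide_pos_pos[OF assms(3) B(1)] unfolding tate_iff by metis
  show ?thesis
  proof (intro exI[of _ "m + n"] allI impI)
    fix i j assume "i + j \<ge> m + n"
    then consider "i \<ge> m" | "j \<ge> n" by linarith
    then show "cabs (f i * g j) < e"
    proof cases
      case 1
      have "cabs (f i) * cabs (g j) \<le> cabs (f i) * C"
        by (intro mult_left_mono C) auto
      also have "\<dots> < e / C * C" using m[OF 1] C(1) by (intro mult_strict_right_mono)
      finally show ?thesis using C(1) by (simp add: cabs_mult)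
    next
      case 2
      have "cabs (f i) * cabs (g j) \<le> B * cabs (g j)"
        by (intro mult_right_mono B) auto
      also have "\<dots> < B * (e / B)" using n[OF 2] B(1) by (intro mult_strict_left_mono)
      finally show ?thesis using B(1) by (simp add: cabs_mult)
    qed
  qed
qed

lemma tate_tmult:
  fixes f g :: "nat \<Rightarrow> 'c"
  assumes "tate f" "tate g"
  shows "tate (tmult f g)"
  unfolding tate_iff
proof (intro allI impI)
  fix e :: real assume "e > 0"
  then obtain n where n: "\<And>i j. i + j \<ge> n \<Longrightarrow> cabs (f i * g j) < e / 2"
    using tate_product_small[OF assms, of "e / 2"] by auto
  have "cabs (tmult f g i) \<le> e / 2" if "i \<ge> n" for i
    unfolding tmult_def using n that \<open>e > 0\<close> by (intro cabs_sum_le) (auto intro!: less_imp_le)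
  then show "\<exists>n. \<forall>i\<ge>n. cabs (tmult f g i) < e"
    using \<open>e > 0\<close> by (intro exI[of _ n]) fastforce
qed

text \<open>The product of two partial sums runs over a square, the partial sum of the Cauchy
  product over the triangle i + j < n. The terms in between are uniformly small, hence so is their
  sum.\<close>

lemma ev_tmult:
  fixes f g :: "nat \<Rightarrow> 'c"
  assumes f: "tate f" and g: "tate g" and \<xi>: "cabs \<xi> \<le> 1"
  shows "ev (tmult f g) \<xi> = ev f \<xi> * ev g \<xi>"
proof (rule ev_eqI)
  define F where "F = (\<lambda>i. f i * \<xi> ^ i)"
  define G where "G = (\<lambda>i. g i * \<xi> ^ i)"
  have F: "tate F" unfolding F_def by (rule tate_le[OF f]) (rule cabs_term_le[OF \<xi>])
  have G: "tate G" unfolding G_def by (rule tate_le[OF g]) (rule cabs_term_le[OF \<xi>])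
  define X where "X n = sum F {..<n}" for n
  define Y where "Y n = sum G {..<n}" for n
  define Z where "Z n = (\<Sum>i<n. tmult f g i * \<xi> ^ i)" for n
  have X: "tate (\<lambda>n. X n - ev f \<xi>)"
    using ev_tendsto[OF f \<xi>] unfolding tendsto_iff_tate X_def F_def .
  have Y: "tate (\<lambda>n. Y n - ev g \<xi>)"
    using ev_tendsto[OF g \<xi>] unfolding tendsto_iff_tate Y_def G_def .
  have Z: "Z n = (\<Sum>(i, j)\<in>{(i, j). i + j < n}. F i * G j)" for n
  proof -
    have "tmult f g k * \<xi> ^ k = (\<Sum>i\<le>k. F i * G (k - i))" for k
      unfolding tmult_def sum_distrib_right F_def G_def
    proof (rule sum.cong)
      fix i assume "i \<in> {..k}"
      then have "\<xi> ^ k = \<xi> ^ i * \<xi> ^ (k - i)" by (simp flip: power_add)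
      then show "f i * g (k - i) * \<xi> ^ k = f i * \<xi> ^ i * (g (k - i) * \<xi> ^ (k - i))"
        by (simp add: mult_ac)
    qed simp
    then show ?thesis
      unfolding Z_def by (simp add: sum.triangle_reindex)
  qed
  have XY: "X n * Y n = (\<Sum>(i, j)\<in>{..<n} \<times> {..<n}. F i * G j)" for n
    by (simp add: X_def Y_def sum_product sum.cartesian_product)
  have ZXY: "X n * Y n - Z n = (\<Sum>(i, j)\<in>{..<n} \<times> {..<n} - {(i, j). i + j < n}. F i * G j)" for n
    unfolding XY Z by (rule sum_diff[symmetric]) auto
  have a: "tate (\<lambda>n. X n * Y n - Z n)"
    unfolding tate_iff
  proof (intro allI impI)
    fix e :: real assume "e > 0"
    then obtain n where n: "\<And>i j. i + j \<ge> n \<Longrightarrow> cabs (F i * G j) < e / 2"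
      using tate_product_small[OF F G, of "e / 2"] by auto
    have "cabs (X k * Y k - Z k) \<le> e / 2" if "k \<ge> n" for k
      unfolding ZXY using n that \<open>e > 0\<close> by (intro cabs_sum_le) (auto intro!: less_imp_le)
    then show "\<exists>n. \<forall>i\<ge>n. cabs (X i * Y i - Z i) < e"
      using \<open>e > 0\<close> by (intro exI[of _ n]) fastforce
  qed
  obtain B where B: "B > 0" "\<And>i. cabs (G i) \<le> B"
    using tate_bounded[OF G] by blast
  have b: "tate (\<lambda>n. (X n - ev f \<xi>) * Y n)"
    unfolding tate_iff
  proof (intro allI impI)
    fix e :: real assume "e > 0"
    then have "e / B > 0" using B by simp
    then obtain n where n: "\<And>i. i \<ge> n \<Longrightarrow> cabs (X i - ev f \<xi>) < e / B"
      using X unfolding tate_iff by meson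
    have "cabs ((X i - ev f \<xi>) * Y i) < e" if "i \<ge> n" for i
    proof -
      have "cabs (X i - ev f \<xi>) * cabs (Y i) \<le> cabs (X i - ev f \<xi>) * B"
        unfolding Y_def using B by (intro mult_left_mono cabs_sum_le) auto
      also have "\<dots> < e / B * B" using n[OF that] B(1) by (intro mult_strict_right_mono)
      finally show ?thesis using B(1) by (simp add: cabs_mult)
    qed
    then show "\<exists>n. \<forall>i\<ge>n. cabs ((X i - ev f \<xi>) * Y i) < e" by blast
  qed
  \<comment> \<open>The combination telescopes to \<open>Z n\<close> minus the product of the two
    values.\<close>
  have "tate (\<lambda>n. (X n - ev f \<xi>) * Y n + ev f \<xi> * (Y n - ev g \<xi>) - (X n * Y n - Z n))"
    by (rule tate_diff[OF tate_add[OF b tate_cmult[OF Y]] a])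
  then show "(\<lambda>n. \<Sum>i<n. tmult f g i * \<xi> ^ i) \<longlonglongrightarrow> ev f \<xi> * ev g \<xi>"
    unfolding tendsto_iff_tate Z_def[symmetric] by (simp add: algebra_simps)
qed

section \<open>Polynomials and rational functions under evaluation\<close>

lemma poly_altdef_less: "n > degree a \<Longrightarrow> (\<Sum>i<n. coeff a i * x ^ i) = poly a x" for a :: "'c poly"
  unfolding poly_altdef by (rule sum.mono_neutral_right) (auto simp: coeff_eq_0)

lemma tate_coeff: "tate (coeff a)" for a :: "'c poly"
  unfolding tate_iff
  by (auto intro!: exI[of _ "Suc (degree a)"] simp: coeff_eq_0)

lemma ev_coeff: "ev (coeff a) \<xi> = poly a \<xi>" for a :: "'c poly"
proof (rule ev_eqI)
  show "(\<lambda>n. \<Sum>i<n. coeff a i * \<xi> ^ i) \<longlonglongrightarrow> poly a \<xi>"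
    by (rule tendsto_eventually)
       (auto simp: eventually_sequentially poly_altdef_less intro!: exI[of _ "Suc (degree a)"])
qed

lemma ev_tA: "ev (tA q th x) \<xi> = poly (Apoly q th x) \<xi>"
  unfolding tA_def using ev_coeff .

lemma tate_tA: "tate (tA q th x)"
  unfolding tA_def using tate_coeff .

lemma ev_tone: "ev (tone :: nat \<Rightarrow> 'c) \<xi> = 1"
proof -
  have "tone = coeff (1 :: 'c poly)"
    by (simp add: tone_def fun_eq_iff)
  then have "ev (tone :: nat \<Rightarrow> 'c) \<xi> = ev (coeff 1) \<xi>" by (rule arg_cong)
  then show ?thesis unfolding ev_coeff by simp
qed

lemma tate_tpolyeval: "(\<forall>P\<in>set Ps. tate P) \<Longrightarrow> tate (tpolyeval Ps z)" for z :: 'c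
  unfolding tpolyeval_def
  by (rule tate_sum) (simp add: tate_cmult mult.commute[of _ "z ^ _"])

lemma ev_sum:
  fixes f :: "'a \<Rightarrow> nat \<Rightarrow> 'c"
  assumes "\<And>a. a \<in> A \<Longrightarrow> tate (f a)" "cabs \<xi> \<le> 1"
  shows "ev (\<lambda>i. \<Sum>a\<in>A. f a i) \<xi> = (\<Sum>a\<in>A. ev (f a) \<xi>)"
proof (rule ev_eqI)
  have "tate (\<lambda>n. \<Sum>a\<in>A. ((\<Sum>i<n. f a i * \<xi> ^ i) - ev (f a) \<xi>))"
    using assms ev_tendsto[unfolded tendsto_iff_tate] by (intro tate_sum) blast
  then show "(\<lambda>n. \<Sum>i<n. (\<Sum>a\<in>A. f a i) * \<xi> ^ i) \<longlonglongrightarrow> (\<Sum>a\<in>A. ev (f a) \<xi>)"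
    unfolding tendsto_iff_tate sum_subtractf sum_distrib_right
    by (subst sum.swap)
qed

lemma ev_tpolyeval:
  fixes z :: 'c
  assumes "\<forall>P\<in>set Ps. tate P" "cabs \<xi> \<le> 1"
  shows "ev (tpolyeval Ps z) \<xi> = poly (\<Sum>j<length Ps. monom (ev (Ps ! j) \<xi>) j) z"
proof -
  have *: "tpolyeval Ps z = (\<lambda>i. \<Sum>j<length Ps. tscal (z ^ j) (Ps ! j) i)"
    by (simp add: tpolyeval_def tscal_def mult.commute)
  have "ev (tpolyeval Ps z) \<xi> = (\<Sum>j<length Ps. ev (tscal (z ^ j) (Ps ! j)) \<xi>)"
    unfolding * using assms by (intro ev_sum) (auto simp: tscal_def tate_cmult)
  also have "\<dots> = (\<Sum>j<length Ps. z ^ j * ev (Ps ! j) \<xi>)"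
    using assms by (intro sum.cong ev_tscal) auto
  also have "\<dots> = poly (\<Sum>j<length Ps. monom (ev (Ps ! j) \<xi>) j) z"
    by (simp add: poly_sum poly_monom mult.commute)
  finally show ?thesis .
qed

text \<open>Evaluation is a ring homomorphism that does not increase the Gauss norm. It sends
  invertible denominators to nonzero values, so the approximants over the Tate algebra become
  rational functions over C_inf with no larger error.\<close>

lemma rigidC_ev:
  assumes h: "rigidT q th h" and \<xi>: "cabs \<xi> \<le> 1"
  shows "rigidC q th (\<lambda>z. ev (h z) \<xi>)"
  unfolding rigidC_def
proof (intro allI impI)
  fix n :: nat and e :: real assume "e > 0"
  then have "\<exists>Ps Qs. (\<forall>P\<in>set Ps. tate P) \<and> (\<forall>Q\<in>set Qs. tate Q) \<and>
        (\<forall>z\<in>Omega_n q th n. tunit (tpolyeval Qs z) \<and>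
           gnorm (\<lambda>i. h z i - tmult (tpolyeval Ps z) (tinv (tpolyeval Qs z)) i) < e)"
    by (rule h[unfolded rigidT_def, THEN conjunct2, THEN spec, THEN spec, THEN mp])
  then obtain Ps Qs where Ps: "\<forall>P\<in>set Ps. tate P" and Qs: "\<forall>Q\<in>set Qs. tate Q"
    and *: "\<forall>z\<in>Omega_n q th n. tunit (tpolyeval Qs z) \<and>
           gnorm (\<lambda>i. h z i - tmult (tpolyeval Ps z) (tinv (tpolyeval Qs z)) i) < e"
    by (elim exE conjE) (rule that)
  define P where "P = (\<Sum>j<length Ps. monom (ev (Ps ! j) \<xi>) j)"
  define Q where "Q = (\<Sum>j<length Qs. monom (ev (Qs ! j) \<xi>) j)"
  show "\<exists>P Q. \<forall>z\<in>Omega_n q th n. poly Q z \<noteq> 0 \<and> cabs (ev (h z) \<xi> - poly P z / poly Q z) < e"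
  proof (rule exI[of _ P], rule exI[of _ Q], rule ballI)
    fix z assume z: "z \<in> Omega_n q th n"
    define p where "p = tpolyeval Ps z"
    define r where "r = tpolyeval Qs z"
    define i where "i = tinv r"
    have "\<exists>h. tate h \<and> tmult r h = tone"
      using * z by (simp add: tunit_def r_def)
    then have i: "tate i" "tmult r i = tone"
      unfolding i_def tinv_def using someI_ex[of "\<lambda>h. tate h \<and> tmult r h = tone"] by auto
    have t: "tate p" "tate r" "tate (h z)"
      using Ps Qs h[unfolded rigidT_def, THEN conjunct1] Omega_n_Omega[OF z]
      unfolding p_def r_def by (simp_all add: tate_tpolyeval)
    have ev: "ev p \<xi> = poly P z" "ev r \<xi> = poly Q z"
      unfolding p_def r_def P_def Q_def using Ps Qs \<xi> by (simp_all add: ev_tpolyeval)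
    have 1: "poly Q z * ev i \<xi> = 1"
      using ev_tmult[OF t(2) i(1) \<xi>] i(2) ev_tone ev by simp
    then have Q: "poly Q z \<noteq> 0" by auto
    with 1 have "ev i \<xi> = 1 / poly Q z" by (simp add: field_simps)
    then have "ev (h z) \<xi> - poly P z / poly Q z = ev (\<lambda>j. h z j - tmult p i j) \<xi>"
      using t i \<xi> ev by (simp add: ev_diff ev_tmult tate_tmult)
    also have "cabs \<dots> \<le> gnorm (\<lambda>j. h z j - tmult p i j)"
      using t i \<xi> by (intro cabs_ev_le_gnorm tate_diff tate_tmult)
    also have "\<dots> < e" using * z by (simp add: p_def r_def i_def)
    finally show "poly Q z \<noteq> 0 \<and> cabs (ev (h z) \<xi> - poly P z / poly Q z) < e"
      using Q by simp
  qed
qed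

end

subsection \<open>Partial fractions\<close>

text \<open>Functions with a partial fraction decomposition whose poles lie in W. The clause
  \<open>pf_ext\<close> frees the values on W, so identities valid off the poles suffice whatever
  the convention \<open>inverse 0 = 0\<close> yields. The inductive form gives the induction of
  \<open>pf_null\<close>.\<close>

inductive pf :: "'a::field set \<Rightarrow> ('a \<Rightarrow> 'a) \<Rightarrow> bool" for W where
  pf_poly: "pf W (poly p)"
| pf_pole: "w \<in> W \<Longrightarrow> m \<ge> 1 \<Longrightarrow> pf W (\<lambda>z. inverse (z - w) ^ m)"
| pf_add: "pf W f \<Longrightarrow> pf W g \<Longrightarrow> pf W (\<lambda>z. f z + g z)"
| pf_cmult: "pf W f \<Longrightarrow> pf W (\<lambda>z. c * f z)"
| pf_ext: "pf W f \<Longrightarrow> (\<And>z. z \<notin> W \<Longrightarrow> g z = f z) \<Longrightarrow> pf W g"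

text \<open>Splitting 1/((z-w)(z-v)) into a multiple of 1/(z-v) - 1/(z-w) lowers the order of the
  pole at w.\<close>

lemma pf_pole_mult_pole:
  fixes v w :: "'a::field"
  assumes "v \<in> W" "w \<in> W" "v \<noteq> w"
  shows "pf W (\<lambda>z. inverse (z - w) ^ m * inverse (z - v))"
proof (induction m)
  case 0
  show ?case using pf_pole[OF assms(1), of 1] by simp
next
  case (Suc m)
  have "pf W (\<lambda>z. inverse (v - w) * (inverse (z - w) ^ m * inverse (z - v) + (- 1) * inverse (z - w) ^ Suc m))"
    using assms by (intro pf_cmult pf_add Suc pf_pole) auto
  then show ?case
  proof (rule pf_ext)
    fix z assume "z \<notin> W"
    then have "z - w \<noteq> 0" "z - v \<noteq> 0" "v - w \<noteq> 0" using assms by auto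
    then have "inverse (z - w) * inverse (z - v) = inverse (v - w) * (inverse (z - v) - inverse (z - w))"
      by (simp add: field_simps)
    then have "inverse (z - w) ^ m * (inverse (z - w) * inverse (z - v)) =
               inverse (z - w) ^ m * (inverse (v - w) * (inverse (z - v) - inverse (z - w)))"
      by (rule arg_cong)
    then show "inverse (z - w) ^ Suc m * inverse (z - v) =
      inverse (v - w) * (inverse (z - w) ^ m * inverse (z - v) + (- 1) * inverse (z - w) ^ Suc m)"
      by (simp add: algebra_simps)
  qed
qed

text \<open>Each generator is treated separately: a polynomial by synthetic division at v, a pole at
  v by raising its order, another pole by \<open>pf_pole_mult_pole\<close>.\<close>

lemma pf_mult_pole: "pf W f \<Longrightarrow> v \<in> W \<Longrightarrow> pf W (\<lambda>z. f z * inverse (z - v))"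
proof (induction rule: pf.induct)
  case (pf_poly p)
  have "pf W (\<lambda>z. poly (synthetic_div p v) z + poly p v * inverse (z - v) ^ 1)"
    using pf_poly by (intro pf.pf_add pf.pf_poly pf.pf_cmult pf.pf_pole) auto
  then show ?case
  proof (rule pf.pf_ext)
    fix z assume "z \<notin> W"
    then have "z - v \<noteq> 0" using pf_poly by auto
    moreover have "poly p z = (z - v) * poly (synthetic_div p v) z + poly p v"
      using arg_cong[OF synthetic_div_correct'[of v p], of "\<lambda>r. poly r z"] by (simp add: algebra_simps)
    ultimately show "poly p z * inverse (z - v) = poly (synthetic_div p v) z + poly p v * inverse (z - v) ^ 1"
      by (simp add: field_simps)
  qed
next
  case (pf_pole w m)
  show ?case
  proof (cases "v = w")
    case True
    then show ?thesis
      using pf.pf_pole[OF pf_pole(1), of "Suc m"] by (simp add: mult.commute)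
  next
    case False
    then show ?thesis using pf_pole_mult_pole pf_pole by blast
  qed
next
  case (pf_add f g)
  then show ?case using pf.pf_add[of W "\<lambda>z. f z * inverse (z - v)" "\<lambda>z. g z * inverse (z - v)"]
    by (simp add: distrib_right)
next
  case (pf_cmult f c)
  then show ?case using pf.pf_cmult[of W "\<lambda>z. f z * inverse (z - v)" c] by (simp add: mult.assoc)
next
  case (pf_ext f g)
  show ?case by (rule pf.pf_ext[OF pf_ext.IH[OF pf_ext.prems]]) (simp add: pf_ext.hyps)
qed

context Cinf_field begin

lemma poly_splits:
  fixes f :: "'c poly"
  assumes "f \<noteq> 0"
  shows "\<exists>c xs. c \<noteq> 0 \<and> f = smult c (\<Prod>x\<leftarrow>xs. [:- x, 1:])"
  using assms
proof (induction "degree f" arbitrary: f)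
  case 0
  then obtain a where "f = [:a:]" by (metis degree_eq_zeroE)
  with 0 show ?case by (intro exI[of _ a] exI[of _ "[]"]) auto
next
  case (Suc n)
  then obtain x where "poly f x = 0" using exists_root[of f] by auto
  then obtain g where g: "f = [:- x, 1:] * g" by (auto simp: poly_eq_0_iff_dvd elim: dvdE)
  with Suc have "g \<noteq> 0" by auto
  have "degree f = degree [:- x, 1:] + degree g"
    unfolding g using \<open>g \<noteq> 0\<close> by (intro degree_mult_eq) auto
  with Suc(2) have "n = degree g" by simp
  with Suc(1) \<open>g \<noteq> 0\<close> obtain c xs where "c \<noteq> 0" "g = smult c (\<Prod>x\<leftarrow>xs. [:- x, 1:])" by blast
  with g have "c \<noteq> 0 \<and> f = smult c (\<Prod>y\<leftarrow>x # xs. [:- y, 1:])"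
    by (simp del: mult_pCons_left)
  then show ?case by blast
qed

text \<open>The denominator splits over the algebraically closed field, and its linear factors are
  divided out one at a time.\<close>

lemma pf_rational:
  fixes P Q :: "'c poly"
  assumes "Q \<noteq> 0" "\<And>w. poly Q w = 0 \<Longrightarrow> w \<in> W"
  shows "pf W (\<lambda>z. poly P z / poly Q z)"
proof -
  obtain c xs where c: "c \<noteq> 0" and Q: "Q = smult c (\<Prod>x\<leftarrow>xs. [:- x, 1:])"
    using poly_splits[OF assms(1)] by blast
  have Q': "poly Q z = c * (\<Prod>x\<leftarrow>xs. z - x)" for z
    unfolding Q by (induction xs) (auto simp: algebra_simps)
  have W: "set xs \<subseteq> W"
  proof
    fix x assume "x \<in> set xs"
    then have "(\<Prod>y\<leftarrow>xs. x - y) = 0" by (induction xs) auto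
    then show "x \<in> W" using assms(2) by (simp add: Q')
  qed
  have "pf W (\<lambda>z. poly P z * inverse (\<Prod>x\<leftarrow>xs. z - x))"
    using W
  proof (induction xs)
    case Nil
    then show ?case using pf_poly[of W P] by simp
  next
    case (Cons x xs)
    then have "pf W (\<lambda>z. poly P z * inverse (\<Prod>x\<leftarrow>xs. z - x) * inverse (z - x))"
      by (intro pf_mult_pole) auto
    then show ?case by (simp add: mult_ac)
  qed
  from pf_cmult[OF this, of "inverse c"] show ?thesis
    unfolding Q' using c by (simp add: field_simps)
qed

text \<open>A linear functional with values in sequences needs to be checked on polynomials and pure
  poles only. It is applied to contour integrals, for which null sequences mean a vanishing
  integral.\<close>

lemma pf_null:
  fixes f :: "'c \<Rightarrow> 'c" and \<Phi> :: "('c \<Rightarrow> 'c) \<Rightarrow> nat \<Rightarrow> 'c"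
  assumes "pf W f"
    and poly: "\<And>p. tate (\<Phi> (poly p))"
    and pole: "\<And>w m. w \<in> W \<Longrightarrow> m \<ge> 1 \<Longrightarrow> tate (\<Phi> (\<lambda>z. inverse (z - w) ^ m))"
    and add: "\<And>f g. \<Phi> (\<lambda>z. f z + g z) = (\<lambda>k. \<Phi> f k + \<Phi> g k)"
    and cmult: "\<And>c f. \<Phi> (\<lambda>z. c * f z) = (\<lambda>k. c * \<Phi> f k)"
    and cong: "\<And>f g. (\<And>z. z \<notin> W \<Longrightarrow> g z = f z) \<Longrightarrow> \<Phi> g = \<Phi> f"
  shows "tate (\<Phi> f)"
  using assms(1)
proof (induction rule: pf.induct)
  case (pf_poly p)
  show ?case by (rule poly)
next
  case (pf_pole w m)
  then show ?case by (rule pole)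
next
  case (pf_add f g)
  show ?case unfolding add by (rule tate_add[OF pf_add.IH])
next
  case (pf_cmult f c)
  show ?case unfolding cmult by (rule tate_cmult[OF pf_cmult.IH])
next
  case (pf_ext f g)
  have "\<Phi> g = \<Phi> f" using pf_ext.hyps by (intro cong)
  then show ?case using pf_ext.IH by simp
qed

subsection \<open>Residues as averages over roots of unity\<close>

text \<open>The multiplicative group of the field with q^(k+1) elements. Its order is -1 in the
  field, so normalising a mean over it is a change of sign. \<open>Suc k\<close> avoids the exponent
  0.\<close>

definition mu :: "nat \<Rightarrow> 'c set" where
  "mu k = {x. x ^ (q ^ Suc k - 1) = 1}"

text \<open>Since the group has more than k elements, no exponent from 1 to k is trivial on
  it.\<close>

lemma order_mu_gt: "k < q ^ Suc k - 1"
proof -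
  have "Suc k < 2 ^ Suc k" by (rule less_exp)
  also have "(2::nat) ^ Suc k \<le> q ^ Suc k" using q_ge_2 by (rule power_mono) simp
  finally show ?thesis by simp
qed

lemma of_nat_q_power: "of_nat (q ^ Suc k) = (0 :: 'c)"
proof -
  obtain p r where p: "prime p" "r > 0" "q = p ^ r" "CHAR('c) = p"
    using q_prime_power_char by blast
  then have "p dvd q ^ Suc k" by (simp add: dvd_power)
  then show ?thesis using p(4) by (metis of_nat_eq_0_iff_char_dvd)
qed

lemma of_nat_order_mu: "of_nat (q ^ Suc k - 1) = (- 1 :: 'c)"
proof -
  have "q ^ Suc k \<ge> 1" using q_ge_2 by simp
  then have "of_nat (q ^ Suc k - 1) = (of_nat (q ^ Suc k) - of_nat 1 :: 'c)" by (rule of_nat_diff)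
  then show ?thesis by (simp only: of_nat_q_power of_nat_1 diff_0)
qed

text \<open>X^n - 1 splits, and a repeated root would be a zero of n X^(n-1), which is impossible
  for a root of unity when n is nonzero in the field.\<close>

lemma card_roots_of_unity:
  assumes n: "of_nat n \<noteq> (0 :: 'c)"
  shows "card {x :: 'c. x ^ n = 1} = n"
proof -
  define f :: "'c poly" where "f = monom 1 n - 1"
  have n0: "n > 0" using n by (cases n) auto
  have "coeff f n = 1" using n0 by (simp add: f_def)
  then have f0: "f \<noteq> 0" by (metis coeff_0 zero_neq_one)
  have roots: "{x. poly f x = 0} = {x. x ^ n = 1}" by (auto simp: f_def poly_monom)
  have "degree f \<le> n" unfolding f_def by (rule degree_diff_le) (auto simp: degree_monom_le)
  moreover have "n \<le> degree f" using \<open>coeff f n = 1\<close> by (intro le_degree) simp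
  ultimately have deg: "degree f = n" by simp
  obtain c xs where c: "c \<noteq> 0" "f = smult c (\<Prod>x\<leftarrow>xs. [:- x, 1:])"
    using poly_splits[OF f0] by blast
  have "degree (\<Prod>x\<leftarrow>ys. [:- x, 1:]) = length ys \<and> (\<Prod>x\<leftarrow>ys. [:- x, 1:]) \<noteq> 0" for ys :: "'c list"
  proof (induction ys)
    case (Cons y ys)
    then show ?case by (simp add: degree_mult_eq del: mult_pCons_left)
  qed simp
  with c deg have len: "length xs = n" by simp
  have "poly (\<Prod>x\<leftarrow>ys. [:- x, 1:]) z = 0 \<longleftrightarrow> z \<in> set ys" for ys and z :: 'c
    by (induction ys) (auto simp: algebra_simps)
  then have set: "{x. x ^ n = 1} = set xs" using roots c by auto
  have "distinct xs"
  proof (rule ccontr)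
    assume "\<not> distinct xs"
    then obtain as bs cs x where xs: "xs = as @ [x] @ bs @ [x] @ cs"
      using not_distinct_decomp by blast
    have "smult c (\<Prod>y\<leftarrow>as @ [x] @ bs @ [x] @ cs. F y) =
        F x * (F x * smult c ((\<Prod>y\<leftarrow>as. F y) * (\<Prod>y\<leftarrow>bs. F y) * (\<Prod>y\<leftarrow>cs. F y)))" for F
      by (simp add: mult_ac)
    with c(2) xs obtain g where g: "f = [:- x, 1:] * ([:- x, 1:] * g)" by metis
    have "poly (pderiv (L * (L * g))) x = 0" if "poly L x = 0" for L
      using that by (simp add: pderiv_mult)
    from this[of "[:- x, 1:]"] have "poly (pderiv f) x = 0"
      unfolding g by (simp del: mult_pCons_left)
    then have "of_nat n * x ^ (n - 1) = 0"
      by (simp add: f_def pderiv_diff pderiv_monom poly_monom)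
    moreover have "x ^ n = 1" using set xs by auto
    moreover from this have "x \<noteq> 0" using n0 by (auto simp: power_0_left)
    ultimately show False using n by simp
  qed
  then show "card {x :: 'c. x ^ n = 1} = n"
    unfolding set using len by (simp add: distinct_card)
qed

lemma card_mu: "card (mu k) = q ^ Suc k - 1"
  unfolding mu_def using card_roots_of_unity[of "q ^ Suc k - 1"] of_nat_order_mu[of k] by auto

lemma mu_cabs: "x \<in> mu k \<Longrightarrow> cabs x = 1"
  unfolding mu_def using order_mu_gt[of k] by (intro cabs_eq_1I[of x "q ^ Suc k - 1"]) auto

lemma mu_nonzero: "x \<in> mu k \<Longrightarrow> x \<noteq> 0"
  using mu_cabs[of x k] by auto

text \<open>Multiplication by some a with a^n different from 1 permutes the group and scales the sum
  by a^n. Such an a exists because X^n - 1 has at most n roots.\<close>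

lemma sum_mu_power:
  assumes "0 < n" "n \<le> k"
  shows "(\<Sum>x\<in>mu k. x ^ n) = 0"
proof -
  have "\<exists>a\<in>mu k. a ^ n \<noteq> 1"
  proof (rule ccontr)
    assume "\<not> ?thesis"
    then have sub: "mu k \<subseteq> {x. poly (monom 1 n - 1) x = 0}" by (auto simp: poly_monom)
    have "coeff (monom 1 n - 1 :: 'c poly) n = 1" using assms by simp
    then have 0: "(monom 1 n - 1 :: 'c poly) \<noteq> 0" by (metis coeff_0 zero_neq_one)
    have "card (mu k) \<le> card {x. poly (monom 1 n - 1 :: 'c poly) x = 0}"
      by (rule card_mono[OF poly_roots_finite[OF 0] sub])
    also have "\<dots> \<le> degree (monom 1 n - 1 :: 'c poly)" by (rule card_poly_roots_bound[OF 0])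
    also have "\<dots> \<le> n" by (rule degree_diff_le) (auto simp: degree_monom_le)
    finally show False using assms order_mu_gt[of k] by (simp add: card_mu)
  qed
  then obtain a where a: "a \<in> mu k" "a ^ n \<noteq> 1" by blast
  have "bij_betw (\<lambda>x. a * x) (mu k) (mu k)"
    by (rule bij_betw_byWitness[where f' = "\<lambda>x. x / a"])
       (use a mu_nonzero[OF a(1)] in \<open>auto simp: mu_def power_mult_distrib power_divide\<close>)
  then have "(\<Sum>x\<in>mu k. x ^ n) = (\<Sum>x\<in>mu k. (a * x) ^ n)"
    by (rule sum.reindex_bij_betw[symmetric])
  also have "\<dots> = a ^ n * (\<Sum>x\<in>mu k. x ^ n)"
    by (simp add: power_mult_distrib sum_distrib_left)
  finally show ?thesis using a(2) by simp
qed

lemma sum_mu_inverse_power: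
  assumes "0 < n" "n \<le> k"
  shows "(\<Sum>x\<in>mu k. inverse x ^ n) = 0"
proof -
  have "bij_betw inverse (mu k) (mu k)"
    by (rule bij_betw_byWitness[where f' = inverse]) (auto simp: mu_def power_inverse)
  then have "(\<Sum>x\<in>mu k. inverse x ^ n) = (\<Sum>x\<in>mu k. x ^ n)"
    by (rule sum.reindex_bij_betw)
  then show ?thesis using sum_mu_power[OF assms] by simp
qed

text \<open>In characteristic \<open>p\<close> the mean over the \<open>q\<^sup>k - 1\<close> roots of unity is the negated sum, so this is
  the approximation of the residue integral over the circle of radius \<open>\<bar>c\<bar>\<close> around \<open>\<kappa>\<close> due to Shnirelman.\<close>
definition avg :: "'c \<Rightarrow> 'c \<Rightarrow> ('c \<Rightarrow> 'c) \<Rightarrow> nat \<Rightarrow> 'c" where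
  "avg c \<kappa> g k = - (\<Sum>x\<in>mu k. c * x * g (\<kappa> + c * x))"

lemma avg_shift: "avg c \<kappa> g = avg c 0 (\<lambda>z. g (\<kappa> + z))"
  by (simp add: avg_def fun_eq_iff)

lemma avg_add: "avg c \<kappa> (\<lambda>z. f z + g z) = (\<lambda>k. avg c \<kappa> f k + avg c \<kappa> g k)"
  by (simp add: avg_def fun_eq_iff algebra_simps sum.distrib)

lemma avg_cmult: "avg c \<kappa> (\<lambda>z. s * g z) = (\<lambda>k. s * avg c \<kappa> g k)"
  by (simp add: avg_def fun_eq_iff sum_distrib_left algebra_simps)

lemma avg_diff: "avg c \<kappa> (\<lambda>z. f z - g z) k = avg c \<kappa> f k - avg c \<kappa> g k"
  by (simp add: avg_def algebra_simps sum_subtractf)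

lemma avg_sum: "avg c \<kappa> (\<lambda>z. \<Sum>i\<in>I. s i * g i z) k = (\<Sum>i\<in>I. s i * avg c \<kappa> (g i) k)"
proof (induction I rule: infinite_finite_induct)
  case (insert i I)
  then show ?case by (simp add: avg_add avg_cmult)
qed (simp_all add: avg_def)

lemma circle_point: "x \<in> mu k \<Longrightarrow> cabs (\<kappa> + c * x - \<kappa>) = cabs c"
  using mu_cabs[of x k] by (simp add: cabs_mult)

lemma avg_cong:
  assumes "\<And>z. cabs (z - \<kappa>) = cabs c \<Longrightarrow> f z = g z"
  shows "avg c \<kappa> f = avg c \<kappa> g"
  unfolding avg_def fun_eq_iff using assms[OF circle_point] by simp

lemma avg_bound:
  assumes "B \<ge> 0" "\<And>z. cabs (z - \<kappa>) = cabs c \<Longrightarrow> cabs c * cabs (g z) \<le> B"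
  shows "cabs (avg c \<kappa> g k) \<le> B"
  unfolding avg_def cabs_minus
proof (rule cabs_sum_le[OF assms(1)])
  fix x assume x: "x \<in> mu k"
  show "cabs (c * x * g (\<kappa> + c * x)) \<le> B"
    using assms(2)[OF circle_point[OF x]] mu_cabs[OF x] by (simp add: cabs_mult)
qed

lemma avg_less:
  assumes "B > 0" "\<And>z. cabs (z - \<kappa>) = cabs c \<Longrightarrow> cabs c * cabs (g z) < B"
  shows "cabs (avg c \<kappa> g k) < B"
proof -
  have *: "cabs (sum f A) < B" if "\<And>a. a \<in> A \<Longrightarrow> cabs (f a) < B" for f :: "'c \<Rightarrow> 'c" and A
    using that by (induction A rule: infinite_finite_induct) (auto simp: assms(1) intro!: cabs_add_less)
  have "cabs (c * x * g (\<kappa> + c * x)) < B" if x: "x \<in> mu k" for x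
    using assms(2)[OF circle_point[OF x]] mu_cabs[OF x] by (simp add: cabs_mult)
  then show ?thesis unfolding avg_def cabs_minus by (rule *)
qed

section \<open>Residues of polynomials and of pure poles\<close>

definition has_res :: "'c \<Rightarrow> 'c \<Rightarrow> ('c \<Rightarrow> 'c) \<Rightarrow> 'c \<Rightarrow> bool" where
  "has_res c \<kappa> g L \<longleftrightarrow> tate (\<lambda>k. avg c \<kappa> g k - L)"

lemma has_res_shift: "has_res c \<kappa> g L \<longleftrightarrow> has_res c 0 (\<lambda>z. g (\<kappa> + z)) L"
  unfolding has_res_def by (subst avg_shift) simp

lemma has_res_sum:
  assumes "\<And>i. i \<in> I \<Longrightarrow> has_res c \<kappa> (g i) (L i)"
  shows "has_res c \<kappa> (\<lambda>z. \<Sum>i\<in>I. s i * g i z) (\<Sum>i\<in>I. s i * L i)"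
proof -
  have "tate (\<lambda>k. \<Sum>i\<in>I. s i * (avg c \<kappa> (g i) k - L i))"
    using assms by (intro tate_sum tate_cmult) (simp add: has_res_def)
  then show ?thesis
    by (simp add: has_res_def avg_sum right_diff_distrib sum_subtractf)
qed

lemma tate_uniform:
  fixes X :: "nat \<Rightarrow> 'c"
  assumes "\<And>e. e > 0 \<Longrightarrow> \<exists>Y. tate Y \<and> (\<forall>k. cabs (X k - Y k) < e)"
  shows "tate X"
  unfolding tate_iff
proof (intro allI impI)
  fix e :: real assume "e > 0"
  then obtain Y where Y: "tate Y" "\<And>k. cabs (X k - Y k) < e"
    using assms by blast
  obtain n where n: "\<And>k. k \<ge> n \<Longrightarrow> cabs (Y k) < e"
    using Y(1) \<open>e > 0\<close> unfolding tate_iff by metis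
  have "cabs (X k) < e" if "k \<ge> n" for k
    using cabs_add_less[OF Y(2)[of k] n[OF that]] by simp
  then show "\<exists>n. \<forall>k\<ge>n. cabs (X k) < e" by blast
qed

text \<open>With the weight |c| included, averaging does not increase the supremum on the circle, so
  residues survive uniform approximation.\<close>

lemma has_res_uniform:
  assumes "\<And>e. e > 0 \<Longrightarrow> \<exists>h. has_res c \<kappa> h L \<and> (\<forall>z. cabs (z - \<kappa>) = cabs c \<longrightarrow> cabs c * cabs (g z - h z) \<le> e)"
  shows "has_res c \<kappa> g L"
  unfolding has_res_def
proof (rule tate_uniform)
  fix e :: real assume e: "e > 0"
  then obtain h where h: "has_res c \<kappa> h L"
    "\<And>z. cabs (z - \<kappa>) = cabs c \<Longrightarrow> cabs c * cabs (g z - h z) \<le> e / 2"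
    using assms[of "e / 2"] by auto
  have "cabs (avg c \<kappa> g k - avg c \<kappa> h k) < e" for k
  proof -
    have "cabs (avg c \<kappa> (\<lambda>z. g z - h z) k) \<le> e / 2"
      using e by (intro avg_bound h(2)) auto
    then show ?thesis using e by (simp add: avg_diff)
  qed
  then show "\<exists>Y. tate Y \<and> (\<forall>k. cabs (avg c \<kappa> g k - L - Y k) < e)"
    using h(1) unfolding has_res_def by (intro exI[of _ "\<lambda>k. avg c \<kappa> h k - L"]) simp
qed

lemma tate_eventually_0: "(\<And>k. k \<ge> n \<Longrightarrow> f k = 0) \<Longrightarrow> tate f" for f :: "nat \<Rightarrow> 'c"
  unfolding tate_iff by (intro allI impI exI[of _ n]) simp

text \<open>The weight in \<open>avg\<close> raises the exponent to j + 1, so the sums vanish from k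
  = j + 1 on.\<close>

lemma has_res_power: "has_res c 0 (\<lambda>z. z ^ j) 0"
  unfolding has_res_def
proof (rule tate_eventually_0[of "Suc j"])
  fix k assume "k \<ge> Suc j"
  then have "(\<Sum>x\<in>mu k. x ^ Suc j) = 0" by (intro sum_mu_power) auto
  moreover have "avg c 0 (\<lambda>z. z ^ j) k = - (c ^ Suc j * (\<Sum>x\<in>mu k. x ^ Suc j))"
    by (simp add: avg_def sum_distrib_left power_mult_distrib mult_ac)
  ultimately show "avg c 0 (\<lambda>z. z ^ j) k - 0 = 0" by simp
qed

text \<open>The weight lowers the order to j - 1. For j = 1 all terms are 1, and their number, -1 in
  the field, cancels the sign in \<open>avg\<close>.\<close>

lemma has_res_inverse_power:
  assumes "c \<noteq> 0" "j \<ge> 1"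
  shows "has_res c 0 (\<lambda>z. inverse z ^ j) (if j = 1 then 1 else 0)"
  unfolding has_res_def
proof (rule tate_eventually_0[of j])
  fix k assume k: "k \<ge> j"
  have "avg c 0 (\<lambda>z. inverse z ^ j) k = - (\<Sum>x\<in>mu k. inverse c ^ (j - 1) * inverse x ^ (j - 1))"
    unfolding avg_def
  proof (rule arg_cong[where f = uminus], rule sum.cong)
    fix x assume "x \<in> mu k"
    then have "x \<noteq> 0" by (rule mu_nonzero)
    obtain i where i: "j = Suc i" using assms by (cases j) auto
    have "c * x * inverse (c * x) ^ Suc i = (c * x * inverse (c * x)) * inverse (c * x) ^ i"
      by (simp only: power_Suc mult.assoc)
    also have "c * x * inverse (c * x) = 1" using assms \<open>x \<noteq> 0\<close> by (intro right_inverse) simp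
    finally show "c * x * inverse (0 + c * x) ^ j = inverse c ^ (j - 1) * inverse x ^ (j - 1)"
      by (simp add: i power_mult_distrib del: power_Suc)
  qed simp
  also have "\<dots> = - (inverse c ^ (j - 1) * (\<Sum>x\<in>mu k. inverse x ^ (j - 1)))"
    by (simp add: sum_distrib_left)
  also have "\<dots> = (if j = 1 then 1 else 0)"
  proof (cases "j = 1")
    case True
    then show ?thesis using of_nat_order_mu[of k] by (simp add: card_mu del: power_Suc)
  next
    case False
    then show ?thesis using k assms by (simp add: sum_mu_inverse_power)
  qed
  finally show "avg c 0 (\<lambda>z. inverse z ^ j) k - (if j = 1 then 1 else 0) = 0" by simp
qed

lemma exists_power_small:
  fixes C r e :: real
  assumes "0 \<le> r" "r < 1" "e > 0"
  shows "\<exists>n\<ge>1. C * r ^ n \<le> e"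
proof -
  have "(\<lambda>n. C * r ^ n) \<longlonglongrightarrow> 0"
    using LIMSEQ_realpow_zero[OF assms(1,2)] by (rule tendsto_mult_right_zero)
  then have "eventually (\<lambda>n. C * r ^ n < e) sequentially"
    using assms(3) by (rule order_tendstoD)
  then have "eventually (\<lambda>n. C * r ^ n < e \<and> n \<ge> 1) sequentially"
    using eventually_ge_at_top[of 1] by (rule eventually_conj)
  then obtain n where "C * r ^ n < e \<and> n \<ge> 1"
    unfolding eventually_sequentially by blast
  then show ?thesis by (intro exI[of _ n]) simp
qed

text \<open>On the circle |z| > |w|, so 1/(z-w) is expanded as a geometric series in w/z, by
  iterating 1/(z-w) = 1/z + w/((z-w)z). The extra factor \<open>inverse z ^ j\<close> makes the
  induction on the pole order go through.\<close>

lemma has_res_inner_pole_aux: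
  assumes wc: "cabs w < cabs c"
  shows "m + j \<ge> 1 \<Longrightarrow>
    has_res c 0 (\<lambda>z. inverse (z - w) ^ m * inverse z ^ j) (if m + j = 1 then 1 else 0)"
proof (induction m arbitrary: j)
  case 0
  have "c \<noteq> 0" using wc by (metis cabs_0 cabs_nonneg not_less)
  then show ?case using has_res_inverse_power[of c j] 0 by simp
next
  case (Suc m)
  have c: "cabs c > 0" using wc cabs_nonneg[of w] by linarith
  show ?case
  proof (rule has_res_uniform)
    fix e :: real assume "e > 0"
    define C where "C = cabs c * inverse (cabs c) ^ Suc m * inverse (cabs c) ^ j"
    obtain J where J: "J \<ge> 1" "C * (cabs w / cabs c) ^ J \<le> e"
      using exists_power_small[of "cabs w / cabs c" e C] wc c \<open>e > 0\<close> by auto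
    \<comment> \<open>The series for one factor, truncated at J. Only m = j = i = 0 gives total
      order 1, and J \<ge> 1 ensures that i = 0 occurs.\<close>
    define h where "h = (\<lambda>z. \<Sum>i<J. w ^ i * (inverse (z - w) ^ m * inverse z ^ (j + 1 + i)))"
    have "has_res c 0 h (\<Sum>i<J. w ^ i * (if m + (j + 1 + i) = 1 then 1 else 0))"
      unfolding h_def by (intro has_res_sum Suc.IH) simp
    also have "(\<Sum>i<J. w ^ i * (if m + (j + 1 + i) = 1 then 1 else 0)) = (if Suc m + j = 1 then 1 else 0)"
    proof -
      have "(\<Sum>i<J. w ^ i * (if m + (j + 1 + i) = 1 then 1 else 0)) =
            (\<Sum>i<J. if i = 0 then (if Suc m + j = 1 then 1 else 0) else 0)"
        by (intro sum.cong) auto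
      then show ?thesis using J(1) by (simp add: sum.delta)
    qed
    finally have h: "has_res c 0 h (if Suc m + j = 1 then 1 else 0)" .
    have "cabs c * cabs (inverse (z - w) ^ Suc m * inverse z ^ j - h z) \<le> e" if z: "cabs z = cabs c" for z
    proof -
      have z0: "z \<noteq> 0" "z \<noteq> w" using z c wc by auto
      have "inverse (z - w) = inverse z + w * (inverse (z - w) * inverse z)"
        using z0 by (simp add: field_simps)
      then have "inverse (z - w) * (inverse (z - w) ^ m * inverse z ^ i) =
          (inverse z + w * (inverse (z - w) * inverse z)) * (inverse (z - w) ^ m * inverse z ^ i)" for i
        by simp
      then have step: "inverse (z - w) ^ Suc m * inverse z ^ i =
          inverse (z - w) ^ m * inverse z ^ (i + 1) + w * (inverse (z - w) ^ Suc m * inverse z ^ (i + 1))" for i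
        by (simp add: algebra_simps)
      have "inverse (z - w) ^ Suc m * inverse z ^ j =
          (\<Sum>i<n. w ^ i * (inverse (z - w) ^ m * inverse z ^ (j + 1 + i))) +
          w ^ n * (inverse (z - w) ^ Suc m * inverse z ^ (j + n))" for n
      proof (induction n)
        case (Suc n)
        have "w ^ n * (inverse (z - w) ^ Suc m * inverse z ^ (j + n)) =
            w ^ n * (inverse (z - w) ^ m * inverse z ^ (j + 1 + n)) +
            w ^ Suc n * (inverse (z - w) ^ Suc m * inverse z ^ (j + Suc n))"
          by (subst step[of "j + n"]) (simp add: algebra_simps)
        with Suc show ?case by (simp only: sum.lessThan_Suc add.assoc)
      qed simp
      then have "inverse (z - w) ^ Suc m * inverse z ^ j - h z =
          w ^ J * (inverse (z - w) ^ Suc m * inverse z ^ (j + J))"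
        unfolding h_def by (simp add: algebra_simps)
      moreover have "cabs (z - w) = cabs c" using cabs_diff_eq'[of w z] z wc by simp
      ultimately have "cabs c * cabs (inverse (z - w) ^ Suc m * inverse z ^ j - h z) =
          cabs c * (cabs w ^ J * (inverse (cabs c) ^ Suc m * inverse (cabs c) ^ (j + J)))"
        using z by (simp only: cabs_mult cabs_power cabs_inverse)
      also have "\<dots> = C * (cabs w / cabs c) ^ J"
        by (simp add: C_def power_add power_divide power_mult_distrib field_simps)
      also have "\<dots> \<le> e" by (rule J)
      finally show ?thesis .
    qed
    with h show "\<exists>h. has_res c 0 h (if Suc m + j = 1 then 1 else 0) \<and> (\<forall>z. cabs (z - 0) = cabs c \<longrightarrow>
           cabs c * cabs (inverse (z - w) ^ Suc m * inverse z ^ j - h z) \<le> e)"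
      by (intro exI[of _ h]) simp
  qed
qed

text \<open>Now |z| < |w| on the circle, and the geometric series runs in z/w; all terms have
  residue 0. The factor \<open>z ^ j\<close> is again there for the induction.\<close>

lemma has_res_outer_pole_aux:
  assumes wc: "cabs c < cabs w"
  shows "has_res c 0 (\<lambda>z. inverse (z - w) ^ m * z ^ j) 0"
proof (induction m arbitrary: j)
  case 0
  then show ?case using has_res_power[of c j] by simp
next
  case (Suc m)
  have w: "cabs w > 0" using wc cabs_nonneg[of c] by linarith
  show ?case
  proof (rule has_res_uniform)
    fix e :: real assume "e > 0"
    define C where "C = cabs c * inverse (cabs w) ^ Suc m * cabs c ^ j"
    define v where "v = inverse w"
    obtain J where J: "J \<ge> 1" "C * (cabs c / cabs w) ^ J \<le> e"
      using exists_power_small[of "cabs c / cabs w" e C] wc w \<open>e > 0\<close> by auto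
    define h where "h = (\<lambda>z. \<Sum>i<J. (- v * v ^ i) * (inverse (z - w) ^ m * z ^ (j + i)))"
    have "has_res c 0 h (\<Sum>i<J. (- v * v ^ i) * 0)"
      unfolding h_def by (intro has_res_sum Suc.IH)
    then have h: "has_res c 0 h 0" by simp
    have "cabs c * cabs (inverse (z - w) ^ Suc m * z ^ j - h z) \<le> e" if z: "cabs z = cabs c" for z
    proof -
      have z0: "w \<noteq> 0" "z \<noteq> w" using z w wc by auto
      have "inverse (z - w) = - v + v * (inverse (z - w) * z)"
        using z0 by (simp add: field_simps v_def)
      then have "inverse (z - w) * (inverse (z - w) ^ m * z ^ i) =
          (- v + v * (inverse (z - w) * z)) * (inverse (z - w) ^ m * z ^ i)" for i
        by simp
      then have step: "inverse (z - w) ^ Suc m * z ^ i =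
          - v * (inverse (z - w) ^ m * z ^ i) + v * (inverse (z - w) ^ Suc m * z ^ (i + 1))" for i
        by (simp add: algebra_simps)
      have "inverse (z - w) ^ Suc m * z ^ j =
          (\<Sum>i<n. (- v * v ^ i) * (inverse (z - w) ^ m * z ^ (j + i))) +
          v ^ n * (inverse (z - w) ^ Suc m * z ^ (j + n))" for n
      proof (induction n)
        case (Suc n)
        have "v ^ n * (inverse (z - w) ^ Suc m * z ^ (j + n)) = - v * v ^ n * (inverse (z - w) ^ m * z ^ (j + n)) +
            v ^ Suc n * (inverse (z - w) ^ Suc m * z ^ (j + Suc n))"
          by (subst step[of "j + n"]) (simp add: algebra_simps)
        with Suc show ?case by (simp only: sum.lessThan_Suc add.assoc)
      qed simp
      then have "inverse (z - w) ^ Suc m * z ^ j - h z =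
          v ^ J * (inverse (z - w) ^ Suc m * z ^ (j + J))"
        unfolding h_def by (simp add: algebra_simps)
      moreover have "cabs (z - w) = cabs w" using cabs_diff_eq[of z w] z wc by simp
      ultimately have "cabs c * cabs (inverse (z - w) ^ Suc m * z ^ j - h z) =
          cabs c * (inverse (cabs w) ^ J * (inverse (cabs w) ^ Suc m * cabs c ^ (j + J)))"
        using z unfolding v_def by (simp only: cabs_mult cabs_power cabs_inverse)
      also have "\<dots> = C * (cabs c / cabs w) ^ J"
        by (simp add: C_def power_add power_divide power_mult_distrib field_simps)
      also have "\<dots> \<le> e" by (rule J)
      finally show ?thesis .
    qed
    with h show "\<exists>h. has_res c 0 h 0 \<and> (\<forall>z. cabs (z - 0) = cabs c \<longrightarrow>
           cabs c * cabs (inverse (z - w) ^ Suc m * z ^ j - h z) \<le> e)"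
      by (intro exI[of _ h]) simp
  qed
qed

lemma has_res_inner_pole:
  assumes "cabs (w - \<kappa>) < cabs c" "m \<ge> 1"
  shows "has_res c \<kappa> (\<lambda>z. inverse (z - w) ^ m) (if m = 1 then 1 else 0)"
  using has_res_inner_pole_aux[OF assms(1), of m 0] assms(2)
  by (subst has_res_shift) (simp add: algebra_simps)

lemma has_res_outer_pole:
  assumes "cabs (w - \<kappa>) > cabs c"
  shows "has_res c \<kappa> (\<lambda>z. inverse (z - w) ^ m) 0"
  using has_res_outer_pole_aux[OF assms, of m 0]
  by (subst has_res_shift) (simp add: algebra_simps)

lemma has_res_poly: "has_res c \<kappa> (poly p) 0"
proof -
  define r where "r = pcompose p [:\<kappa>, 1:]"
  have "has_res c 0 (\<lambda>z. \<Sum>i\<le>degree r. coeff r i * z ^ i) (\<Sum>i\<le>degree r. coeff r i * 0)"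
    by (intro has_res_sum has_res_power)
  moreover have "(\<lambda>z. \<Sum>i\<le>degree r. coeff r i * z ^ i) = (\<lambda>z. poly p (\<kappa> + z))"
    by (simp add: r_def poly_pcompose flip: poly_altdef)
  ultimately show ?thesis by (subst has_res_shift) simp
qed


subsection \<open>Circles avoiding \<open>K\<^sub>\<infinity>\<close>\<close>

text \<open>Its absolute value q^(1/2) lies strictly between two neighbouring absolute values of
  K_inf.\<close>

definition sigma :: 'c where
  "sigma = (SOME x. x ^ 2 = th)"

text \<open>The circles of radius \<open>\<bar>rad N\<bar> = q\<^sup>N\<^sup>+\<^sup>1\<^sup>/\<^sup>2\<close> and \<open>\<bar>rad0\<bar> = q\<^sup>-\<^sup>1\<^sup>/\<^sup>2\<close> stay away from \<open>K\<^sub>\<infinity>\<close>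
  because these radii are not in the value group of \<open>K\<^sub>\<infinity>\<close>.\<close>
definition rad :: "nat \<Rightarrow> 'c" where
  "rad N = sigma * th ^ N"

definition rad0 :: 'c where
  "rad0 = inverse sigma"

lemma sigma_square: "sigma ^ 2 = th"
proof -
  let ?f = "monom 1 2 - [:th:] :: 'c poly"
  have "coeff ?f 2 = 1" by (simp add: coeff_pCons numeral_2_eq_2)
  then have "degree ?f \<ge> 2" by (intro le_degree) simp
  then obtain x where "poly ?f x = 0" using exists_root[of ?f] by auto
  then have "\<exists>x. x ^ 2 = th" by (auto simp: poly_monom)
  then show ?thesis unfolding sigma_def by (rule someI_ex)
qed

lemma cabs_sigma_square: "cabs sigma * cabs sigma = real q"
  using arg_cong[OF sigma_square, of cabs] by (simp add: cabs_th power2_eq_square cabs_mult)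

lemma cabs_sigma: "1 < cabs sigma" "cabs sigma < real q"
proof -
  show 1: "1 < cabs sigma"
  proof (rule ccontr)
    assume "\<not> 1 < cabs sigma"
    then have "cabs sigma * cabs sigma \<le> 1" by (intro mult_le_one) auto
    then show False using cabs_sigma_square real_q_gt_1 by simp
  qed
  then have "cabs sigma * 1 < cabs sigma * cabs sigma" by (intro mult_strict_left_mono) auto
  then show "cabs sigma < real q" using cabs_sigma_square by simp
qed

lemma sigma_nonzero: "sigma \<noteq> 0"
  using cabs_sigma by auto

lemma th_nonzero: "th \<noteq> 0"
  using cabs_th real_q_gt_1 by auto

lemma th_Aset: "th \<in> Aset q th"
  using Aset_poly[of "[:0, 1:]"] by simp

lemma cabs_rad: "real q ^ N < cabs (rad N)" "cabs (rad N) < real q ^ Suc N"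
  using cabs_sigma real_q_gt_1 by (simp_all add: rad_def cabs_mult cabs_power cabs_th)

lemma rad_nonzero: "rad N \<noteq> 0"
  using sigma_nonzero th_nonzero by (simp add: rad_def)

lemma cabs_rad0: "inverse (real q) < cabs rad0" "cabs rad0 < 1" "0 < cabs rad0"
  using cabs_sigma by (auto simp: rad0_def cabs_inverse sigma_nonzero intro!: inverse_less_1_iff[THEN iffD2])

text \<open>Up to an error below |sigma|, y is an element of A and would share its absolute value, a
  power of q; but 1 < |sigma| < q.\<close>

lemma cabs_Kinf_neq_sigma: "y \<in> Kinf q th \<Longrightarrow> cabs y \<noteq> cabs sigma"
proof
  assume y: "y \<in> Kinf q th" and eq: "cabs y = cabs sigma"
  obtain a where a: "a \<in> Aset q th" "cabs (y - a) \<le> inverse (real q)"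
    using Kinf_approx[OF y] by blast
  have "cabs (y - a) < cabs y" using a(2) cabs_sigma cabs_rad0 eq by linarith
  then have *: "cabs a = cabs sigma" using cabs_eq_if_close eq by metis
  then have "a \<noteq> 0" using sigma_nonzero by auto
  then obtain n where n: "cabs a = real q ^ n" using cabs_Aset a(1) by blast
  show False
  proof (cases n)
    case 0
    then show ?thesis using n * cabs_sigma by simp
  next
    case (Suc m)
    have "real q ^ 1 \<le> real q ^ n" using Suc real_q_gt_1 by (intro power_increasing) auto
    then show ?thesis using n * cabs_sigma by simp
  qed
qed

text \<open>When |k| and |z| always differ, |z - k| is the larger of the two, and k = 0 attains the
  infimum.\<close>

lemma imnorm_eq_cabs:
  assumes "\<And>k. k \<in> Kinf q th \<Longrightarrow> cabs k \<noteq> cabs z"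
  shows "imnorm q th z = cabs z"
proof (rule antisym[OF imnorm_le_cabs imnorm_geI])
  fix k assume "k \<in> Kinf q th"
  then have "cabs k < cabs z \<or> cabs z < cabs k" using assms by force
  then show "cabs z \<le> cabs (z - k)"
    using cabs_diff_eq'[of k z] cabs_diff_eq[of z k] by auto
qed

lemma imnorm_rad:
  assumes "cabs z = cabs (rad N)"
  shows "imnorm q th z = cabs z"
proof (rule imnorm_eq_cabs)
  fix k assume "k \<in> Kinf q th"
  then have "k / th ^ N \<in> Kinf q th"
    by (rule Kinf_divide[OF _ Aset_Kinf[OF Aset_power[OF th_Aset]]])
  then have "cabs (k / th ^ N) \<noteq> cabs sigma" by (rule cabs_Kinf_neq_sigma)
  then show "cabs k \<noteq> cabs z"
    using real_q_gt_1 by (simp add: assms rad_def cabs_divide cabs_mult cabs_power cabs_th field_simps)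
qed

lemma imnorm_rad0:
  assumes "cabs z = cabs rad0"
  shows "imnorm q th z = cabs z"
proof (rule imnorm_eq_cabs)
  fix k assume "k \<in> Kinf q th"
  then have "k * th \<in> Kinf q th"
    by (rule Kinf_mult[OF _ Aset_Kinf[OF th_Aset]])
  then have "cabs (k * th) \<noteq> cabs sigma" by (rule cabs_Kinf_neq_sigma)
  moreover have "inverse (cabs sigma) * real q = cabs sigma"
    using sigma_nonzero by (simp flip: cabs_sigma_square)
  ultimately show "cabs k \<noteq> cabs z"
    by (auto simp: assms rad0_def cabs_inverse cabs_mult cabs_th)
qed

subsection \<open>Finite lattices\<close>

text \<open>The values at \<open>th\<close> of the polynomials of degree at most N, a finite
  additive group.\<close>

definition AN :: "nat \<Rightarrow> 'c set" where
  "AN N = {x \<in> Aset q th. cabs x \<le> real q ^ N}"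

lemma AN_Aset: "x \<in> AN N \<Longrightarrow> x \<in> Aset q th"
  by (simp add: AN_def)

lemma AN_0 [simp]: "0 \<in> AN N"
  by (simp add: AN_def)

lemma AN_diff: "x \<in> AN N \<Longrightarrow> y \<in> AN N \<Longrightarrow> x - y \<in> AN N"
  by (simp add: AN_def Aset_diff cabs_diff_leI)

lemma AN_mono: "m \<le> n \<Longrightarrow> AN m \<subseteq> AN n"
proof -
  assume "m \<le> n"
  then have "real q ^ m \<le> real q ^ n" using real_q_gt_1 by (intro power_increasing) auto
  then show ?thesis by (auto simp: AN_def)
qed

text \<open>No element of A has absolute value strictly between q^N and q^(N+1).\<close>

lemma AN_iff:
  assumes "x \<in> Aset q th"
  shows "x \<in> AN N \<longleftrightarrow> cabs x < real q ^ Suc N"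
proof (cases "x = 0")
  case True
  then show ?thesis using real_q_gt_1 by simp
next
  case False
  then obtain n where "cabs x = real q ^ n" using cabs_Aset assms by blast
  then show ?thesis using assms real_q_gt_1 by (simp add: AN_def power_strict_increasing_iff less_Suc_eq_le del: power_Suc)
qed

lemma AN_cabs_rad: "x \<in> AN N \<Longrightarrow> cabs x < cabs (rad N)"
  using cabs_rad(1)[of N] by (simp add: AN_def)

lemma not_AN_cabs: "x \<in> Aset q th \<Longrightarrow> x \<notin> AN N \<Longrightarrow> cabs x \<ge> real q ^ Suc N"
  using AN_iff by auto

lemma finite_AN: "finite (AN N)"
proof (induction N)
  case 0
  have "AN 0 \<subseteq> Fqset q"
  proof
    fix x assume x: "x \<in> AN 0"
    then obtain a where a: "Fqpoly q a" "x = poly a th" by (auto simp: AN_def elim: AsetE)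
    obtain c b where cb: "a = pCons c b" by (rule pCons_cases)
    have "b = 0"
    proof (rule ccontr)
      assume "b \<noteq> 0"
      then have "cabs x = real q ^ Suc (degree b)"
        using cabs_poly_th[OF a(1)] a(2) cb by simp
      moreover have "real q ^ Suc (degree b) > 1" using real_q_gt_1 by (intro one_less_power) auto
      ultimately show False using x by (simp add: AN_def)
    qed
    then show "x \<in> Fqset q" using a cb by simp
  qed
  then show ?case by (rule finite_subset[OF _ finite_Fqset])
next
  case (Suc N)
  have "AN (Suc N) \<subseteq> (\<lambda>(c, y). c + th * y) ` (Fqset q \<times> AN N)"
  proof
    fix x assume x: "x \<in> AN (Suc N)"
    then obtain a where a: "Fqpoly q a" "x = poly a th" by (auto simp: AN_def elim: AsetE)
    obtain c b where cb: "a = pCons c b" by (rule pCons_cases)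
    have "poly b th \<in> AN N"
    proof (cases "b = 0")
      case False
      then have "cabs x = real q * cabs (poly b th)"
        using cabs_poly_th[OF a(1)] cabs_poly_th[of b] a cb by simp
      then have "real q * cabs (poly b th) \<le> real q * real q ^ N" using x by (simp add: AN_def)
      then have "cabs (poly b th) \<le> real q ^ N" using real_q_gt_1 by simp
      then show ?thesis using a cb by (simp add: AN_def)
    qed simp
    then show "x \<in> (\<lambda>(c, y). c + th * y) ` (Fqset q \<times> AN N)"
      using a cb by (auto intro!: image_eqI[of _ _ "(c, poly b th)"])
  qed
  then show ?case by (rule finite_subset) (intro finite_imageI finite_cartesian_product finite_Fqset Suc)
qed

text \<open>The derivative of the polynomial with simple zeros at the points of a finite additive group
  takes the same value at all these points, so it is constant for degree reasons.\<close>
lemma sum_inverse_lattice: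
  fixes V :: "'c set"
  assumes V: "finite V" "0 \<in> V" "\<And>x y. x \<in> V \<Longrightarrow> y \<in> V \<Longrightarrow> x - y \<in> V" and z: "z \<notin> V"
  shows "(\<Sum>a\<in>V. inverse (z - a)) = (\<Prod>a\<in>V - {0}. a) / (\<Prod>a\<in>V. z - a)"
proof -
  define f where "f = (\<Prod>a\<in>V. [:- a, 1:])"
  define D where "D = (\<Prod>a\<in>V - {0}. a)"
  have pderiv: "poly (pderiv f) x = (\<Sum>a\<in>V. \<Prod>b\<in>V - {a}. x - b)" for x
    by (simp add: f_def pderiv_prod poly_sum poly_prod pderiv_pCons)
  have at_V: "poly (pderiv f) x = D" if x: "x \<in> V" for x
  proof -
    have "(\<Sum>a\<in>V. \<Prod>b\<in>V - {a}. x - b) = (\<Sum>a\<in>V. if a = x then \<Prod>b\<in>V - {x}. x - b else 0)"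
    proof (rule sum.cong)
      fix a assume "a \<in> V"
      then show "(\<Prod>b\<in>V - {a}. x - b) = (if a = x then \<Prod>b\<in>V - {x}. x - b else 0)"
        using x V(1) by (auto intro!: prod_zero)
    qed simp
    also have "\<dots> = (\<Prod>b\<in>V - {x}. x - b)" using V(1) x by (simp add: sum.delta')
    also have "bij_betw (\<lambda>b. x - b) (V - {x}) (V - {0})"
      by (rule bij_betw_byWitness[where f' = "\<lambda>b. x - b"]) (use V x in \<open>auto intro: V(3)\<close>)
    then have "(\<Prod>b\<in>V - {x}. x - b) = D"
      unfolding D_def by (rule prod.reindex_bij_betw)
    finally show ?thesis by (simp add: pderiv)
  qed
  have deg: "degree f = card V"
    unfolding f_def by (subst degree_prod_eq_sum_degree) auto
  have const: "pderiv f = [:D:]"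
  proof (rule ccontr)
    assume "pderiv f \<noteq> [:D:]"
    then have g: "pderiv f - [:D:] \<noteq> 0" by simp
    have "V \<subseteq> {x. poly (pderiv f - [:D:]) x = 0}" using at_V by auto
    then have "card V \<le> card {x. poly (pderiv f - [:D:]) x = 0}"
      by (rule card_mono[OF poly_roots_finite[OF g]])
    also have "\<dots> \<le> degree (pderiv f - [:D:])" by (rule card_poly_roots_bound[OF g])
    also have "\<dots> \<le> card V - 1"
    proof (rule degree_diff_le)
      show "degree (pderiv f) \<le> card V - 1"
        using deg by (intro degree_le) (auto simp: coeff_pderiv coeff_eq_0)
    qed simp
    finally have "card V = 0" by simp
    then show False using V by auto
  qed
  have nz: "z - a \<noteq> 0" if "a \<in> V" for a using that z by auto
  have "(\<Sum>a\<in>V. inverse (z - a)) * (\<Prod>a\<in>V. z - a) = (\<Sum>a\<in>V. \<Prod>b\<in>V - {a}. z - b)"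
    unfolding sum_distrib_right
  proof (rule sum.cong)
    fix a assume a: "a \<in> V"
    show "inverse (z - a) * (\<Prod>a\<in>V. z - a) = (\<Prod>b\<in>V - {a}. z - b)"
      using nz[OF a] by (simp add: prod.remove[OF V(1) a])
  qed simp
  also have "\<dots> = D" using pderiv[of z] const by simp
  finally have "(\<Sum>a\<in>V. inverse (z - a)) * (\<Prod>a\<in>V. z - a) = D" .
  moreover have "(\<Prod>a\<in>V. z - a) \<noteq> 0" using V(1) nz by auto
  ultimately show ?thesis by (simp add: D_def field_simps)
qed

text \<open>Divided by \<open>DN N\<close>, the N-th truncation of the exponential function of the
  lattice A.\<close>

definition eN :: "nat \<Rightarrow> 'c \<Rightarrow> 'c" where
  "eN N z = (\<Prod>a\<in>AN N. z - a)"

definition DN :: "nat \<Rightarrow> 'c" where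
  "DN N = (\<Prod>a\<in>AN N - {0}. a)"

lemma DN_nonzero: "DN N \<noteq> 0"
  by (simp add: DN_def finite_AN)

lemma eN_nonzero: "z \<notin> AN N \<Longrightarrow> eN N z \<noteq> 0"
  by (auto simp: eN_def finite_AN)

lemma sum_inverse_AN: "z \<notin> AN N \<Longrightarrow> (\<Sum>a\<in>AN N. inverse (z - a)) = DN N / eN N z"
  unfolding DN_def eN_def by (intro sum_inverse_lattice finite_AN AN_0 AN_diff)

text \<open>Lagrange interpolation of the Cauchy kernel, as a function of z, at the nodes
  \<open>AN N\<close>. The derivative of \<open>eN N\<close> is the constant \<open>DN N\<close>, so
  all basis polynomials have this same denominator; the last summand is the interpolation
  error.\<close>

lemma lagrange_kernel:
  assumes x: "x \<notin> AN N" and z: "z \<notin> AN N" and xz: "x \<noteq> z"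
  shows "inverse (x - z) = (\<Sum>a\<in>AN N. eN N z / DN N * inverse (z - a) * inverse (x - a)) +
           eN N z / eN N x * inverse (x - z)"
proof -
  have "inverse (z - a) * inverse (x - a) = inverse (x - z) * (inverse (z - a) - inverse (x - a))"
    if "a \<in> AN N" for a
  proof -
    have "z - a \<noteq> 0" "x - a \<noteq> 0" "x - z \<noteq> 0" using that x z xz by auto
    then show ?thesis by (simp add: field_simps)
  qed
  then have "(\<Sum>a\<in>AN N. inverse (z - a) * inverse (x - a)) =
      (\<Sum>a\<in>AN N. inverse (x - z) * (inverse (z - a) - inverse (x - a)))"
    by (intro sum.cong) auto
  also have "\<dots> = inverse (x - z) * (DN N / eN N z - DN N / eN N x)"
    by (simp only: sum_distrib_left[symmetric] sum_subtractf sum_inverse_AN[OF x] sum_inverse_AN[OF z])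
  finally have *: "(\<Sum>a\<in>AN N. inverse (z - a) * inverse (x - a)) =
      inverse (x - z) * (DN N / eN N z - DN N / eN N x)" .
  have "(\<Sum>a\<in>AN N. eN N z / DN N * inverse (z - a) * inverse (x - a)) =
      eN N z / DN N * (inverse (x - z) * (DN N / eN N z - DN N / eN N x))"
    by (simp only: *[symmetric] sum_distrib_left mult.assoc)
  also have "\<dots> = inverse (x - z) * (eN N z / DN N * (DN N / eN N z - DN N / eN N x))"
    by (simp only: mult_ac)
  also have "eN N z / DN N * (DN N / eN N z - DN N / eN N x) = 1 - eN N z / eN N x"
    using DN_nonzero[of N] eN_nonzero[OF x] eN_nonzero[OF z] by (simp add: field_simps)
  finally show ?thesis by (simp add: algebra_simps)
qed

text \<open>Lattice points beyond degree M are larger than z, so they contribute |a| both to the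
  numerator and to the denominator.\<close>

lemma cabs_eN_DN:
  assumes "M \<le> N" "cabs z < real q ^ Suc M"
  shows "cabs (eN N z) / cabs (DN N) = cabs (eN M z) / cabs (DN M)"
proof -
  have "AN N = AN M \<union> (AN N - AN M)" using AN_mono[OF assms(1)] by auto
  then have "cabs (eN N z) = cabs (eN M z) * (\<Prod>a\<in>AN N - AN M. cabs (z - a))"
    unfolding eN_def cabs_prod by (subst \<open>AN N = _\<close>, subst prod.union_disjoint) (auto simp: finite_AN)
  also have "(\<Prod>a\<in>AN N - AN M. cabs (z - a)) = (\<Prod>a\<in>AN N - AN M. cabs a)"
  proof (rule prod.cong)
    fix a assume "a \<in> AN N - AN M"
    then have "cabs z < cabs a" using not_AN_cabs[of a M] assms(2) AN_Aset by fastforce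
    then show "cabs (z - a) = cabs a" by (rule cabs_diff_eq)
  qed simp
  finally have e: "cabs (eN N z) = cabs (eN M z) * (\<Prod>a\<in>AN N - AN M. cabs a)" .
  have "AN N - {0} = (AN M - {0}) \<union> (AN N - AN M)" using AN_mono[OF assms(1)] by auto
  then have D: "cabs (DN N) = cabs (DN M) * (\<Prod>a\<in>AN N - AN M. cabs a)"
    unfolding DN_def cabs_prod by (simp only: \<open>AN N - {0} = _\<close>) (subst prod.union_disjoint, auto simp: finite_AN)
  have "(\<Prod>a\<in>AN N - AN M. cabs a) \<noteq> 0" by (auto simp: finite_AN)
  then show ?thesis unfolding e D by simp
qed

lemma circle_not_AN: "cabs z = cabs (rad N) \<Longrightarrow> z \<notin> Aset q th"
  using imnorm_rad[of z N] imnorm_pos_iff[of z] rad_nonzero[of N] Omega_not_Kinf Aset_Kinf by force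

subsection \<open>The parameter at infinity\<close>

text \<open>The finite sums over \<open>AN n\<close> are \<open>DN n\<close> /
  \<open>eN n z\<close>, whose absolute value is constant for n \<ge> N by
  \<open>cabs_eN_DN\<close>; the limit inherits it.\<close>

lemma cabs_lattice_sum:
  assumes z: "cabs z = cabs (rad N)"
  shows "cabs (infsum (\<lambda>a. inverse (z - a)) (Aset q th)) = cabs (DN N) / cabs (eN N z)"
proof -
  let ?f = "\<lambda>a. inverse (z - a)"
  define X where "X n = (\<Sum>a\<in>AN n. ?f a)" for n
  have zA: "z \<notin> Aset q th" using circle_not_AN[OF z] .
  have small: "cabs (?f a) \<le> inverse (real q ^ Suc n)" if "n \<ge> N" "a \<in> Aset q th" "a \<notin> AN n" for a n
  proof -
    have a: "cabs a \<ge> real q ^ Suc n" using not_AN_cabs that by simp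
    have "cabs z < real q ^ Suc N" using z cabs_rad by simp
    also have "\<dots> \<le> real q ^ Suc n" using that(1) real_q_gt_1 by (intro power_increasing) auto
    finally have "cabs (z - a) = cabs a" using a by (intro cabs_diff_eq) simp
    then show ?thesis using a real_q_gt_1 unfolding cabs_inverse by (simp add: le_imp_inverse_le del: power_Suc)
  qed
  have tail: "cabs (sum ?f (Y - AN n)) \<le> inverse (real q ^ Suc n)" if "n \<ge> N" "Y \<subseteq> Aset q th" for n Y
    using that by (intro cabs_sum_le small) auto
  have small0: "(\<lambda>n. inverse (real q ^ Suc n)) \<longlonglongrightarrow> 0"
    using LIMSEQ_inverse_realpow_zero[OF real_q_gt_1] by (rule LIMSEQ_Suc)
  have "tate (\<lambda>n. X (Suc n) - X n)"
    unfolding tate_iff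
  proof (intro allI impI)
    fix e :: real assume "e > 0"
    then obtain M where M: "\<And>n. n \<ge> M \<Longrightarrow> inverse (real q ^ Suc n) < e"
      using order_tendstoD(2)[OF small0] unfolding eventually_sequentially by blast
    have "cabs (X (Suc n) - X n) < e" if "n \<ge> max M N" for n
    proof -
      have "X (Suc n) - X n = sum ?f (AN (Suc n) - AN n)"
        unfolding X_def by (subst sum_diff[OF finite_AN AN_mono]) auto
      then show ?thesis using tail[of n "AN (Suc n)"] M[of n] AN_Aset that by fastforce
    qed
    then show "\<exists>M. \<forall>n\<ge>M. cabs (X (Suc n) - X n) < e" by blast
  qed
  then obtain L where L: "X \<longlonglongrightarrow> L" using Cauchy_ultrametric by blast
  \<comment> \<open>\<open>infsum\<close> refers to all finite subsets, not just the exhaustion by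
    \<open>AN n\<close>; the uniform bound on tails makes the two limits agree.\<close>
  have "(?f has_sum L) (Aset q th)"
    unfolding has_sum_def tendsto_iff
  proof (intro allI impI)
    fix e :: real assume e: "e > 0"
    obtain M where M: "\<And>n. n \<ge> M \<Longrightarrow> inverse (real q ^ Suc n) < e"
      using order_tendstoD(2)[OF small0 e] unfolding eventually_sequentially by blast
    obtain M' where M': "\<And>n. n \<ge> M' \<Longrightarrow> cabs (X n - L) < e"
      using L e unfolding tendsto_iff_tate tate_iff by metis
    define n where "n = max N (max M M')"
    show "\<forall>\<^sub>F Y in finite_subsets_at_top (Aset q th). dist (sum ?f Y) L < e"
      unfolding eventually_finite_subsets_at_top
    proof (intro exI[of _ "AN n"] conjI allI impI)
      fix Y assume Y: "finite Y \<and> AN n \<subseteq> Y \<and> Y \<subseteq> Aset q th"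
      have "sum ?f Y - L = sum ?f (Y - AN n) + (X n - L)"
        using Y by (simp add: X_def sum_diff finite_AN)
      also have "cabs \<dots> < e"
      proof (rule cabs_add_less)
        have "n \<ge> N" "n \<ge> M" "n \<ge> M'" by (auto simp: n_def)
        then show "cabs (sum ?f (Y - AN n)) < e" "cabs (X n - L) < e"
          using le_less_trans[OF tail M] Y M' by auto
      qed
      finally show "dist (sum ?f Y) L < e" by (simp add: dist_cabs)
    qed (auto simp: finite_AN AN_Aset)
  qed
  then have inf: "infsum ?f (Aset q th) = L" by (rule infsumI)
  have X: "cabs (X n) = cabs (DN N) / cabs (eN N z)" if "n \<ge> N" for n
  proof -
    have "cabs (X n) = inverse (cabs (eN n z) / cabs (DN n))"
      unfolding X_def using zA AN_Aset by (subst sum_inverse_AN) (auto simp: cabs_divide)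
    also have "\<dots> = inverse (cabs (eN N z) / cabs (DN N))"
      using cabs_eN_DN[OF that] z cabs_rad(2)[of N] by simp
    finally show ?thesis by simp
  qed
  have "cabs (DN N) / cabs (eN N z) > 0"
    using DN_nonzero[of N] eN_nonzero[of z N] zA AN_Aset[of z N] by (intro divide_pos_pos) auto
  then obtain n0 where "\<And>n. n \<ge> n0 \<Longrightarrow> cabs (X n - L) < cabs (DN N) / cabs (eN N z)"
    using L unfolding tendsto_iff_tate tate_iff by metis
  from this[of "max n0 N"] have "cabs L = cabs (X (max n0 N))"
    using X[of "max n0 N"] by (intro cabs_eq_if_close) simp
  then show ?thesis using X[of "max n0 N"] inf by simp
qed

text \<open>The factors tend to 1 and all have absolute value 1, so the partial products do as well
  and cannot tend to 0.\<close>

lemma carlitz_product_converges: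
  "\<exists>P. P \<noteq> 0 \<and> (\<lambda>n. \<Prod>i\<in>{1..n}. (1 - inverse (th ^ (q ^ i - 1)))) \<longlonglongrightarrow> P"
proof -
  define X where "X n = (\<Prod>i\<in>{1..n}. (1 - inverse (th ^ (q ^ i - 1))))" for n
  have exp: "q ^ i - 1 \<ge> i" for i
  proof -
    have "i < 2 ^ i" by (rule less_exp)
    also have "(2::nat) ^ i \<le> q ^ i" using q_ge_2 by (rule power_mono) simp
    finally show ?thesis by simp
  qed
  have t: "cabs (inverse (th ^ (q ^ i - 1))) \<le> inverse (real q ^ i)" for i
    unfolding cabs_inverse cabs_power cabs_th
    using real_q_gt_1 power_increasing[OF exp[of i], of "real q"] by (intro le_imp_inverse_le) auto
  have one: "cabs (1 - inverse (th ^ (q ^ i - 1))) = 1" if "i \<ge> 1" for i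
  proof -
    have "1 < real q ^ i" using that real_q_gt_1 by (intro one_less_power) auto
    then have "inverse (real q ^ i) < 1" using inverse_less_1_iff by blast
    then show ?thesis using t[of i] cabs_diff_eq'[of "inverse (th ^ (q ^ i - 1))" 1] by simp
  qed
  have X1: "cabs (X n) = 1" for n
    unfolding X_def cabs_prod by (rule prod.neutral) (use one in auto)
  have "tate (\<lambda>n. X (Suc n) - X n)"
    unfolding tate_iff
  proof (intro allI impI)
    fix e :: real assume "e > 0"
    then obtain M where M: "\<And>n. n \<ge> M \<Longrightarrow> inverse (real q ^ n) < e"
      using order_tendstoD(2)[OF LIMSEQ_inverse_realpow_zero[OF real_q_gt_1]]
      unfolding eventually_sequentially by blast
    have "cabs (X (Suc n) - X n) < e" if "n \<ge> M" for n
    proof -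
      have "X (Suc n) = X n * (1 - inverse (th ^ (q ^ Suc n - 1)))" by (simp add: X_def)
      then have "X (Suc n) - X n = - (X n * inverse (th ^ (q ^ Suc n - 1)))"
        by (simp add: algebra_simps)
      then have "cabs (X (Suc n) - X n) = cabs (inverse (th ^ (q ^ Suc n - 1)))"
        by (simp only: cabs_minus cabs_mult X1 mult_1)
      also have "\<dots> \<le> inverse (real q ^ Suc n)" by (rule t)
      also have "\<dots> < e" using M[of "Suc n"] that by simp
      finally show ?thesis .
    qed
    then show "\<exists>M. \<forall>n\<ge>M. cabs (X (Suc n) - X n) < e" by blast
  qed
  then obtain P where P: "X \<longlonglongrightarrow> P" using Cauchy_ultrametric by blast
  have "P \<noteq> 0"
  proof
    assume "P = 0"
    then obtain n where "cabs (X n - 0) < 1"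
      using P unfolding tendsto_iff_tate tate_iff by (metis order_refl zero_less_one)
    then show False using X1 by simp
  qed
  then show ?thesis using P unfolding X_def by blast
qed

text \<open>The period is a choice, so a solution of its defining equation must be exhibited first.
  Without this, smallness of \<open>uC\<close> times a function would give no information.\<close>

lemma carlitz_period_nonzero: "carlitz_period q th \<noteq> 0"
proof -
  obtain P where P: "P \<noteq> 0" "(\<lambda>n. \<Prod>i\<in>{1..n}. (1 - inverse (th ^ (q ^ i - 1)))) \<longlonglongrightarrow> P"
    using carlitz_product_converges by blast
  let ?y = "- (th ^ q) / P ^ (q - 1)"
  have q1: "q - 1 \<ge> 1" using q_ge_2 by simp
  have "coeff (monom 1 (q - 1) - [:?y:]) (q - 1) = 1" using q1 by (simp add: coeff_pCons split: nat.splits)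
  then have "degree (monom 1 (q - 1) - [:?y:]) \<ge> q - 1" by (intro le_degree) simp
  then obtain x where "poly (monom 1 (q - 1) - [:?y:]) x = 0"
    using exists_root[of "monom 1 (q - 1) - [:?y:]"] q1 by auto
  then have "x ^ (q - 1) - ?y = 0" by (simp add: poly_monom)
  then have "x ^ (q - 1) = ?y" by (simp only: right_minus_eq)
  with P have "\<exists>x P. P \<noteq> 0 \<and>
      (\<lambda>n. \<Prod>i\<in>{1..n}. (1 - inverse (th ^ (q ^ i - 1)))) \<longlonglongrightarrow> P \<and> x ^ (q - 1) = - (th ^ q) / P ^ (q - 1)"
    by blast
  then have "\<exists>P. P \<noteq> 0 \<and> (\<lambda>n. \<Prod>i\<in>{1..n}. (1 - inverse (th ^ (q ^ i - 1)))) \<longlonglongrightarrow> P \<and>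
      carlitz_period q th ^ (q - 1) = - (th ^ q) / P ^ (q - 1)"
    unfolding carlitz_period_def by (rule someI_ex)
  then obtain P' where "P' \<noteq> 0" "carlitz_period q th ^ (q - 1) = - (th ^ q) / P' ^ (q - 1)" by blast
  then have "carlitz_period q th ^ (q - 1) \<noteq> 0" using th_nonzero by simp
  then show ?thesis using q1 by (auto simp: power_0_left)
qed

lemma cabs_uC:
  assumes "cabs z = cabs (rad N)"
  shows "cabs (uC q th z) = inverse (cabs (carlitz_period q th)) * (cabs (DN N) / cabs (eN N z))"
  unfolding uC_def cabs_mult cabs_inverse cabs_lattice_sum[OF assms] ..


subsection \<open>Cauchy's formula for rigid analytic functions\<close>

text \<open>The places where approximants on \<open>Omega_n q th (Suc N)\<close> may have poles:
  beyond the large circle or inside the small ones.\<close>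

definition polar :: "nat \<Rightarrow> 'c set" where
  "polar N = {w. cabs w > cabs (rad N) \<or> (\<exists>\<kappa>\<in>AN N. cabs (w - \<kappa>) < cabs rad0)}"

text \<open>A point w not beyond the large circle is within 1/q of K_inf, hence within |rad0| of
  some a in A. If a had degree above N, then |w| = |a| would exceed the radius.\<close>

lemma not_Omega_n_polar:
  assumes "w \<notin> Omega_n q th (Suc N)"
  shows "w \<in> polar N"
proof (cases "cabs w > cabs (rad N)")
  case False
  then have "imnorm q th w < inverse (real q ^ Suc N)"
    using assms cabs_rad(2)[of N] by (auto simp: Omega_n_def)
  also have "\<dots> \<le> inverse (real q ^ 1)"
    using real_q_gt_1 by (intro le_imp_inverse_le power_increasing) auto
  finally obtain k where k: "k \<in> Kinf q th" "cabs (w - k) < inverse (real q)"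
    using imnorm_lessD[of w "inverse (real q)"] by auto
  obtain a where a: "a \<in> Aset q th" "cabs (k - a) \<le> inverse (real q)"
    using Kinf_approx[OF k(1)] by blast
  have wa: "cabs (w - a) < cabs rad0"
    using k(2) a(2) cabs_rad0(1) cabs_ultra[of w k "cabs rad0" a] by auto
  have "a \<in> AN N"
  proof (rule ccontr)
    assume "a \<notin> AN N"
    then have big: "cabs a \<ge> real q ^ Suc N" using not_AN_cabs a(1) by blast
    then have "cabs (a - w) < cabs a"
      using wa cabs_rad0(2) one_le_power[of "real q" "Suc N"] real_q_gt_1 by (simp add: cabs_minus_commute)
    then have "cabs w = cabs a" by (rule cabs_eq_if_close)
    then show False using False big cabs_rad(2)[of N] by simp
  qed
  with wa show ?thesis by (auto simp: polar_def)
qed (simp add: polar_def)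

lemma AN_polar: "a \<in> AN N \<Longrightarrow> a \<in> polar N"
  using cabs_rad0(3) by (auto simp: polar_def intro!: bexI[of _ a])

lemma polar_inner:
  assumes "\<kappa> \<in> AN N" "cabs (w - \<kappa>) < cabs rad0"
  shows "cabs w < cabs (rad N)"
proof -
  have "cabs (w - \<kappa>) < cabs (rad N)"
    using assms(2) cabs_rad0(2) cabs_rad(1)[of N] one_le_power[of "real q" N] real_q_gt_1 by linarith
  then show ?thesis using cabs_add_less[OF _ AN_cabs_rad[OF assms(1)], of "w - \<kappa>"] by simp
qed

lemma big_circle:
  assumes "cabs z = cabs (rad N)"
  shows "z \<in> Omega_n q th (Suc N)" "z \<notin> polar N"
proof -
  have "imnorm q th z = cabs z" using imnorm_rad[OF assms] .
  moreover have "inverse (real q ^ Suc N) \<le> 1"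
    using real_q_gt_1 one_le_power[of "real q" "Suc N"] by (intro inverse_le_1_iff[THEN iffD2]) auto
  moreover have "1 \<le> cabs (rad N)"
    using cabs_rad(1)[of N] one_le_power[of "real q" N] real_q_gt_1 by linarith
  ultimately show "z \<in> Omega_n q th (Suc N)"
    using assms cabs_rad(2)[of N] by (simp add: Omega_n_def)
  show "z \<notin> polar N" using polar_inner[of _ N z] assms by (force simp: polar_def)
qed

text \<open>Distinct elements of A have distance at least 1, so the small discs are
  disjoint.\<close>

lemma AN_dist: "\<kappa> \<in> AN N \<Longrightarrow> \<kappa>' \<in> AN N \<Longrightarrow> \<kappa> \<noteq> \<kappa>' \<Longrightarrow> cabs (\<kappa> - \<kappa>') > cabs rad0"
  using cabs_Aset_ge_1[of "\<kappa> - \<kappa>'"] AN_Aset[OF AN_diff[of \<kappa> N \<kappa>']] cabs_rad0(2) by simp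

lemma small_circle:
  assumes "\<kappa> \<in> AN N" "cabs (z - \<kappa>) = cabs rad0"
  shows "z \<in> Omega_n q th (Suc N)" "z \<notin> polar N"
proof -
  have *: "cabs z \<le> real q ^ N"
  proof -
    have "cabs (z - \<kappa>) \<le> real q ^ N"
      using assms(2) cabs_rad0(2) one_le_power[of "real q" N] real_q_gt_1 by linarith
    then show ?thesis using cabs_add_leI[of "z - \<kappa>" "real q ^ N" \<kappa>] assms(1) by (simp add: AN_def)
  qed
  have "imnorm q th (z - \<kappa>) = cabs rad0" using imnorm_rad0[OF assms(2)] assms(2) by simp
  then have im: "imnorm q th z = cabs rad0" using imnorm_diff_Aset AN_Aset assms(1) by simp
  have "inverse (real q ^ Suc N) \<le> inverse (real q ^ 1)"
    using real_q_gt_1 by (intro le_imp_inverse_le power_increasing) auto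
  then have "inverse (real q ^ Suc N) \<le> cabs rad0" using cabs_rad0(1) by simp
  moreover have "real q ^ N \<le> real q ^ Suc N" using real_q_gt_1 by (intro power_increasing) auto
  ultimately show "z \<in> Omega_n q th (Suc N)" using * im by (simp add: Omega_n_def)
  have "\<not> cabs (z - \<kappa>') < cabs rad0" if "\<kappa>' \<in> AN N" for \<kappa>'
  proof
    assume "cabs (z - \<kappa>') < cabs rad0"
    moreover from this assms have "\<kappa> \<noteq> \<kappa>'" by auto
    ultimately show False
      using AN_dist[OF assms(1) that] cabs_add_leI[of "\<kappa> - z" "cabs rad0" "z - \<kappa>'"] assms(2)
      by (simp add: cabs_minus_commute)
  qed
  then show "z \<notin> polar N" using * cabs_rad(1)[of N] by (auto simp: polar_def)
qed

text \<open>Zeros of Q avoid the affinoid and so fall into \<open>polar N\<close>; the point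
  \<open>rad N\<close> of the affinoid rules out Q = 0.\<close>

lemma rational_approx:
  assumes "rigidC q th f" "e > 0"
  shows "\<exists>P Q. Q \<noteq> 0 \<and> (\<forall>w. poly Q w = 0 \<longrightarrow> w \<in> polar N) \<and>
    (\<forall>z\<in>Omega_n q th (Suc N). poly Q z \<noteq> 0 \<and> cabs (f z - poly P z / poly Q z) < e)"
proof -
  obtain P Q where PQ: "\<forall>z\<in>Omega_n q th (Suc N). poly Q z \<noteq> 0 \<and> cabs (f z - poly P z / poly Q z) < e"
    using assms unfolding rigidC_def by blast
  moreover have "rad N \<in> Omega_n q th (Suc N)" using big_circle by simp
  ultimately have "Q \<noteq> 0" by auto
  moreover have "\<forall>w. poly Q w = 0 \<longrightarrow> w \<in> polar N" using PQ not_Omega_n_polar by blast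
  ultimately show ?thesis using PQ by blast
qed

text \<open>The residue integral over the boundary of the region between the large circle and the small
  circles around the points of \<open>AN N\<close>.\<close>
definition bdry :: "nat \<Rightarrow> ('c \<Rightarrow> 'c) \<Rightarrow> nat \<Rightarrow> 'c" where
  "bdry N g k = avg (rad N) 0 g k - (\<Sum>\<kappa>\<in>AN N. avg rad0 \<kappa> g k)"

lemma bdry_add: "bdry N (\<lambda>z. f z + g z) = (\<lambda>k. bdry N f k + bdry N g k)"
  by (simp add: bdry_def fun_eq_iff avg_add sum.distrib)

lemma bdry_cmult: "bdry N (\<lambda>z. c * f z) = (\<lambda>k. c * bdry N f k)"
  by (simp add: bdry_def fun_eq_iff avg_cmult sum_distrib_left right_diff_distrib)

lemma bdry_diff: "bdry N (\<lambda>z. f z - g z) k = bdry N f k - bdry N g k"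
  by (simp add: bdry_def avg_diff sum_subtractf)

lemma bdry_cong:
  assumes "\<And>z. z \<notin> polar N \<Longrightarrow> f z = g z"
  shows "bdry N f = bdry N g"
proof -
  have "avg (rad N) 0 f = avg (rad N) 0 g"
    by (rule avg_cong) (use assms big_circle(2) in simp)
  moreover have "avg rad0 \<kappa> f = avg rad0 \<kappa> g" if "\<kappa> \<in> AN N" for \<kappa>
    by (rule avg_cong) (use assms small_circle(2)[OF that] in simp)
  ultimately show ?thesis by (simp add: bdry_def fun_eq_iff)
qed

lemma bdry_bound:
  assumes "B \<ge> 0" "\<And>z. cabs z = cabs (rad N) \<Longrightarrow> cabs (rad N) * cabs (g z) \<le> B"
    and "\<And>\<kappa> z. \<kappa> \<in> AN N \<Longrightarrow> cabs (z - \<kappa>) = cabs rad0 \<Longrightarrow> cabs rad0 * cabs (g z) \<le> B"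
  shows "cabs (bdry N g k) \<le> B"
  unfolding bdry_def
  by (intro cabs_diff_leI cabs_sum_le avg_bound) (use assms in auto)

lemma bdry_has_res:
  assumes "has_res (rad N) 0 g L" "\<And>\<kappa>. \<kappa> \<in> AN N \<Longrightarrow> has_res rad0 \<kappa> g (M \<kappa>)"
  shows "tate (\<lambda>k. bdry N g k - (L - (\<Sum>\<kappa>\<in>AN N. M \<kappa>)))"
proof -
  have "tate (\<lambda>k. \<Sum>\<kappa>\<in>AN N. (avg rad0 \<kappa> g k - M \<kappa>))"
    using assms(2) by (intro tate_sum) (simp add: has_res_def)
  with assms(1)[unfolded has_res_def]
  have "tate (\<lambda>k. (avg (rad N) 0 g k - L) - (\<Sum>\<kappa>\<in>AN N. (avg rad0 \<kappa> g k - M \<kappa>)))"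
    by (rule tate_diff)
  then show ?thesis by (simp add: bdry_def sum_subtractf algebra_simps)
qed

text \<open>A pole beyond the large circle contributes nothing. A pole in a small disc is seen by
  the large circle and by exactly one small circle, and these two residues cancel.\<close>

lemma bdry_pf:
  assumes "pf (polar N) g"
  shows "tate (bdry N g)"
  using assms
proof (rule pf_null)
  show "tate (bdry N (poly p))" for p
    using bdry_has_res[of N "poly p" 0 "\<lambda>_. 0"] has_res_poly by simp
  show "bdry N f = bdry N g" if "\<And>z. z \<notin> polar N \<Longrightarrow> f z = g z" for f g
    using that by (rule bdry_cong)
  show "tate (bdry N (\<lambda>z. inverse (z - w) ^ m))" if w: "w \<in> polar N" and m: "m \<ge> 1" for w m
  proof (cases "cabs w > cabs (rad N)")
    case True
    have "has_res rad0 \<kappa> (\<lambda>z. inverse (z - w) ^ m) 0" if "\<kappa> \<in> AN N" for \<kappa>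
    proof (rule has_res_outer_pole)
      have "cabs (w - \<kappa>) = cabs w" using AN_cabs_rad[OF that] True by (intro cabs_diff_eq') simp
      moreover have "cabs (rad N) > 1"
        using cabs_rad(1)[of N] one_le_power[of "real q" N] real_q_gt_1 by linarith
      ultimately show "cabs rad0 < cabs (w - \<kappa>)" using True cabs_rad0 by linarith
    qed
    then show ?thesis
      using bdry_has_res[OF has_res_outer_pole[of "rad N" w 0 m], of "\<lambda>_. 0"] True by simp
  next
    case False
    then obtain \<kappa>0 where k0: "\<kappa>0 \<in> AN N" "cabs (w - \<kappa>0) < cabs rad0" using w by (auto simp: polar_def)
    let ?L = "if m = 1 then 1 else 0 :: 'c"
    have small: "has_res rad0 \<kappa> (\<lambda>z. inverse (z - w) ^ m) (if \<kappa> = \<kappa>0 then ?L else 0)"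
      if k: "\<kappa> \<in> AN N" for \<kappa>
    proof (cases "\<kappa> = \<kappa>0")
      case True
      then show ?thesis using has_res_inner_pole[OF k0(2) m] by simp
    next
      case False
      have "cabs (w - \<kappa>0) < cabs (\<kappa> - \<kappa>0)" using AN_dist[OF k k0(1) False] k0(2) by simp
      then have "cabs ((w - \<kappa>0) - (\<kappa> - \<kappa>0)) = cabs (\<kappa> - \<kappa>0)" by (rule cabs_diff_eq)
      then have "cabs (w - \<kappa>) > cabs rad0" using AN_dist[OF k k0(1) False] by simp
      then show ?thesis using has_res_outer_pole False by simp
    qed
    have "has_res (rad N) 0 (\<lambda>z. inverse (z - w) ^ m) ?L"
      using has_res_inner_pole[of w 0 "rad N" m] polar_inner[OF k0] m by simp
    from bdry_has_res[OF this small] show ?thesis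
      using k0(1) by (simp add: sum.delta finite_AN)
  qed
qed (rule bdry_add bdry_cmult)+

text \<open>After subtraction of \<open>f z0\<close> the singularity at \<open>z0\<close> is
  removable and the boundary integral vanishes in the limit; the integral of 1/(z - z0) tends to 1.
  Height at least 1 keeps \<open>z0\<close> out of all small discs.\<close>

lemma cauchy_formula:
  assumes f: "rigidC q th f" and z0: "imnorm q th z0 \<ge> 1" "cabs z0 < cabs (rad N)"
  shows "tate (\<lambda>k. bdry N (\<lambda>z. f z * inverse (z - z0)) k - f z0)"
proof -
  have z0': "z0 \<in> Omega_n q th (Suc N)"
  proof -
    have "inverse (real q ^ Suc N) \<le> 1"
      using real_q_gt_1 one_le_power[of "real q" "Suc N"] by (intro inverse_le_1_iff[THEN iffD2]) auto
    then show ?thesis using z0 cabs_rad(2)[of N] by (simp add: Omega_n_def)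
  qed
  have big: "cabs (z - z0) = cabs (rad N)" if "cabs z = cabs (rad N)" for z
    using cabs_diff_eq'[of z0 z] that z0(2) by simp
  have z0k: "cabs (z0 - \<kappa>) \<ge> 1" if "\<kappa> \<in> AN N" for \<kappa>
    using imnorm_le[OF Aset_Kinf[OF AN_Aset[OF that]], of z0] z0(1) by linarith
  have small: "cabs (z - z0) \<ge> 1" if "\<kappa> \<in> AN N" "cabs (z - \<kappa>) = cabs rad0" for \<kappa> z
  proof -
    have "cabs ((z - \<kappa>) - (z0 - \<kappa>)) = cabs (z0 - \<kappa>)"
      using z0k[OF that(1)] that(2) cabs_rad0(2) by (intro cabs_diff_eq) simp
    then show ?thesis using z0k[OF that(1)] by simp
  qed
  define g where "g = (\<lambda>z. (f z - f z0) * inverse (z - z0))"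
  have g: "tate (bdry N g)"
  proof (rule tate_uniform)
    fix e :: real assume e: "e > 0"
    obtain P Q where Q: "Q \<noteq> 0" "\<And>w. poly Q w = 0 \<Longrightarrow> w \<in> polar N"
      and PQ: "\<And>z. z \<in> Omega_n q th (Suc N) \<Longrightarrow> poly Q z \<noteq> 0 \<and> cabs (f z - poly P z / poly Q z) < e / 2"
      using rational_approx[OF f, of "e / 2" N] e by auto
    have Q0: "poly Q z0 \<noteq> 0" using PQ z0' by blast
    \<comment> \<open>Numerator of P/Q - P(z0)/Q(z0). It vanishes at \<open>z0\<close>, so the
      quotient by z - z0 keeps all its poles in \<open>polar N\<close>.\<close>
    define R where "R = smult (poly Q z0) P - smult (poly P z0) Q"
    have "poly R z0 = 0" by (simp add: R_def)
    then obtain R' where R': "R = [:- z0, 1:] * R'" by (auto simp: poly_eq_0_iff_dvd elim: dvdE)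
    define h where "h = (\<lambda>z. poly R' z / poly (smult (poly Q z0) Q) z)"
    have h: "tate (bdry N h)"
      unfolding h_def using Q Q0 by (intro bdry_pf pf_rational) auto
    have heq: "(f z - f z0) * inverse (z - z0) - h z =
        ((f z - poly P z / poly Q z) - (f z0 - poly P z0 / poly Q z0)) * inverse (z - z0)"
      if "z \<in> Omega_n q th (Suc N)" "z \<noteq> z0" for z
    proof -
      have "poly Q z \<noteq> 0" "z - z0 \<noteq> 0" using PQ that by auto
      have "poly R z = (z - z0) * poly R' z" unfolding R' by (simp add: algebra_simps)
      then have "poly R' z = poly R z * inverse (z - z0)"
        using \<open>z - z0 \<noteq> 0\<close> by (simp add: field_simps)
      then have "h z = (poly Q z0 * poly P z - poly P z0 * poly Q z) / (poly Q z0 * poly Q z) * inverse (z - z0)"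
        by (simp add: h_def R_def)
      also have "(poly Q z0 * poly P z - poly P z0 * poly Q z) / (poly Q z0 * poly Q z) =
          poly P z / poly Q z - poly P z0 / poly Q z0"
        using \<open>poly Q z \<noteq> 0\<close> Q0 by (simp add: field_simps)
      finally show ?thesis by (simp add: algebra_simps)
    qed
    have est: "cabs (g z - h z) \<le> e / 2 / cabs (z - z0)"
      if "z \<in> Omega_n q th (Suc N)" "z \<noteq> z0" for z
    proof -
      have "cabs ((f z - poly P z / poly Q z) - (f z0 - poly P z0 / poly Q z0)) \<le> e / 2"
        by (rule cabs_diff_leI) (use PQ[OF that(1)] PQ[OF z0'] in auto)
      then show ?thesis
        unfolding g_def heq[OF that] cabs_mult cabs_inverse divide_inverse[of "e / 2"]
        by (intro mult_right_mono) auto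
    qed
    have gh: "cabs (bdry N (\<lambda>z. g z - h z) k) \<le> e / 2" for k
    proof (rule bdry_bound)
      show "cabs (rad N) * cabs (g z - h z) \<le> e / 2" if "cabs z = cabs (rad N)" for z
      proof -
        have "z \<noteq> z0" using that z0(2) by auto
        then have "cabs (g z - h z) \<le> e / 2 / cabs (rad N)"
          using est[OF big_circle(1)[OF that]] big[OF that] by simp
        then show ?thesis using rad_nonzero[of N] by (simp add: pos_le_divide_eq mult_ac)
      qed
      show "cabs rad0 * cabs (g z - h z) \<le> e / 2"
        if "\<kappa> \<in> AN N" "cabs (z - \<kappa>) = cabs rad0" for \<kappa> z
      proof -
        have s: "cabs (z - z0) \<ge> 1" using small that by blast
        then have "z \<noteq> z0" by auto
        then have "cabs (g z - h z) \<le> e / 2 / cabs (z - z0)"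
          using est[OF small_circle(1)[OF that]] by simp
        also have "\<dots> \<le> e / 2 / 1" using s e by (intro divide_left_mono) auto
        finally have "cabs (g z - h z) \<le> e / 2" by simp
        then have "cabs rad0 * cabs (g z - h z) \<le> 1 * (e / 2)"
          using cabs_rad0 by (intro mult_mono) auto
        then show ?thesis by simp
      qed
    qed (use e in simp)
    have "cabs (bdry N g k - bdry N h k) < e" for k
      using gh[of k] e by (simp add: bdry_diff)
    with h show "\<exists>Y. tate Y \<and> (\<forall>k. cabs (bdry N g k - Y k) < e)" by blast
  qed
  have one: "tate (\<lambda>k. bdry N (\<lambda>z. inverse (z - z0)) k - 1)"
  proof -
    have "has_res (rad N) 0 (\<lambda>z. inverse (z - z0)) 1"
      using has_res_inner_pole[of z0 0 "rad N" 1] z0(2) by simp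
    moreover have "has_res rad0 \<kappa> (\<lambda>z. inverse (z - z0)) 0" if "\<kappa> \<in> AN N" for \<kappa>
      using has_res_outer_pole[of rad0 z0 \<kappa> 1] z0k[OF that] cabs_rad0(2) by simp
    ultimately show ?thesis using bdry_has_res[of N _ 1 "\<lambda>_. 0"] by simp
  qed
  have "bdry N (\<lambda>z. f z * inverse (z - z0)) k - f z0 =
      bdry N g k + f z0 * (bdry N (\<lambda>z. inverse (z - z0)) k - 1)" for k
  proof -
    have "(\<lambda>z. f z * inverse (z - z0)) = (\<lambda>z. g z + f z0 * inverse (z - z0))"
      by (simp add: g_def algebra_simps)
    then show ?thesis by (simp add: bdry_add bdry_cmult algebra_simps)
  qed
  then show ?thesis using tate_add[OF g tate_cmult[OF one, of "f z0"]] by simp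
qed

text \<open>The circles of this radius around 0 and around a are the same set, but are sampled at
  different points. The averages differ, while their limits agree on every partial fraction and so
  on uniform limits.\<close>

lemma avg_translate:
  assumes f: "rigidC q th f" and a: "a \<in> AN N"
  shows "tate (\<lambda>k. avg (rad N) 0 (\<lambda>z. f z * inverse (z - a)) k - avg (rad N) 0 (\<lambda>z. f (z + a) * inverse z) k)"
proof -
  define \<Phi> where "\<Phi> g k = avg (rad N) 0 g k - avg (rad N) a g k" for g k
  have circ: "cabs z = cabs (rad N)" if "cabs (z - a) = cabs (rad N)" for z
    using cabs_add_eq[of a "z - a"] AN_cabs_rad[OF a] that by simp
  have circ': "cabs (z - a) = cabs (rad N)" if "cabs z = cabs (rad N)" for z
    using cabs_diff_eq'[of a z] AN_cabs_rad[OF a] that by simp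
  have null: "tate (\<Phi> g)" if "pf (polar N) g" for g
    using that
  proof (rule pf_null)
    have *: "tate (\<Phi> g)" if "has_res (rad N) 0 g L" "has_res (rad N) a g L" for g L
      using tate_diff[OF that[unfolded has_res_def]] by (simp add: \<Phi>_def[abs_def])
    show "tate (\<Phi> (poly p))" for p by (rule *[OF has_res_poly has_res_poly])
    show "tate (\<Phi> (\<lambda>z. inverse (z - w) ^ m))" if w: "w \<in> polar N" and m: "m \<ge> 1" for w m
    proof (cases "cabs w > cabs (rad N)")
      case True
      then have "cabs (w - a) > cabs (rad N)"
        using cabs_diff_eq'[of a w] AN_cabs_rad[OF a] by simp
      with True show ?thesis by (intro *[of _ 0] has_res_outer_pole) auto
    next
      case False
      then obtain \<kappa> where "\<kappa> \<in> AN N" "cabs (w - \<kappa>) < cabs rad0" using w by (auto simp: polar_def)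
      then have "cabs w < cabs (rad N)" by (rule polar_inner)
      moreover from this have "cabs (w - a) < cabs (rad N)"
        using AN_cabs_rad[OF a] by (intro cabs_diff_less)
      ultimately show ?thesis using m by (intro *[OF has_res_inner_pole has_res_inner_pole]) auto
    qed
    show "\<Phi> (\<lambda>z. f z + g z) = (\<lambda>k. \<Phi> f k + \<Phi> g k)" for f g
      by (simp add: \<Phi>_def fun_eq_iff avg_add)
    show "\<Phi> (\<lambda>z. c * f z) = (\<lambda>k. c * \<Phi> f k)" for c f
      by (simp add: \<Phi>_def fun_eq_iff avg_cmult right_diff_distrib)
    show "\<Phi> g = \<Phi> f" if "\<And>z. z \<notin> polar N \<Longrightarrow> g z = f z" for f g
    proof -
      have "avg (rad N) 0 g = avg (rad N) 0 f"
        by (rule avg_cong) (use that big_circle(2) in simp)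
      moreover have "avg (rad N) a g = avg (rad N) a f"
        by (rule avg_cong, rule that, rule big_circle(2), rule circ)
      ultimately show ?thesis by (simp add: \<Phi>_def fun_eq_iff)
    qed
  qed
  have "tate (\<Phi> (\<lambda>z. f z * inverse (z - a)))"
  proof (rule tate_uniform)
    fix e :: real assume e: "e > 0"
    obtain P Q where Q: "Q \<noteq> 0" "\<And>w. poly Q w = 0 \<Longrightarrow> w \<in> polar N"
      and PQ: "\<And>z. z \<in> Omega_n q th (Suc N) \<Longrightarrow> poly Q z \<noteq> 0 \<and> cabs (f z - poly P z / poly Q z) < e / 2"
      using rational_approx[OF f, of "e / 2" N] e by auto
    define h where "h = (\<lambda>z. poly P z / poly Q z * inverse (z - a))"
    have h: "tate (\<Phi> h)"
      unfolding h_def by (rule null[OF pf_mult_pole[OF pf_rational[OF Q] AN_polar[OF a]]])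
    have est: "cabs (rad N) * cabs (f z * inverse (z - a) - h z) \<le> e / 2" if "cabs z = cabs (rad N)" for z
    proof -
      have "f z * inverse (z - a) - h z = (f z - poly P z / poly Q z) * inverse (z - a)"
        by (simp add: h_def algebra_simps)
      then have "cabs (rad N) * cabs (f z * inverse (z - a) - h z) = cabs (f z - poly P z / poly Q z)"
        using circ'[OF that] rad_nonzero[of N] by (simp only: cabs_mult cabs_inverse) simp
      then show ?thesis using PQ[OF big_circle(1)[OF that]] by simp
    qed
    have "cabs (\<Phi> (\<lambda>z. f z * inverse (z - a)) k - \<Phi> h k) < e" for k
    proof -
      have "\<Phi> (\<lambda>z. f z * inverse (z - a)) k - \<Phi> h k =
          avg (rad N) 0 (\<lambda>z. f z * inverse (z - a) - h z) k - avg (rad N) a (\<lambda>z. f z * inverse (z - a) - h z) k"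
        by (simp add: \<Phi>_def avg_diff)
      also have "cabs \<dots> \<le> e / 2"
      proof (rule cabs_diff_leI)
        show "cabs (avg (rad N) 0 (\<lambda>z. f z * inverse (z - a) - h z) k) \<le> e / 2"
          by (rule avg_bound) (use e est in auto)
        show "cabs (avg (rad N) a (\<lambda>z. f z * inverse (z - a) - h z) k) \<le> e / 2"
        proof (rule avg_bound)
          show "cabs (rad N) * cabs (f z * inverse (z - a) - h z) \<le> e / 2"
            if "cabs (z - a) = cabs (rad N)" for z
            by (rule est[OF circ[OF that]])
        qed (use e in simp)
      qed
      finally show ?thesis using e by simp
    qed
    with h show "\<exists>Y. tate Y \<and> (\<forall>k. cabs (\<Phi> (\<lambda>z. f z * inverse (z - a)) k - Y k) < e)" by blast
  qed
  moreover have "avg (rad N) a (\<lambda>z. f z * inverse (z - a)) = avg (rad N) 0 (\<lambda>z. f (z + a) * inverse z)"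
    by (subst avg_shift) (simp add: add.commute)
  ultimately show ?thesis by (simp add: \<Phi>_def[abs_def])
qed


subsection \<open>Boundedness\<close>

lemma poly_bounded: "\<exists>B. \<forall>z. cabs z \<le> R \<longrightarrow> cabs (poly P z) \<le> B" for P :: "'c poly"
proof (induction P)
  case (pCons c P)
  then obtain B where B: "\<And>z. cabs z \<le> R \<Longrightarrow> cabs (poly P z) \<le> B" by blast
  have "cabs (poly (pCons c P) z) \<le> cabs c + R * B" if "cabs z \<le> R" for z
  proof -
    have "R \<ge> 0" using that cabs_nonneg[of z] by linarith
    then have "cabs z * cabs (poly P z) \<le> R * B"
      using that B[OF that] by (intro mult_mono) auto
    then show ?thesis using cabs_add_le[of c "z * poly P z"] by (simp add: cabs_mult)
  qed
  then show ?case by blast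
qed auto

text \<open>An approximating P/Q is bounded because all zeros of Q keep the distance q^(-n) from the
  affinoid, which bounds |Q| from below.\<close>

lemma rigidC_bounded:
  assumes f: "rigidC q th f"
  shows "\<exists>B. \<forall>z\<in>Omega_n q th n. cabs (f z) \<le> B"
proof (cases "Omega_n q th n = {}")
  case False
  obtain P Q where PQ: "\<forall>z\<in>Omega_n q th n. poly Q z \<noteq> 0 \<and> cabs (f z - poly P z / poly Q z) < 1"
    using f[unfolded rigidC_def, THEN spec, THEN spec, THEN mp, OF zero_less_one, of n] by blast
  obtain B where B: "\<And>z. cabs z \<le> real q ^ n \<Longrightarrow> cabs (poly P z) \<le> B"
    using poly_bounded by blast
  define r where "r = inverse (real q ^ n)"
  have r: "0 < r" "r \<le> real q ^ n"
  proof -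
    show "0 < r" using real_q_gt_1 by (simp add: r_def)
    have "1 \<le> real q ^ n" using real_q_gt_1 by (intro one_le_power) simp
    then show "r \<le> real q ^ n" unfolding r_def using inverse_le_1_iff[of "real q ^ n"] by linarith
  qed
  \<comment> \<open>If w were closer than r to z, it would share with z the distance to every point
    of K_inf within r of w.\<close>
  have dist: "r \<le> cabs (z - w)" if z: "z \<in> Omega_n q th n" and w: "w \<notin> Omega_n q th n" for z w
  proof (cases "cabs w \<le> real q ^ n")
    case True
    then have "imnorm q th w < r" using w by (auto simp: Omega_n_def r_def)
    then obtain k where k: "k \<in> Kinf q th" "cabs (w - k) < r" using imnorm_lessD by blast
    have "r \<le> cabs (z - k)" using z imnorm_le[OF k(1), of z] by (simp add: Omega_n_def r_def)
    then show ?thesis using cabs_ultra[of z w r k] k(2) by linarith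
  next
    case False
    then have "cabs (z - w) = cabs w" using z by (intro cabs_diff_eq) (auto simp: Omega_n_def)
    then show ?thesis using False r by linarith
  qed
  have "Q \<noteq> 0" using PQ False by auto
  then obtain c xs where c: "c \<noteq> 0" and Q: "Q = smult c (\<Prod>x\<leftarrow>xs. [:- x, 1:])"
    using poly_splits by blast
  have Q': "poly Q z = c * (\<Prod>x\<leftarrow>xs. z - x)" for z
    unfolding Q by (induction xs) (auto simp: algebra_simps)
  have xs: "x \<notin> Omega_n q th n" if "x \<in> set xs" for x
  proof -
    have "(\<Prod>y\<leftarrow>xs. x - y) = 0" using that by (induction xs) auto
    then show ?thesis using PQ Q' by force
  qed
  have lower: "r ^ length xs \<le> cabs (\<Prod>x\<leftarrow>xs. z - x)" if z: "z \<in> Omega_n q th n" for z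
    using xs
  proof (induction xs)
    case (Cons x xs)
    have "r * r ^ length xs \<le> cabs (z - x) * cabs (\<Prod>x\<leftarrow>xs. z - x)"
      using Cons dist[OF z] r by (intro mult_mono) auto
    then show ?case by (simp add: cabs_mult)
  qed simp
  have "cabs (f z) \<le> 1 + B / (cabs c * r ^ length xs)" if z: "z \<in> Omega_n q th n" for z
  proof -
    have P: "cabs (poly P z) \<le> B" using z by (intro B) (simp add: Omega_n_def)
    moreover have "B \<ge> 0" using P cabs_nonneg[of "poly P z"] by linarith
    moreover have "cabs c * r ^ length xs \<le> cabs (poly Q z)"
      unfolding Q' cabs_mult using lower[OF z] by (intro mult_left_mono) auto
    ultimately have "cabs (poly P z / poly Q z) \<le> B / (cabs c * r ^ length xs)"
      unfolding cabs_divide using c r by (intro frac_le) auto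
    moreover have "cabs (f z - poly P z / poly Q z) < 1" using PQ z by blast
    ultimately show ?thesis
      using cabs_add_le[of "f z - poly P z / poly Q z" "poly P z / poly Q z"] by simp
  qed
  then show ?thesis by blast
qed simp

text \<open>On these circles |z|_Im = |z| > q^N \<ge> N, so a limit at infinity becomes a statement
  about large N.\<close>

lemma tends0ImD:
  assumes "tends0Im q th g" "e > 0"
  shows "\<exists>M. \<forall>N\<ge>M. \<forall>z. cabs z = cabs (rad N) \<longrightarrow> \<bar>g z\<bar> < e"
proof -
  obtain R where R: "\<forall>z\<in>Omega q th. imnorm q th z \<ge> R \<longrightarrow> \<bar>g z\<bar> < e"
    using assms unfolding tends0Im_def by blast
  show ?thesis
  proof (intro exI[of _ "nat \<lceil>R\<rceil>"] allI impI)
    fix N and z :: 'c assume N: "nat \<lceil>R\<rceil> \<le> N" and z: "cabs z = cabs (rad N)"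
    have "R \<le> real N" using N by linarith
    also have "N < 2 ^ N" by (rule less_exp)
    then have "N < q ^ N" using power_mono[OF q_ge_2, of N] by linarith
    then have "real N \<le> real q ^ N" by (metis less_imp_le of_nat_le_iff of_nat_power)
    also have "\<dots> < imnorm q th z" using cabs_rad(1)[of N] imnorm_rad[OF z] z by simp
    finally have "R \<le> imnorm q th z" by simp
    then show "\<bar>g z\<bar> < e"
      using R Omega_n_Omega[OF big_circle(1)[OF z]] by blast
  qed
qed

text \<open>For fixed \<open>z0\<close>, on a large circle the function \<open>f2\<close> is dominated by the lattice polynomial \<open>eN N\<close>, while
  translations by the lattice change the integral over the circle by a small amount only. Hence Lagrange
  interpolation of the integral at the lattice points shows that it hardly depends on \<open>z0\<close>.\<close>
lemma circle_integral_nearly_constant: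
  assumes f1: "rigidC q th f1" and f2: "rigidC q th f2"
    and chi: "\<And>a. a \<in> Aset q th \<Longrightarrow> cabs (ch a) \<le> 1"
    and trans: "\<And>a z. a \<in> Aset q th \<Longrightarrow> z \<in> Omega q th \<Longrightarrow> f2 (z + a) = f2 z - ch a * f1 z"
    and lim1: "tends0Im q th (\<lambda>z. cabs (f1 z))"
    and lim2: "tends0Im q th (\<lambda>z. cabs (uC q th z * f2 z))"
    and z0: "imnorm q th z0 \<ge> 1" and e: "e > 0"
  shows "\<exists>M. \<forall>N\<ge>M. \<exists>K. \<forall>k\<ge>K.
    cabs (avg (rad N) 0 (\<lambda>x. f2 x * inverse (x - z0)) k - avg (rad N) 0 (\<lambda>x. f2 x * inverse x) k) \<le> e"
proof -
  obtain N0 where N0: "cabs z0 < real q ^ N0"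
    using real_arch_pow[OF real_q_gt_1] by blast
  \<comment> \<open>By \<open>cabs_eN_DN\<close> this does not change with N, so the interpolation
    weights stay bounded as the nodes multiply.\<close>
  define G where "G = cabs (eN N0 z0) / cabs (DN N0)"
  have G: "G \<ge> 0" by (simp add: G_def)
  have GN: "cabs (eN N z0) / cabs (DN N) = G" if "N \<ge> N0" for N
  proof -
    have "real q ^ N0 \<le> real q ^ Suc N0" using real_q_gt_1 by (intro power_increasing) auto
    then show ?thesis unfolding G_def using N0 by (intro cabs_eN_DN[OF that]) simp
  qed
  define \<delta> where "\<delta> = e / (G + 1)"
  have \<delta>: "\<delta> > 0" "\<delta> * G \<le> e"
    using e G by (auto simp: \<delta>_def field_simps)
  define per where "per = cabs (carlitz_period q th)"
  have per: "per > 0" using carlitz_period_nonzero by (simp add: per_def)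
  obtain M1 where M1: "\<forall>N\<ge>M1. \<forall>z. cabs z = cabs (rad N) \<longrightarrow> \<bar>cabs (f1 z)\<bar> < \<delta>"
    using tends0ImD[OF lim1 \<delta>(1)] by blast
  obtain M2 where M2: "\<forall>N\<ge>M2. \<forall>z. cabs z = cabs (rad N) \<longrightarrow> \<bar>cabs (uC q th z * f2 z)\<bar> < \<delta> / per"
    using tends0ImD[OF lim2 divide_pos_pos[OF \<delta>(1) per]] by blast
  show ?thesis
  proof (rule exI[of _ "max N0 (max M1 M2)"], intro allI impI)
    fix N assume "N \<ge> max N0 (max M1 M2)"
    then have N: "N \<ge> N0" "N \<ge> M1" "N \<ge> M2" by auto
    define Z where "Z a k = avg (rad N) 0 (\<lambda>x. f2 x * inverse (x - a)) k" for a k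
    have "real q ^ N0 \<le> real q ^ N" using N(1) real_q_gt_1 by (intro power_increasing) auto
    then have z0N: "cabs z0 < cabs (rad N)" using N0 cabs_rad(1)[of N] by linarith
    have z0A: "cabs (z0 - a) \<ge> 1" if "a \<in> AN N" for a
      using imnorm_le[OF Aset_Kinf[OF AN_Aset[OF that]], of z0] z0 by linarith
    then have z0nA: "z0 \<notin> AN N" by force
    have node: "\<exists>K. \<forall>k\<ge>K. cabs (Z a k - Z 0 k) < \<delta>" if a: "a \<in> AN N" for a
    proof -
      have "tate (\<lambda>k. Z a k - avg (rad N) 0 (\<lambda>x. f2 (x + a) * inverse x) k)"
        unfolding Z_def by (rule avg_translate[OF f2 a])
      then obtain K where K: "\<And>k. k \<ge> K \<Longrightarrow> cabs (Z a k - avg (rad N) 0 (\<lambda>x. f2 (x + a) * inverse x) k) < \<delta>"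
        using \<delta>(1) unfolding tate_iff by metis
      have "cabs (Z a k - Z 0 k) < \<delta>" if "k \<ge> K" for k
      proof -
        have "avg (rad N) 0 (\<lambda>x. f2 (x + a) * inverse x) =
              avg (rad N) 0 (\<lambda>x. f2 x * inverse x - ch a * (f1 x * inverse x))"
        proof (rule avg_cong)
          fix x :: 'c assume "cabs (x - 0) = cabs (rad N)"
          then have "x \<in> Omega q th" using Omega_n_Omega[OF big_circle(1), of x N] by simp
          then show "f2 (x + a) * inverse x = f2 x * inverse x - ch a * (f1 x * inverse x)"
            unfolding trans[OF AN_Aset[OF a] \<open>x \<in> Omega q th\<close>] by (simp add: left_diff_distrib)
        qed
        then have eq: "avg (rad N) 0 (\<lambda>x. f2 (x + a) * inverse x) k - Z 0 k =
            - (ch a * avg (rad N) 0 (\<lambda>x. f1 x * inverse x) k)"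
          by (simp add: Z_def avg_diff avg_cmult)
        have "cabs (avg (rad N) 0 (\<lambda>x. f1 x * inverse x) k) < \<delta>"
        proof (rule avg_less[OF \<delta>(1)])
          fix x :: 'c assume "cabs (x - 0) = cabs (rad N)"
          then have x: "cabs x = cabs (rad N)" by simp
          then have "cabs (f1 x) < \<delta>" using M1 N(2) by auto
          then show "cabs (rad N) * cabs (f1 x * inverse x) < \<delta>"
            using x rad_nonzero[of N] unfolding cabs_mult cabs_inverse by (simp add: field_simps)
        qed
        then have "cabs (ch a * avg (rad N) 0 (\<lambda>x. f1 x * inverse x) k) < \<delta>"
          using chi[OF AN_Aset[OF a]] mult_left_le_one_le[of "cabs (avg (rad N) 0 (\<lambda>x. f1 x * inverse x) k)" "cabs (ch a)"]
          by (simp add: cabs_mult)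
        then have "cabs (avg (rad N) 0 (\<lambda>x. f2 (x + a) * inverse x) k - Z 0 k) < \<delta>"
          unfolding eq by simp
        from cabs_add_less[OF K[OF that] this] show ?thesis by simp
      qed
      then show ?thesis by blast
    qed
    have "\<exists>K. \<forall>a\<in>AN N. \<forall>k\<ge>K. cabs (Z a k - Z 0 k) < \<delta>"
    proof -
      obtain K where K: "\<And>a. a \<in> AN N \<Longrightarrow> \<forall>k\<ge>K a. cabs (Z a k - Z 0 k) < \<delta>"
        using node by metis
      have "\<forall>a\<in>AN N. \<forall>k\<ge>Max (K ` AN N). cabs (Z a k - Z 0 k) < \<delta>"
        using K Max_ge[OF finite_imageI[OF finite_AN]] by (meson imageI order_trans)
      then show ?thesis by blast
    qed
    then obtain K where K: "\<And>a k. a \<in> AN N \<Longrightarrow> k \<ge> K \<Longrightarrow> cabs (Z a k - Z 0 k) < \<delta>" by blast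
    \<comment> \<open>The Lagrange weights of \<open>z0\<close>. They are at most G because
      \<open>z0\<close> has distance at least 1 from the nodes, and they sum to 1.\<close>
    define w where "w a = eN N z0 / DN N * inverse (z0 - a)" for a
    have w: "cabs (w a) \<le> G" if "a \<in> AN N" for a
    proof -
      have "inverse (cabs (z0 - a)) \<le> 1" using z0A[OF that] by (simp add: inverse_le_1_iff)
      then have "G * inverse (cabs (z0 - a)) \<le> G" using G by (simp add: mult_left_le)
      then show ?thesis unfolding w_def cabs_mult cabs_divide cabs_inverse GN[OF N(1)] .
    qed
    have sum_w: "(\<Sum>a\<in>AN N. w a) = 1"
      unfolding w_def sum_distrib_left[symmetric] sum_inverse_AN[OF z0nA]
      using DN_nonzero[of N] eN_nonzero[OF z0nA] by simp
    have "cabs (Z z0 k - Z 0 k) \<le> e" if k: "k \<ge> K" for k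
    proof -
      define r where "r = avg (rad N) 0 (\<lambda>x. f2 x * (eN N z0 / eN N x * inverse (x - z0))) k"
      have "avg (rad N) 0 (\<lambda>x. f2 x * inverse (x - z0)) =
          avg (rad N) 0 (\<lambda>x. (\<Sum>a\<in>AN N. w a * (f2 x * inverse (x - a))) +
             f2 x * (eN N z0 / eN N x * inverse (x - z0)))"
      proof (rule avg_cong)
        fix x :: 'c assume "cabs (x - 0) = cabs (rad N)"
        then have x: "cabs x = cabs (rad N)" by simp
        have "x \<notin> AN N" "x \<noteq> z0" using circle_not_AN[OF x] AN_Aset x z0N by auto
        from lagrange_kernel[OF this(1) z0nA this(2)]
        have "inverse (x - z0) = (\<Sum>a\<in>AN N. w a * inverse (x - a)) + eN N z0 / eN N x * inverse (x - z0)"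
          by (simp only: w_def)
        then have "f2 x * inverse (x - z0) =
            f2 x * ((\<Sum>a\<in>AN N. w a * inverse (x - a)) + eN N z0 / eN N x * inverse (x - z0))" by (rule arg_cong)
        then show "f2 x * inverse (x - z0) = (\<Sum>a\<in>AN N. w a * (f2 x * inverse (x - a))) +
             f2 x * (eN N z0 / eN N x * inverse (x - z0))"
          by (simp only: distrib_left sum_distrib_left mult.left_commute)
      qed
      then have "Z z0 k = (\<Sum>a\<in>AN N. w a * Z a k) + r"
        by (simp add: Z_def r_def avg_add avg_sum)
      \<comment> \<open>As the weights sum to 1, the value \<open>Z 0 k\<close> can be split off,
        leaving the small differences between nodes.\<close>
      also have "(\<Sum>a\<in>AN N. w a * Z a k) = (\<Sum>a\<in>AN N. w a * (Z a k - Z 0 k)) + Z 0 k"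
        by (simp add: right_diff_distrib sum_subtractf sum_w flip: sum_distrib_right)
      finally have eq: "Z z0 k - Z 0 k = (\<Sum>a\<in>AN N. w a * (Z a k - Z 0 k)) + r" by simp
      have "cabs (\<Sum>a\<in>AN N. w a * (Z a k - Z 0 k)) \<le> e"
      proof (rule cabs_sum_le)
        fix a assume a: "a \<in> AN N"
        have "cabs (w a) * cabs (Z a k - Z 0 k) \<le> G * \<delta>"
          using w[OF a] K[OF a k] G by (intro mult_mono) auto
        then show "cabs (w a * (Z a k - Z 0 k)) \<le> e" using \<delta>(2) by (simp add: cabs_mult mult.commute)
      qed (use e in simp)
      moreover have "cabs r \<le> e"
        unfolding r_def
      proof (rule avg_bound)
        fix x :: 'c assume "cabs (x - 0) = cabs (rad N)"
        then have x: "cabs x = cabs (rad N)" by simp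
        have xz: "cabs (x - z0) = cabs (rad N)" using cabs_diff_eq'[of z0 x] x z0N by simp
        have e0: "cabs (eN N x) > 0" using eN_nonzero[of x N] circle_not_AN[OF x] AN_Aset by auto
        have D0: "cabs (DN N) > 0" using DN_nonzero by simp
        \<comment> \<open>By \<open>cabs_uC\<close> this bounds |f2 x / eN N x| by \<delta> / |DN
          N|, which is what the interpolation error requires.\<close>
        have "cabs (uC q th x * f2 x) < \<delta> / per" using M2 N(3) x by auto
        then have "inverse per * (cabs (DN N) / cabs (eN N x)) * cabs (f2 x) \<le> \<delta> / per"
          unfolding cabs_mult cabs_uC[OF x] per_def[symmetric] by simp
        then have "cabs (DN N) / cabs (eN N x) * cabs (f2 x) \<le> \<delta>"
          using per by (simp add: field_simps)
        then have f2x: "cabs (f2 x) / cabs (eN N x) \<le> \<delta> / cabs (DN N)"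
          using D0 by (simp add: field_simps)
        have "cabs (rad N) * cabs (f2 x * (eN N z0 / eN N x * inverse (x - z0))) =
            cabs (f2 x) / cabs (eN N x) * cabs (eN N z0)"
          using rad_nonzero[of N] unfolding cabs_mult cabs_divide cabs_inverse xz by simp
        also have "\<dots> \<le> \<delta> / cabs (DN N) * cabs (eN N z0)"
          using f2x by (intro mult_right_mono) auto
        also have "\<dots> = \<delta> * (cabs (eN N z0) / cabs (DN N))" by simp
        also have "\<dots> \<le> e" using \<delta>(2) GN[OF N(1)] by simp
        finally show "cabs (rad N) * cabs (f2 x * (eN N z0 / eN N x * inverse (x - z0))) \<le> e" .
      qed (use e in simp)
      ultimately show ?thesis unfolding eq by (rule cabs_add_leI)
    qed
    then show "\<exists>K. \<forall>k\<ge>K. cabs (avg (rad N) 0 (\<lambda>x. f2 x * inverse (x - z0)) k -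
        avg (rad N) 0 (\<lambda>x. f2 x * inverse x) k) \<le> e"
      by (auto simp: Z_def)
  qed
qed

text \<open>Translation moves every small circle to the one around 0, where \<open>f1\<close> and
  \<open>f2\<close> are bounded, and |z - z0| \<ge> 1 there; this gives a bound independent of N.
  The large circle is compared with the integral for \<open>z0\<close> = 0.\<close>

lemma bounded_at_infinity:
  assumes f1: "rigidC q th f1" and f2: "rigidC q th f2"
    and chi: "\<And>a. a \<in> Aset q th \<Longrightarrow> cabs (ch a) \<le> 1"
    and trans: "\<And>a z. a \<in> Aset q th \<Longrightarrow> z \<in> Omega q th \<Longrightarrow> f2 (z + a) = f2 z - ch a * f1 z"
    and lim1: "tends0Im q th (\<lambda>z. cabs (f1 z))"
    and lim2: "tends0Im q th (\<lambda>z. cabs (uC q th z * f2 z))"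
  shows "\<exists>B. \<forall>z. imnorm q th z \<ge> 1 \<longrightarrow> cabs (f2 z) \<le> B"
proof -
  have circ0: "z \<in> Omega_n q th (Suc 0)" if "cabs z = cabs rad0" for z
    using small_circle(1)[of 0 0 z] that by simp
  obtain B1 where B1: "\<forall>z\<in>Omega_n q th (Suc 0). cabs (f1 z) \<le> B1" using rigidC_bounded[OF f1] by blast
  obtain B2 where B2: "\<forall>z\<in>Omega_n q th (Suc 0). cabs (f2 z) \<le> B2" using rigidC_bounded[OF f2] by blast
  define B where "B = max 1 (max B1 B2)"
  have B: "1 \<le> B" "cabs (f1 z) \<le> B" "cabs (f2 z) \<le> B" if "cabs z = cabs rad0" for z
    using B1 B2 circ0[OF that] by (fastforce simp: B_def)+
  have small: "cabs (f2 z) \<le> B" if "\<kappa> \<in> AN N" "cabs (z - \<kappa>) = cabs rad0" for \<kappa> N z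
  proof -
    have "z - \<kappa> \<in> Omega q th" using circ0[OF that(2)] by (rule Omega_n_Omega)
    then have "f2 z = f2 (z - \<kappa>) - ch \<kappa> * f1 (z - \<kappa>)"
      using trans[OF AN_Aset[OF that(1)], of "z - \<kappa>"] by simp
    moreover have "cabs (ch \<kappa> * f1 (z - \<kappa>)) \<le> 1 * B"
      unfolding cabs_mult using chi[OF AN_Aset[OF that(1)]] B(2)[OF that(2)] by (intro mult_mono) auto
    ultimately show ?thesis using B(3)[OF that(2)] by (simp add: cabs_diff_leI)
  qed
  have near: "\<exists>M. \<forall>N\<ge>M. \<exists>K. \<forall>k\<ge>K. cabs (f2 z0 - avg (rad N) 0 (\<lambda>x. f2 x * inverse x) k) \<le> B"
    if z0: "imnorm q th z0 \<ge> 1" for z0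
  proof -
    obtain M where M: "\<forall>N\<ge>M. \<exists>K. \<forall>k\<ge>K.
      cabs (avg (rad N) 0 (\<lambda>x. f2 x * inverse (x - z0)) k - avg (rad N) 0 (\<lambda>x. f2 x * inverse x) k) \<le> 1"
      using circle_integral_nearly_constant[OF f1 f2 chi trans lim1 lim2 z0 zero_less_one] by blast
    obtain N0 where N0: "cabs z0 < real q ^ N0"
      using real_arch_pow[OF real_q_gt_1] by blast
    show ?thesis
    proof (rule exI[of _ "max M N0"], intro allI impI)
      fix N assume N: "N \<ge> max M N0"
      have "real q ^ N0 \<le> real q ^ N" using N real_q_gt_1 by (intro power_increasing) auto
      then have z0N: "cabs z0 < cabs (rad N)" using N0 cabs_rad(1)[of N] by linarith
      obtain K1 where K1: "\<forall>k\<ge>K1. cabs (avg (rad N) 0 (\<lambda>x. f2 x * inverse (x - z0)) k -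
          avg (rad N) 0 (\<lambda>x. f2 x * inverse x) k) \<le> 1"
        using M N by auto
      obtain K2 where K2: "\<forall>k\<ge>K2. cabs (bdry N (\<lambda>z. f2 z * inverse (z - z0)) k - f2 z0) < 1"
        using cauchy_formula[OF f2 z0 z0N] unfolding tate_iff by (metis zero_less_one)
      show "\<exists>K. \<forall>k\<ge>K. cabs (f2 z0 - avg (rad N) 0 (\<lambda>x. f2 x * inverse x) k) \<le> B"
      proof (intro exI[of _ "max K1 K2"] allI impI)
        fix k assume k: "k \<ge> max K1 K2"
        define J where "J = (\<Sum>\<kappa>\<in>AN N. avg rad0 \<kappa> (\<lambda>z. f2 z * inverse (z - z0)) k)"
        define I where "I = avg (rad N) 0 (\<lambda>x. f2 x * inverse (x - z0)) k"
        define I0 where "I0 = avg (rad N) 0 (\<lambda>x. f2 x * inverse x) k"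
        have B1: "1 \<le> B" by (simp add: B_def)
        have 1: "cabs (I - I0) \<le> B" using K1 k B1 by (auto simp: I_def I0_def intro: order_trans)
        have "cabs (I - J - f2 z0) < 1" using K2 k by (simp add: bdry_def I_def J_def)
        then have 2: "cabs (f2 z0 - (I - J)) \<le> B" using B1 by (simp add: cabs_minus_commute)
        have 3: "cabs J \<le> B"
          unfolding J_def
        proof (rule cabs_sum_le, goal_cases)
          case (2 \<kappa>)
          show ?case
          proof (rule avg_bound)
            fix z :: 'c assume z: "cabs (z - \<kappa>) = cabs rad0"
            note \<kappa> = 2
            have "1 \<le> cabs (z0 - \<kappa>)"
              using imnorm_le[OF Aset_Kinf[OF AN_Aset[OF \<kappa>]], of z0] z0 by linarith
            moreover from this have "cabs ((z - \<kappa>) - (z0 - \<kappa>)) = cabs (z0 - \<kappa>)"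
              using z cabs_rad0(2) by (intro cabs_diff_eq) simp
            ultimately have zz: "1 \<le> cabs (z - z0)" by simp
            have "cabs rad0 * inverse (cabs (z - z0)) \<le> 1 * 1"
              using zz cabs_rad0 by (intro mult_mono) (auto simp: inverse_le_1_iff)
            then have "cabs (f2 z) * (cabs rad0 * inverse (cabs (z - z0))) \<le> cabs (f2 z)"
              by (intro mult_left_le) auto
            then show "cabs rad0 * cabs (f2 z * inverse (z - z0)) \<le> B"
              using small[OF \<kappa> z] by (simp add: cabs_mult cabs_inverse mult_ac)
          qed (use B1 in auto)
        qed (use B1 in auto)
        have "f2 z0 - I0 = (f2 z0 - (I - J)) + ((I - I0) - J)" by simp
        also have "cabs \<dots> \<le> B" by (rule cabs_add_leI[OF 2 cabs_diff_leI[OF 1 3]])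
        finally show "cabs (f2 z0 - avg (rad N) 0 (\<lambda>x. f2 x * inverse x) k) \<le> B" by (simp add: I0_def)
      qed
    qed
  qed
  have r0: "imnorm q th (rad 0) \<ge> 1" using imnorm_rad[of "rad 0" 0] cabs_rad(1)[of 0] by simp
  obtain M1 where M1: "\<forall>N\<ge>M1. \<exists>K. \<forall>k\<ge>K. cabs (f2 (rad 0) - avg (rad N) 0 (\<lambda>x. f2 x * inverse x) k) \<le> B"
    using near[OF r0] by blast
  have "cabs (f2 z) \<le> max B (cabs (f2 (rad 0)))" if z: "imnorm q th z \<ge> 1" for z
  proof -
    obtain M2 where M2: "\<forall>N\<ge>M2. \<exists>K. \<forall>k\<ge>K. cabs (f2 z - avg (rad N) 0 (\<lambda>x. f2 x * inverse x) k) \<le> B"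
      using near[OF z] by blast
    \<comment> \<open>A single N, and then a single index k, serve both points, so that the common
      integral cancels.\<close>
    define N where "N = max M1 M2"
    have N: "N \<ge> M1" "N \<ge> M2" by (simp_all add: N_def)
    obtain K1 where K1: "\<forall>k\<ge>K1. cabs (f2 (rad 0) - avg (rad N) 0 (\<lambda>x. f2 x * inverse x) k) \<le> B"
      using M1 N(1) by blast
    obtain K2 where K2: "\<forall>k\<ge>K2. cabs (f2 z - avg (rad N) 0 (\<lambda>x. f2 x * inverse x) k) \<le> B"
      using M2 N(2) by blast
    define I where "I = avg (rad N) 0 (\<lambda>x. f2 x * inverse x) (max K1 K2)"
    have "cabs (f2 z - I) \<le> B" "cabs (f2 (rad 0) - I) \<le> B" using K1 K2 by (simp_all add: I_def)
    then have "cabs ((f2 z - I) - (f2 (rad 0) - I)) \<le> B" by (rule cabs_diff_leI)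
    then show ?thesis using cabs_add_le_max[of "f2 z - f2 (rad 0)" "f2 (rad 0)"] by auto
  qed
  then show ?thesis by blast
qed


section \<open>Translating and scaling in the upper half plane\<close>

lemma tends0Im_le:
  assumes "tends0Im q th g" "\<And>z. z \<in> Omega q th \<Longrightarrow> \<bar>h z\<bar> \<le> g z"
  shows "tends0Im q th h"
  unfolding tends0Im_def
proof (intro allI impI)
  fix e :: real assume "e > 0"
  then obtain R where R: "\<forall>z\<in>Omega q th. R \<le> imnorm q th z \<longrightarrow> \<bar>g z\<bar> < e"
    using assms(1) unfolding tends0Im_def by blast
  show "\<exists>R. \<forall>z\<in>Omega q th. R \<le> imnorm q th z \<longrightarrow> \<bar>h z\<bar> < e"
  proof (intro exI[of _ R] ballI impI)
    fix z assume "z \<in> Omega q th" "R \<le> imnorm q th z"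
    then have "\<bar>g z\<bar> < e" "\<bar>h z\<bar> \<le> g z" using R assms(2) by blast+
    then show "\<bar>h z\<bar> < e" by linarith
  qed
qed

text \<open>A point within R of K_inf is, modulo A, of bounded absolute value, since K_inf is A plus
  a small disc; translation by A preserves |z|_Im.\<close>

lemma translate_to_Omega_n:
  assumes "\<epsilon> > 0"
  shows "\<exists>n. \<forall>z. \<epsilon> \<le> imnorm q th z \<and> imnorm q th z < R \<longrightarrow> (\<exists>a\<in>Aset q th. z - a \<in> Omega_n q th n)"
proof -
  obtain n where n: "max (max R 1) (inverse \<epsilon>) < real q ^ n"
    using real_arch_pow[OF real_q_gt_1] by blast
  have "inverse (real q ^ n) \<le> inverse (inverse \<epsilon>)"
    using n assms by (intro le_imp_inverse_le) auto
  then have \<epsilon>: "inverse (real q ^ n) \<le> \<epsilon>" by simp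
  have "\<exists>a\<in>Aset q th. z - a \<in> Omega_n q th n" if z: "\<epsilon> \<le> imnorm q th z" "imnorm q th z < R" for z
  proof -
    obtain k where k: "k \<in> Kinf q th" "cabs (z - k) < R" using imnorm_lessD[OF z(2)] by blast
    obtain a where a: "a \<in> Aset q th" "cabs (k - a) \<le> inverse (real q)" using Kinf_approx[OF k(1)] by blast
    have "inverse (real q) < 1" using cabs_rad0 by linarith
    then have "cabs ((z - k) + (k - a)) \<le> real q ^ n"
      using k(2) a(2) n by (intro cabs_add_leI) auto
    then have "z - a \<in> Omega_n q th n"
      using z(1) \<epsilon> imnorm_diff_Aset[OF a(1), of z] by (simp add: Omega_n_def)
    then show ?thesis using a(1) by blast
  qed
  then show ?thesis by blast
qed

text \<open>If |b| = q^d, multiplication by b maps Omega_n into Omega_(n+d), so approximants can be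
  pulled back.\<close>

lemma rigidC_scale:
  assumes f: "rigidC q th f" and b: "b \<in> Aset q th" "b \<noteq> 0"
  shows "rigidC q th (\<lambda>z. c * f (b * z))"
  unfolding rigidC_def
proof (intro allI impI)
  fix n and e :: real assume e: "e > 0"
  obtain d where d: "cabs b = real q ^ d" using cabs_Aset[OF b] by blast
  \<comment> \<open>The added 1 handles c = 0 and makes the final inequality strict.\<close>
  have \<delta>: "e / (cabs c + 1) > 0" using e by (intro divide_pos_pos) (auto intro: add_nonneg_pos)
  obtain P Q where PQ: "\<forall>z\<in>Omega_n q th (n + d). poly Q z \<noteq> 0 \<and> cabs (f z - poly P z / poly Q z) < e / (cabs c + 1)"
    using f[unfolded rigidC_def, THEN spec, THEN spec, THEN mp, OF \<delta>, of "n + d"] by blast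
  show "\<exists>P Q. \<forall>z\<in>Omega_n q th n. poly Q z \<noteq> 0 \<and> cabs (c * f (b * z) - poly P z / poly Q z) < e"
  proof (rule exI[of _ "smult c (pcompose P [:0, b:])"], rule exI[of _ "pcompose Q [:0, b:]"], rule ballI)
    fix z assume z: "z \<in> Omega_n q th n"
    have "imnorm q th (b * z) = cabs b * imnorm q th z"
      using imnorm_affine[of b 0 z] b Aset_Kinf by simp
    moreover have "1 \<le> real q ^ d" using real_q_gt_1 by (intro one_le_power) simp
    then have "1 * imnorm q th z \<le> cabs b * imnorm q th z"
      unfolding d using imnorm_nonneg by (intro mult_right_mono) auto
    moreover have "inverse (real q ^ (n + d)) \<le> inverse (real q ^ n)"
      using real_q_gt_1 by (intro le_imp_inverse_le power_increasing) auto
    moreover have "inverse (real q ^ n) \<le> imnorm q th z" using z by (simp add: Omega_n_def)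
    ultimately have "inverse (real q ^ (n + d)) \<le> imnorm q th (b * z)" by linarith
    moreover have "cabs (b * z) \<le> real q ^ (n + d)"
      using z d real_q_gt_1 by (simp add: Omega_n_def cabs_mult power_add)
    ultimately have "b * z \<in> Omega_n q th (n + d)" by (simp add: Omega_n_def)
    then have Q: "poly Q (b * z) \<noteq> 0" and lt: "cabs (f (b * z) - poly P (b * z) / poly Q (b * z)) < e / (cabs c + 1)"
      using PQ by auto
    have "c * f (b * z) - c * poly P (b * z) / poly Q (b * z) = c * (f (b * z) - poly P (b * z) / poly Q (b * z))"
      by (simp add: right_diff_distrib)
    then have "cabs (c * f (b * z) - c * poly P (b * z) / poly Q (b * z)) =
        cabs c * cabs (f (b * z) - poly P (b * z) / poly Q (b * z))"
      by (simp add: cabs_mult)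
    also have "\<dots> \<le> cabs c * (e / (cabs c + 1))" using lt by (intro mult_left_mono) auto
    also have "\<dots> < e"
      using e add_nonneg_pos[OF cabs_nonneg[of c] zero_less_one] by (simp add: pos_divide_less_eq)
    finally show "poly (pcompose Q [:0, b:]) z \<noteq> 0 \<and>
        cabs (c * f (b * z) - poly (smult c (pcompose P [:0, b:])) z / poly (pcompose Q [:0, b:]) z) < e"
      using Q by (simp add: poly_pcompose mult.commute)
  qed
qed

end

locale vmf_eval = Cinf_field q th for q :: nat and th :: "'c::{field,complete_space}" +
  fixes k m :: int and h1 h2 :: "'c \<Rightarrow> nat \<Rightarrow> 'c" and zeta :: 'c and p :: "'c poly" and l :: nat
  assumes vmf: "vmf q th k m h1 h2" and zeta: "zeta \<in> Fq_ac q"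
    and minpoly: "minpoly_Fq q zeta p" and l: "l < degree p"
begin

definition xi :: 'c where "xi = zeta ^ (q ^ l)"
definition f1 :: "'c \<Rightarrow> 'c" where "f1 z = ev (h1 z) xi"
definition f2 :: "'c \<Rightarrow> 'c" where "f2 z = ev (h2 z) xi"
definition at_xi :: "'c \<Rightarrow> 'c" where "at_xi a = poly (Apoly q th a) xi"
definition pp :: 'c where "pp = poly p th"

subsection \<open>Evaluation at \<open>\<xi> = \<zeta>^(q^l)\<close>\<close>

lemma cabs_xi: "cabs xi \<le> 1"
  unfolding xi_def cabs_power using cabs_le_1_Fq_ac[OF zeta] by (intro power_le_one) auto

lemma Fqpoly_p: "Fqpoly q p" and p_zeta: "poly p zeta = 0" and lead_p: "lead_coeff p = 1"
  and p_minimal: "Fqpoly q g \<Longrightarrow> g \<noteq> 0 \<Longrightarrow> poly g zeta = 0 \<Longrightarrow> degree p \<le> degree g"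
  using minpoly unfolding minpoly_Fq_def by blast+

lemma p_nonzero: "p \<noteq> 0"
  using lead_p by auto

lemma pp_Aset: "pp \<in> Aset q th"
  unfolding pp_def using Fqpoly_p by simp

lemma pp_nonzero: "pp \<noteq> 0"
  unfolding pp_def using th_transcendental[OF Fqpoly_p] p_nonzero by blast

lemma cabs_pp: "cabs pp \<ge> 1"
  using cabs_Aset_ge_1[OF pp_Aset pp_nonzero] .

lemma at_xi_eq: "a \<in> Aset q th \<Longrightarrow> at_xi a = poly (Apoly q th a) zeta ^ (q ^ l)"
  unfolding at_xi_def xi_def using Apoly by (simp add: poly_frobenius)

lemma at_xi_poly: "Fqpoly q a \<Longrightarrow> at_xi (poly a th) = poly a xi"
  by (simp add: at_xi_def Apoly_poly)

lemma at_xi_mult: "a \<in> Aset q th \<Longrightarrow> b \<in> Aset q th \<Longrightarrow> at_xi (a * b) = at_xi a * at_xi b"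
  by (elim AsetE) (simp add: at_xi_poly Fqpoly_mult flip: poly_mult)

lemma at_xi_diff: "a \<in> Aset q th \<Longrightarrow> b \<in> Aset q th \<Longrightarrow> at_xi (a - b) = at_xi a - at_xi b"
  by (elim AsetE) (simp add: at_xi_poly Fqpoly_diff flip: poly_diff)

lemma at_xi_Fqset: "a \<in> Fqset q \<Longrightarrow> at_xi a = a"
  using at_xi_poly[of "[:a:]"] by simp

lemma cabs_at_xi: "a \<in> Aset q th \<Longrightarrow> cabs (at_xi a) \<le> 1"
  unfolding at_xi_def using Apoly cabs_poly_le_1[OF cabs_xi] by blast

lemma at_xi_pp: "at_xi pp = 0"
proof -
  have "at_xi pp = poly p zeta ^ (q ^ l)"
    unfolding pp_def xi_def[symmetric] at_xi_poly[OF Fqpoly_p] unfolding xi_def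
    by (rule poly_frobenius[OF Fqpoly_p])
  then show ?thesis using p_zeta q_ge_2 by (simp add: power_0_left)
qed

lemma at_xi_pp_mult: "a \<in> Aset q th \<Longrightarrow> at_xi (pp * a) = 0"
  by (simp add: at_xi_mult pp_Aset at_xi_pp)

text \<open>The remainder on division by p also vanishes at \<zeta>, so it is 0 by minimality of the
  degree.\<close>

lemma pp_dvd:
  assumes a: "Fqpoly q a" "poly a zeta = 0"
  shows "\<exists>e\<in>Aset q th. poly a th = pp * e"
proof -
  obtain s r where sr: "Fqpoly q s" "Fqpoly q r" "a = p * s + r" "r = 0 \<or> degree r < degree p"
    using Fqpoly_division[OF Fqpoly_p p_nonzero a(1)] by blast
  have "poly r zeta = 0" using a(2) sr(3) p_zeta by simp
  then have "r = 0" using p_minimal[OF sr(2)] sr(4) by fastforce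
  then have "poly a th = pp * poly s th" using sr(3) by (simp add: pp_def)
  then show ?thesis using sr(1) by (intro bexI[of _ "poly s th"]) simp_all
qed

text \<open>c is invertible modulo p. The value y of its polynomial at \<zeta> lies in the field
  with q^n elements and is nonzero, so its inverse y^(q^n - 2) is again the value of a polynomial
  over F_q.\<close>

lemma exists_solution_mod_pp:
  assumes c: "c \<in> Aset q th" "\<not> (\<exists>e\<in>Aset q th. c = pp * e)" and d: "d \<in> Aset q th"
  shows "\<exists>x\<in>Aset q th. \<exists>y\<in>Aset q th. d - c * x = pp * y"
proof -
  obtain n where n: "n \<ge> 1" "zeta ^ (q ^ n) = zeta" using zeta by (auto simp: Fq_ac_def)
  obtain C where C: "Fqpoly q C" "c = poly C th" using c(1) by (rule AsetE)
  obtain D where D: "Fqpoly q D" "d = poly D th" using d by (rule AsetE)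
  define y where "y = poly C zeta"
  have y0: "y \<noteq> 0" using pp_dvd[OF C(1)] c(2) C(2) by (auto simp: y_def)
  have "y ^ (q ^ n) = y" unfolding y_def using poly_frobenius[OF C(1), of zeta n] n(2) by simp
  moreover have qn: "q ^ n \<ge> 2" using q_ge_2 n(1) self_le_power[of q n] by linarith
  then have "y ^ (q ^ n) = y * (y * y ^ (q ^ n - 2))"
    by (metis add_2_eq_Suc le_add_diff_inverse power_Suc)
  ultimately have inv: "y * y ^ (q ^ n - 2) = 1" using y0 by simp
  define X where "X = D * C ^ (q ^ n - 2)"
  have X: "Fqpoly q X" unfolding X_def using C D by (intro Fqpoly_mult Fqpoly_power)
  have "poly (D - C * X) zeta = poly D zeta - poly D zeta * (y * y ^ (q ^ n - 2))"
    by (simp add: X_def y_def)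
  then have "poly (D - C * X) zeta = 0" by (simp add: inv)
  moreover have "Fqpoly q (D - C * X)" using C D X by (intro Fqpoly_diff Fqpoly_mult)
  ultimately obtain e where "e \<in> Aset q th" "poly (D - C * X) th = pp * e" using pp_dvd by blast
  then show ?thesis using X C D by (intro bexI[of _ "poly X th"] bexI[of _ e]) simp_all
qed

section \<open>Transformation law and growth of the evaluated functions\<close>

lemma rigidT_h: "rigidT q th h1" "rigidT q th h2"
  using vmf[unfolded vmf_def, THEN conjunct1] vmf[unfolded vmf_def, THEN conjunct2, THEN conjunct1] .

lemma tate_h: "z \<in> Omega q th \<Longrightarrow> tate (h1 z)" "z \<in> Omega q th \<Longrightarrow> tate (h2 z)"
  using rigidT_h[unfolded rigidT_def] by blast+

lemma rigidC_f: "rigidC q th f1" "rigidC q th f2"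
  using rigidC_ev[OF rigidT_h(1) cabs_xi] rigidC_ev[OF rigidT_h(2) cabs_xi]
  unfolding f1_def[abs_def] f2_def[abs_def] .

lemma GL2A_D:
  assumes "(a, b, c, d) \<in> GL2A q th"
  shows "a \<in> Aset q th" "b \<in> Aset q th" "c \<in> Aset q th" "d \<in> Aset q th"
    "a * d - b * c \<in> Fqset q" "a * d - b * c \<noteq> 0"
  using assms by (simp_all add: GL2A_def)

lemma GL2A_jfac: "(a, b, c, d) \<in> GL2A q th \<Longrightarrow> z \<in> Omega q th \<Longrightarrow> c * z + d \<noteq> 0"
  using jfac_nonzero[of c d a b z] GL2A_D[of a b c d] Aset_Kinf by blast

lemma transform:
  assumes g: "(a, b, c, d) \<in> GL2A q th" and z: "z \<in> Omega q th"
  defines "s \<equiv> (c * z + d) powi k * (a * d - b * c) powi (- m) * inverse (a * d - b * c)"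
  shows "f1 (mob (a, b, c, d) z) = s * (at_xi d * f1 z - at_xi c * f2 z)"
    and "f2 (mob (a, b, c, d) z) = s * (at_xi a * f2 z - at_xi b * f1 z)"
proof -
  have "\<forall>g\<in>GL2A q th. \<forall>z\<in>Omega q th. (case g of (a,b,c,d) \<Rightarrow>
        h1 (mob g z) = tscal (jfac g z powi k * mdet g powi (- m) * inverse (mdet g))
                         (\<lambda>i. tmult (tA q th d) (h1 z) i - tmult (tA q th c) (h2 z) i) \<and>
        h2 (mob g z) = tscal (jfac g z powi k * mdet g powi (- m) * inverse (mdet g))
                         (\<lambda>i. tmult (tA q th a) (h2 z) i - tmult (tA q th b) (h1 z) i))"
    using vmf unfolding vmf_def by (elim conjE)
  from bspec[OF bspec[OF this g] z]
  have h: "h1 (mob (a, b, c, d) z) = tscal s (\<lambda>i. tmult (tA q th d) (h1 z) i - tmult (tA q th c) (h2 z) i)"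
    "h2 (mob (a, b, c, d) z) = tscal s (\<lambda>i. tmult (tA q th a) (h2 z) i - tmult (tA q th b) (h1 z) i)"
    by (simp_all add: s_def jfac_def mdet_def)
  have ev: "ev (tscal s (\<lambda>i. tmult (tA q th x) u i - tmult (tA q th y) v i)) xi =
      s * (at_xi x * ev u xi - at_xi y * ev v xi)" if "tate u" "tate v" for x y u v
    using that cabs_xi
    by (simp add: ev_tscal ev_diff ev_tmult tate_diff tate_tmult tate_tA ev_tA at_xi_def)
  show "f1 (mob (a, b, c, d) z) = s * (at_xi d * f1 z - at_xi c * f2 z)"
    "f2 (mob (a, b, c, d) z) = s * (at_xi a * f2 z - at_xi b * f1 z)"
    unfolding f1_def f2_def h using tate_h[OF z] by (simp_all add: ev)
qed

lemma translate:
  assumes "a \<in> Aset q th" "z \<in> Omega q th"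
  shows "f1 (z + a) = f1 z" "f2 (z + a) = f2 z - at_xi a * f1 z"
proof -
  have "(1, a, 0, 1) \<in> GL2A q th" using assms by (simp add: GL2A_def)
  from transform[OF this assms(2)] show "f1 (z + a) = f1 z" "f2 (z + a) = f2 z - at_xi a * f1 z"
    using at_xi_Fqset[of 1] at_xi_Fqset[of 0] by (simp_all add: mob_def)
qed

lemma lim_f1: "tends0Im q th (\<lambda>z. cabs (f1 z))"
proof (rule tends0Im_le)
  show "tends0Im q th (\<lambda>z. gnorm (h1 z))" using vmf unfolding vmf_def by (elim conjE)
  show "\<bar>cabs (f1 z)\<bar> \<le> gnorm (h1 z)" if "z \<in> Omega q th" for z
    using cabs_ev_le_gnorm[OF tate_h(1)[OF that] cabs_xi] by (simp add: f1_def)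
qed

lemma lim_f2: "tends0Im q th (\<lambda>z. cabs (uC q th z * f2 z))"
proof (rule tends0Im_le)
  show "tends0Im q th (\<lambda>z. gnorm (tscal (uC q th z) (h2 z)))" using vmf unfolding vmf_def by (elim conjE)
  show "\<bar>cabs (uC q th z * f2 z)\<bar> \<le> gnorm (tscal (uC q th z) (h2 z))" if "z \<in> Omega q th" for z
  proof -
    have "tate (tscal (uC q th z) (h2 z))"
      using tate_cmult[OF tate_h(2)[OF that]] by (simp add: tscal_def)
    from cabs_ev_le_gnorm[OF this cabs_xi] show ?thesis
      using ev_tscal[OF tate_h(2)[OF that] cabs_xi] by (simp add: f2_def)
  qed
qed

text \<open>High up, the limit of \<open>f1\<close> and \<open>bounded_at_infinity\<close> apply.
  The remaining strip is covered by A-translates of one affinoid, and translation only adds a(\<xi>)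
  \<open>f1\<close> with |a(\<xi>)| \<le> 1.\<close>

lemma f_bounded:
  assumes "\<epsilon> > 0"
  shows "\<exists>B. \<forall>z. imnorm q th z \<ge> \<epsilon> \<longrightarrow> cabs (f1 z) \<le> B \<and> cabs (f2 z) \<le> B"
proof -
  obtain B2 where B2: "\<forall>z. imnorm q th z \<ge> 1 \<longrightarrow> cabs (f2 z) \<le> B2"
    using bounded_at_infinity[OF rigidC_f cabs_at_xi translate(2) lim_f1 lim_f2] by blast
  obtain R where R: "\<forall>z\<in>Omega q th. imnorm q th z \<ge> R \<longrightarrow> \<bar>cabs (f1 z)\<bar> < 1"
    using lim_f1 unfolding tends0Im_def by (meson zero_less_one)
  obtain n where n: "\<forall>z. \<epsilon> \<le> imnorm q th z \<and> imnorm q th z < max 1 R \<longrightarrow> (\<exists>a\<in>Aset q th. z - a \<in> Omega_n q th n)"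
    using translate_to_Omega_n[OF assms] by blast
  obtain C1 where C1: "\<forall>z\<in>Omega_n q th n. cabs (f1 z) \<le> C1" using rigidC_bounded[OF rigidC_f(1)] by blast
  obtain C2 where C2: "\<forall>z\<in>Omega_n q th n. cabs (f2 z) \<le> C2" using rigidC_bounded[OF rigidC_f(2)] by blast
  define B where "B = max (max 1 B2) (max C1 C2)"
  have "cabs (f1 z) \<le> B \<and> cabs (f2 z) \<le> B" if z: "imnorm q th z \<ge> \<epsilon>" for z
  proof (cases "imnorm q th z < max 1 R")
    case True
    then obtain a where a: "a \<in> Aset q th" "z - a \<in> Omega_n q th n" using n z by blast
    have \<Omega>: "z - a \<in> Omega q th" using Omega_n_Omega[OF a(2)] .
    have c: "cabs (f1 (z - a)) \<le> B" "cabs (f2 (z - a)) \<le> B"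
      using C1 C2 a(2) by (fastforce simp: B_def)+
    have "cabs (at_xi a * f1 (z - a)) \<le> 1 * B"
      unfolding cabs_mult using cabs_at_xi[OF a(1)] c(1) by (intro mult_mono) auto
    then have "cabs (f2 (z - a) - at_xi a * f1 (z - a)) \<le> B" using c(2) by (intro cabs_diff_leI) auto
    then show ?thesis using translate[OF a(1) \<Omega>] c by simp
  next
    case False
    have "z \<in> Omega q th" using z assms by (intro imnorm_ge_Omega)
    then have "cabs (f1 z) < 1" "cabs (f2 z) \<le> B2" using R B2 False by auto
    then show ?thesis unfolding B_def by linarith
  qed
  then show ?thesis by blast
qed

subsection \<open>The two modular forms\<close>

text \<open>The inverse determinant in the representation joins det^(-m), so type m + 1 cancels the
  determinant exactly.\<close>

lemma slash_f1:
  assumes g: "(a, b, c, d) \<in> GL2A q th" and z: "z \<in> Omega q th"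
  shows "slash k (m + 1) (a, b, c, d) f1 z = at_xi d * f1 z - at_xi c * f2 z"
  using GL2A_D(6)[OF g] GL2A_jfac[OF g z]
  unfolding slash_def transform(1)[OF g z]
  by (simp add: mdet_def jfac_def power_int_add power_int_minus field_simps)

text \<open>On \<open>Gamma0\<close> the \<open>f2\<close> term has coefficient c(\<xi>) = 0,
  leaving d(\<xi>). Since \<open>slash_f1\<close> holds on all of GL_2(A), the bounds on
  \<open>f1\<close> and \<open>f2\<close> settle every cusp at once.\<close>

lemma mfchar_f1: "mfchar q th p zeta k (m + 1) (int (q ^ l)) f1"
proof -
  have \<Gamma>0: "slash k (m + 1) g f1 z = eta q th zeta g powi int (q ^ l) * f1 z"
    if g: "g \<in> Gamma0 q th p" and z: "z \<in> Omega q th" for g z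
  proof -
    obtain a b c d where g': "g = (a, b, c, d)" by (cases g)
    obtain e where e: "e \<in> Aset q th" "c = pp * e" and gl: "(a, b, c, d) \<in> GL2A q th"
      using g by (auto simp: Gamma0_def g' pp_def)
    have "at_xi c = 0" using at_xi_pp_mult e by simp
    then show ?thesis
      using slash_f1[OF gl z] GL2A_D(4)[OF gl]
      by (simp add: g' eta_def at_xi_eq power_int_of_nat del: of_nat_power)
  qed
  have bound: "\<exists>B. \<forall>z\<in>Omega q th. imnorm q th z \<ge> 1 \<longrightarrow> cabs (slash k (m + 1) g f1 z) \<le> B"
    if g: "g \<in> GL2A q th" for g
  proof -
    obtain a b c d where g': "g = (a, b, c, d)" by (cases g)
    note gl = g[unfolded g']
    obtain B where B: "\<forall>z. imnorm q th z \<ge> 1 \<longrightarrow> cabs (f1 z) \<le> B \<and> cabs (f2 z) \<le> B"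
      using f_bounded[of 1] by auto
    have "cabs (slash k (m + 1) g f1 z) \<le> B" if z: "z \<in> Omega q th" "imnorm q th z \<ge> 1" for z
    proof -
      have "cabs (at_xi d * f1 z) \<le> 1 * B" "cabs (at_xi c * f2 z) \<le> 1 * B"
        unfolding cabs_mult using B z(2) cabs_at_xi[OF GL2A_D(3)[OF gl]] cabs_at_xi[OF GL2A_D(4)[OF gl]]
        by (intro mult_mono; simp)+
      then show ?thesis unfolding g' slash_f1[OF gl z(1)] by (intro cabs_diff_leI) auto
    qed
    then show ?thesis by blast
  qed
  have \<Gamma>1: "slash k (m + 1) g f1 z = f1 z" if "g \<in> Gamma1 q th p zeta" "z \<in> Omega q th" for g z
    using that \<Gamma>0[of g z] by (simp add: Gamma1_def)
  show ?thesis
    unfolding mfchar_def mfG_def using rigidC_f(1) \<Gamma>0 \<Gamma>1 bound by (intro conjI ballI)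
qed

section \<open>The slash by the level matrices\<close>

lemma slash_alpha: "slash k m (alpha_p th p) f z = pp powi m * f (pp * z)"
  by (simp add: slash_def alpha_p_def mdet_def jfac_def mob_def pp_def)

lemma Omega_pp: "z \<in> Omega q th \<Longrightarrow> pp * z \<in> Omega q th"
  using Omega_affine[of pp 0 z] Aset_Kinf pp_Aset pp_nonzero by simp

text \<open>\<open>W_p\<close> is (0, -1; 1, 0) times \<open>alpha_p\<close>. The first factor has
  determinant 1, so slashing in type m is compatible with the law of \<open>f1\<close>.\<close>

lemma slash_W:
  assumes z: "z \<in> Omega q th"
  shows "slash k m (W_p th p) f1 z = - slash k m (alpha_p th p) f2 z"
proof -
  have w: "pp * z \<in> Omega q th" using Omega_pp[OF z] .
  then have w0: "pp * z \<noteq> 0" using Omega_not_Kinf Aset_Kinf[OF Aset_0] by metis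
  have g: "(0, - 1, 1, 0) \<in> GL2A q th" by (simp add: GL2A_def Aset_minus)
  have "mob (W_p th p) z = mob (0, - 1, 1, 0) (pp * z)"
    by (simp add: mob_def W_p_def pp_def)
  then have "f1 (mob (W_p th p) z) = (pp * z) powi k * (- f2 (pp * z))"
    using transform(1)[OF g w] at_xi_Fqset[of 1] at_xi_Fqset[of 0] by simp
  then show ?thesis
    using w0 unfolding slash_alpha
    by (simp add: slash_def W_p_def mdet_def jfac_def pp_def[symmetric] power_int_minus)
qed

definition F :: "'c \<Rightarrow> 'c" where
  "F z = - slash k m (alpha_p th p) f2 z"

lemma F_eq: "F z = - (pp powi m) * f2 (pp * z)"
  by (simp add: F_def slash_alpha)

text \<open>With c = pe one has \<alpha>(a, b; c, d) = (a, pb; e, d)\<alpha>, and (pb)(\<xi>) = 0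
  removes \<open>f1\<close>. Evaluating the determinant at \<xi> gives a(\<xi>) d(\<xi>) = D, which
  turns a(\<xi>)/D into 1/d(\<xi>).\<close>

lemma slash_F_Gamma0:
  assumes g: "(a, b, c, d) \<in> GL2A q th" and e: "e \<in> Aset q th" "c = pp * e" and z: "z \<in> Omega q th"
  shows "slash k m (a, b, c, d) F z = inverse (at_xi d) * F z" and "at_xi d \<noteq> 0"
proof -
  define D where "D = a * d - b * c"
  have D: "D \<in> Fqset q" "D \<noteq> 0" using GL2A_D(5,6)[OF g] by (simp_all add: D_def)
  note A = GL2A_D(1-4)[OF g]
  have "at_xi D = at_xi a * at_xi d - at_xi b * at_xi c"
    unfolding D_def using A by (simp add: at_xi_diff at_xi_mult Aset_mult)
  then have ad: "at_xi a * at_xi d = D"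
    using at_xi_Fqset[OF D(1)] at_xi_pp_mult[OF e(1)] e(2) by simp
  then show d0: "at_xi d \<noteq> 0" using D(2) by auto
  have g': "(a, pp * b, e, d) \<in> GL2A q th"
    using A e pp_Aset g by (auto simp: GL2A_def Aset_mult mult_ac)
  have w: "pp * z \<in> Omega q th" using Omega_pp[OF z] .
  have "pp * mob (a, b, c, d) z = mob (a, pp * b, e, d) (pp * z)"
    by (simp add: mob_def e(2) algebra_simps)
  then have "f2 (pp * mob (a, b, c, d) z) =
      (e * (pp * z) + d) powi k * (a * d - pp * b * e) powi (- m) * inverse (a * d - pp * b * e) *
      (at_xi a * f2 (pp * z) - at_xi (pp * b) * f1 (pp * z))"
    using transform(2)[OF g' w] by simp
  also have "e * (pp * z) + d = c * z + d" by (simp add: e(2) mult_ac)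
  also have "a * d - pp * b * e = D" by (simp add: D_def e(2) mult_ac)
  finally have *: "f2 (pp * mob (a, b, c, d) z) =
      (c * z + d) powi k * D powi (- m) * inverse D * (at_xi a * f2 (pp * z))"
    using at_xi_pp_mult[OF A(2)] by simp
  have "slash k m (a, b, c, d) F z = inverse D * at_xi a * F z"
    unfolding slash_def F_eq *
    using D(2) GL2A_jfac[OF g z]
    by (simp add: mdet_def jfac_def D_def[symmetric] power_int_minus field_simps)
  also have "inverse D * at_xi a = inverse (at_xi d)"
    using ad d0 D(2) by (simp add: field_simps)
  finally show "slash k m (a, b, c, d) F z = inverse (at_xi d) * F z" .
qed

text \<open>The two cases are the two types of cusps of \<open>Gamma0\<close>. If p divides c, F is
  only multiplied by a constant. Otherwise the factorisation \<alpha>\<gamma> = (pa, b - ax; c,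
  y)(1, x; 0, p) expresses the slash through \<open>f1\<close> alone.\<close>

lemma slash_F_bounded:
  assumes g: "(a, b, c, d) \<in> GL2A q th"
  shows "\<exists>B. \<forall>z\<in>Omega q th. imnorm q th z \<ge> 1 \<longrightarrow> cabs (slash k m (a, b, c, d) F z) \<le> B"
proof (cases "\<exists>e\<in>Aset q th. c = pp * e")
  case True
  then obtain e where e: "e \<in> Aset q th" "c = pp * e" by blast
  obtain B where B: "\<forall>z. imnorm q th z \<ge> 1 \<longrightarrow> cabs (f1 z) \<le> B \<and> cabs (f2 z) \<le> B"
    using f_bounded[of 1] by auto
  have "cabs (slash k m (a, b, c, d) F z) \<le> inverse (cabs (at_xi d)) * (cabs (pp powi m) * B)"
    if z: "z \<in> Omega q th" "imnorm q th z \<ge> 1" for z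
  proof -
    have "imnorm q th (pp * z) = cabs pp * imnorm q th z"
      using imnorm_affine[of pp 0 z] Aset_Kinf pp_Aset pp_nonzero by simp
    moreover have "1 * 1 \<le> cabs pp * imnorm q th z"
      using z(2) cabs_pp by (intro mult_mono) auto
    ultimately have "cabs (f2 (pp * z)) \<le> B" using B by simp
    then show ?thesis
      unfolding slash_F_Gamma0(1)[OF g e z(1)] F_eq cabs_mult cabs_inverse cabs_minus
      by (intro mult_left_mono) auto
  qed
  then show ?thesis by blast
next
  case False
  note A = GL2A_D(1-4)[OF g]
  define D where "D = a * d - b * c"
  have D: "D \<in> Fqset q" "D \<noteq> 0" using GL2A_D(5,6)[OF g] by (simp_all add: D_def)
  \<comment> \<open>The choice of x makes d - cx divisible by p, so that the left factor has entries
    in A and determinant D.\<close>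
  obtain x y where x: "x \<in> Aset q th" and y: "y \<in> Aset q th" and xy: "d - c * x = pp * y"
    using exists_solution_mod_pp[OF A(3) False A(4)] by blast
  have d: "d = c * x + pp * y" using xy by (simp add: algebra_simps)
  have det: "pp * a * y - (b - a * x) * c = D" unfolding D_def d by (simp add: algebra_simps)
  have g': "(pp * a, b - a * x, c, y) \<in> GL2A q th"
    using A x y pp_Aset det D by (auto simp: GL2A_def intro!: Aset_mult Aset_diff)
  have bx: "b - a * x \<in> Aset q th" using A x by (intro Aset_diff Aset_mult)
  obtain B where B: "\<forall>z. imnorm q th z \<ge> inverse (cabs pp) \<longrightarrow> cabs (f1 z) \<le> B \<and> cabs (f2 z) \<le> B"
    using f_bounded[of "inverse (cabs pp)"] pp_nonzero by auto
  have "cabs (slash k m (a, b, c, d) F z) \<le> cabs (pp powi m * inverse (pp powi k) * inverse D) * B"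
    if z: "z \<in> Omega q th" "imnorm q th z \<ge> 1" for z
  proof -
    \<comment> \<open>The image of z under (1, x; 0, p). Its height is that of z divided by |p|,
      hence the threshold 1/|p| in the bound B.\<close>
    define w where "w = inverse pp * z + x / pp"
    have Ki: "inverse pp \<in> Kinf q th" "x / pp \<in> Kinf q th" "inverse pp \<noteq> 0"
      using Aset_Kinf[OF pp_Aset] Aset_Kinf[OF x] pp_nonzero by (auto intro: Kinf_inverse Kinf_divide)
    have w: "w \<in> Omega q th" unfolding w_def using Ki z(1) by (intro Omega_affine)
    have "imnorm q th w = inverse (cabs pp) * imnorm q th z"
      unfolding w_def using imnorm_affine[OF Ki] by (simp add: cabs_inverse)
    then have "inverse (cabs pp) \<le> imnorm q th w"
      using z(2) mult_left_mono[of 1 "imnorm q th z" "inverse (cabs pp)"] by simp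
    then have f1w: "cabs (f1 w) \<le> B" using B by blast
    have j: "c * z + d \<noteq> 0" using GL2A_jfac[OF g z(1)] .
    have pw: "pp * w = z + x" using pp_nonzero by (simp add: w_def field_simps)
    have jw: "c * w + y = (c * z + d) / pp"
    proof -
      have "pp * (c * w + y) = c * (pp * w) + pp * y" by (simp add: algebra_simps)
      also have "\<dots> = c * z + d" unfolding pw d by (simp add: algebra_simps)
      finally show ?thesis using pp_nonzero by (simp add: field_simps)
    qed
    have "pp * a * w + (b - a * x) = a * z + b"
    proof -
      have "pp * a * w = a * (pp * w)" by (simp add: mult_ac)
      then show ?thesis unfolding pw by (simp add: algebra_simps)
    qed
    then have "pp * mob (a, b, c, d) z = mob (pp * a, b - a * x, c, y) w"
      using pp_nonzero j by (simp add: mob_def jw)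
    then have *: "f2 (pp * mob (a, b, c, d) z) =
        ((c * z + d) / pp) powi k * D powi (- m) * inverse D * (- (at_xi (b - a * x) * f1 w))"
      using transform(2)[OF g' w] at_xi_pp_mult[OF A(1)] unfolding jw det by simp
    have "slash k m (a, b, c, d) F z =
        pp powi m * inverse (pp powi k) * inverse D * (at_xi (b - a * x) * f1 w)"
      unfolding slash_def F_eq * using D(2) j pp_nonzero
      by (simp add: mdet_def jfac_def D_def[symmetric] power_int_minus power_int_divide_distrib field_simps)
    moreover have "cabs (at_xi (b - a * x) * f1 w) \<le> 1 * B"
      unfolding cabs_mult using cabs_at_xi[OF bx] f1w by (intro mult_mono) auto
    ultimately show ?thesis
      by (simp only: cabs_mult[of "pp powi m * inverse (pp powi k) * inverse D"]) (intro mult_left_mono, auto)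
  qed
  then show ?thesis by blast
qed

lemma mfchar_F: "mfchar q th p zeta k m (- int (q ^ l)) F"
proof -
  have \<Gamma>0: "slash k m g F z = eta q th zeta g powi (- int (q ^ l)) * F z"
    if g: "g \<in> Gamma0 q th p" and z: "z \<in> Omega q th" for g z
  proof -
    obtain a b c d where g': "g = (a, b, c, d)" by (cases g)
    obtain e where e: "e \<in> Aset q th" "c = pp * e" and gl: "(a, b, c, d) \<in> GL2A q th"
      using g by (auto simp: Gamma0_def g' pp_def)
    show ?thesis
      using slash_F_Gamma0(1)[OF gl e z] GL2A_D(4)[OF gl]
      by (simp add: g' eta_def at_xi_eq power_int_minus power_int_of_nat del: of_nat_power)
  qed
  have bound: "\<exists>B. \<forall>z\<in>Omega q th. imnorm q th z \<ge> 1 \<longrightarrow> cabs (slash k m g F z) \<le> B"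
    if "g \<in> GL2A q th" for g
    using that slash_F_bounded by (cases g) blast
  have \<Gamma>1: "slash k m g F z = F z" if "g \<in> Gamma1 q th p zeta" "z \<in> Omega q th" for g z
    using that \<Gamma>0[of g z] by (simp add: Gamma1_def)
  have "rigidC q th F"
    unfolding F_eq[abs_def] by (rule rigidC_scale[OF rigidC_f(2) pp_Aset pp_nonzero])
  then show ?thesis
    unfolding mfchar_def mfG_def using \<Gamma>0 \<Gamma>1 bound by (intro conjI ballI)
qed

end

theorem proposition4p8:
  fixes q :: nat and th :: "'c::{field,complete_space}" and k m :: int
    and h1 h2 :: "'c \<Rightarrow> nat \<Rightarrow> 'c" and zeta :: 'c and p :: "'c poly" and l :: nat
  assumes "is_Cinf q th"
    and "vmf q th k m h1 h2"
    and "zeta \<in> Fq_ac q"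
    and "minpoly_Fq q zeta p"
    and "l < degree p"
  shows "mfchar q th p zeta k (m + 1) (int (q ^ l)) (\<lambda>z. ev (h1 z) (zeta ^ (q ^ l)))
       \<and> (\<forall>z\<in>Omega q th. slash k m (W_p th p) (\<lambda>w. ev (h1 w) (zeta ^ (q ^ l))) z
                          = - slash k m (alpha_p th p) (\<lambda>w. ev (h2 w) (zeta ^ (q ^ l))) z)
       \<and> mfchar q th p zeta k m (- int (q ^ l))
           (\<lambda>z. - slash k m (alpha_p th p) (\<lambda>w. ev (h2 w) (zeta ^ (q ^ l))) z)"
proof -
  interpret vmf_eval q th k m h1 h2 zeta p l
    using assms by unfold_locales
  have f: "f1 = (\<lambda>z. ev (h1 z) (zeta ^ (q ^ l)))" "f2 = (\<lambda>z. ev (h2 z) (zeta ^ (q ^ l)))"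
    by (simp_all add: fun_eq_iff f1_def f2_def xi_def)
  show ?thesis
    using mfchar_f1 slash_W mfchar_F unfolding F_def[abs_def] f by (intro conjI ballI)
qed

end
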